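(* For $m\ge3$ odd, $\mathrm{HH}^0(A)$ has the following decomposition into indecomposable $\mathrm{HH}^1(A)$-modules: $$\mathrm{HH}^0(A)=\langle1\rangle\oplus\bigoplus_{i\in\mathbb Z/m\mathbb Z}\langle f_i^s,\ \varepsilon_i+\varepsilon_{i+1}\mid1\le s\le N-1\rangle.$$
   Context: Fix integers $N\ge1$, $m\ge3$ and a field $k$ whose characteristic does not divide $2$, $N$ or $m$. $Q$ is the quiver with vertex set $\mathbb Z/m\mathbb Z$ and arrows $a_i:i\to i+1$, $\bar a_i:i+1\to i$ ($i\in\mathbb Z/m\mathbb Z$); paths are composed from left to right, indices are modulo $m$. $A=kQ/\langle a_ia_{i+1},\ \bar a_{i+1}\bar a_i,\ (a_i\bar a_i)^N-(\bar a_{i-1}a_{i-1})^N\mid i\in\mathbb Z/m\mathbb Z\rangle$. $\mathrm{HH}^0(A)$ is the center of $A$, with $k$-basis $\{1,\varepsilon_i,f_i^s\mid i\in\mathbb Z/m\mathbb Z,\ 1\le s\le N-1\}$, where $\varepsilon_i=(a_i\bar a_i)^N$ and $f_i=a_i\bar a_i+\bar a_ia_i$. $\mathrm{HH}^1(A)$ is the Lie algebra of derivations of $A$ modulo inner derivations (with the commutator bracket); it acts on $\mathrm{HH}^0(A)$ by the Gerstenhaber bracket, i.e. $[f,z]=f(z)$ for a derivation $f$ and a central element $z$. It has $k$-basis the classes of the derivations $\varphi_{1,0}$ ($a_i\mapsto a_i$, $\bar a_i\mapsto0$), $\psi_{1,0}$ ($a_i\mapsto0$, $\bar a_i\mapsto-\bar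 a_i$), and $E_{1,j,s}$ for $j\in\mathbb Z/m\mathbb Z$, $1\le s\le N-1$ ($a_j\mapsto a_j(\bar a_ja_j)^s$, all other arrows $\mapsto0$). $\langle\ldots\rangle$ denotes $k$-linear span. *)

theory Defs
  imports
    "HOL-Algebra.Algebra"
    "HOL-Algebra.Algebraic_Closure_Type"
    "HOL-Library.Poly_Mapping"
    "Graph_Theory.Arc_Walk"
begin

section \<open>Algebras over a field\<close>

text \<open>
  The ground field is a type \<open>'k\<close> of class \<^class>\<open>field\<close>; as a ring in the sense of
  HOL-Algebra it is \<^const>\<open>ring_of_type_algebra\<close>. An algebra, associative or not, is a record
  \<^typ>\<open>('k, 'b) module\<close> whose field \<open>mult\<close> is the product. For a Lie algebra, \<open>mult\<close> is the
  bracket, and the field \<open>one\<close> is irrelevant.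
\<close>

definition linear_span :: "('k::field, 'b) module \<Rightarrow> 'b set \<Rightarrow> 'b set" where
  "linear_span V S = \<Inter> {U. submodule U (ring_of_type_algebra :: 'k ring) V \<and> S \<subseteq> U}"

definition quotient_algebra :: "('k, 'b) module \<Rightarrow> 'b set \<Rightarrow> ('k, 'b set) module" where
  "quotient_algebra B I =
     \<lparr>carrier = carrier (B Quot I), monoid.mult = monoid.mult (B Quot I), monoid.one = monoid.one (B Quot I),
      ring.zero = ring.zero (B Quot I), ring.add = ring.add (B Quot I),
      module.smult = (\<lambda>c C. \<Union>x\<in>C. I +>\<^bsub>B\<^esub> (c \<odot>\<^bsub>B\<^esub> x))\<rparr>"

section \<open>Lie algebras and their modules\<close>

locale lie_algebra = module R L for R (structure) and L (structure) +
  assumes bracket_closed: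
      "\<lbrakk>x \<in> carrier L; y \<in> carrier L\<rbrakk> \<Longrightarrow> x \<otimes>\<^bsub>L\<^esub> y \<in> carrier L"
    and bracket_add_left:
      "\<lbrakk>x \<in> carrier L; y \<in> carrier L; z \<in> carrier L\<rbrakk> \<Longrightarrow>
        (x \<oplus>\<^bsub>L\<^esub> y) \<otimes>\<^bsub>L\<^esub> z = (x \<otimes>\<^bsub>L\<^esub> z) \<oplus>\<^bsub>L\<^esub> (y \<otimes>\<^bsub>L\<^esub> z)"
    and bracket_add_right:
      "\<lbrakk>x \<in> carrier L; y \<in> carrier L; z \<in> carrier L\<rbrakk> \<Longrightarrow>
        x \<otimes>\<^bsub>L\<^esub> (y \<oplus>\<^bsub>L\<^esub> z) = (x \<otimes>\<^bsub>L\<^esub> y) \<oplus>\<^bsub>L\<^esub> (x \<otimes>\<^bsub>L\<^esub> z)"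
    and bracket_smult_left:
      "\<lbrakk>c \<in> carrier R; x \<in> carrier L; y \<in> carrier L\<rbrakk> \<Longrightarrow>
        (c \<odot>\<^bsub>L\<^esub> x) \<otimes>\<^bsub>L\<^esub> y = c \<odot>\<^bsub>L\<^esub> (x \<otimes>\<^bsub>L\<^esub> y)"
    and bracket_smult_right:
      "\<lbrakk>c \<in> carrier R; x \<in> carrier L; y \<in> carrier L\<rbrakk> \<Longrightarrow>
        x \<otimes>\<^bsub>L\<^esub> (c \<odot>\<^bsub>L\<^esub> y) = c \<odot>\<^bsub>L\<^esub> (x \<otimes>\<^bsub>L\<^esub> y)"
    and bracket_self: "x \<in> carrier L \<Longrightarrow> x \<otimes>\<^bsub>L\<^esub> x = \<zero>\<^bsub>L\<^esub>"
    and jacobi: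
      "\<lbrakk>x \<in> carrier L; y \<in> carrier L; z \<in> carrier L\<rbrakk> \<Longrightarrow>
        (x \<otimes>\<^bsub>L\<^esub> (y \<otimes>\<^bsub>L\<^esub> z)) \<oplus>\<^bsub>L\<^esub> ((y \<otimes>\<^bsub>L\<^esub> (z \<otimes>\<^bsub>L\<^esub> x)) \<oplus>\<^bsub>L\<^esub> (z \<otimes>\<^bsub>L\<^esub> (x \<otimes>\<^bsub>L\<^esub> y))) = \<zero>\<^bsub>L\<^esub>"

locale lie_module = L: lie_algebra R L + V: module R V
  for R (structure) and L (structure) and V (structure) and act +
  assumes act_closed: "\<lbrakk>x \<in> carrier L; v \<in> carrier V\<rbrakk> \<Longrightarrow> act x v \<in> carrier V"
    and act_add_left:
      "\<lbrakk>x \<in> carrier L; y \<in> carrier L; v \<in> carrier V\<rbrakk> \<Longrightarrow>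
        act (x \<oplus>\<^bsub>L\<^esub> y) v = act x v \<oplus>\<^bsub>V\<^esub> act y v"
    and act_add_right:
      "\<lbrakk>x \<in> carrier L; v \<in> carrier V; w \<in> carrier V\<rbrakk> \<Longrightarrow>
        act x (v \<oplus>\<^bsub>V\<^esub> w) = act x v \<oplus>\<^bsub>V\<^esub> act x w"
    and act_smult_left:
      "\<lbrakk>c \<in> carrier R; x \<in> carrier L; v \<in> carrier V\<rbrakk> \<Longrightarrow>
        act (c \<odot>\<^bsub>L\<^esub> x) v = c \<odot>\<^bsub>V\<^esub> act x v"
    and act_smult_right:
      "\<lbrakk>c \<in> carrier R; x \<in> carrier L; v \<in> carrier V\<rbrakk> \<Longrightarrow>
        act x (c \<odot>\<^bsub>V\<^esub> v) = c \<odot>\<^bsub>V\<^esub> act x v"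
    and act_bracket:
      "\<lbrakk>x \<in> carrier L; y \<in> carrier L; v \<in> carrier V\<rbrakk> \<Longrightarrow>
        act (x \<otimes>\<^bsub>L\<^esub> y) v = act x (act y v) \<ominus>\<^bsub>V\<^esub> act y (act x v)"

locale lie_submodule = submodule U R V
  for U and R (structure) and L (structure) and V (structure) and act +
  assumes act_stable: "\<lbrakk>x \<in> carrier L; u \<in> U\<rbrakk> \<Longrightarrow> act x u \<in> U"

definition indecomposable_lie_module ::
  "'k ring \<Rightarrow> ('k, 'l) module \<Rightarrow> ('k, 'v) module \<Rightarrow> ('l \<Rightarrow> 'v \<Rightarrow> 'v) \<Rightarrow> bool" where
  "indecomposable_lie_module R L V act \<longleftrightarrow>
     lie_module R L V act \<and> carrier V \<noteq> {\<zero>\<^bsub>V\<^esub>} \<and>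
     (\<forall>U W. lie_submodule U R L V act \<and> lie_submodule W R L V act \<and>
        U \<inter> W = {\<zero>\<^bsub>V\<^esub>} \<and> U <+>\<^bsub>V\<^esub> W = carrier V \<longrightarrow>
        U = {\<zero>\<^bsub>V\<^esub>} \<or> W = {\<zero>\<^bsub>V\<^esub>})"

text \<open>Internal direct sum of a finite family of subsets, which will be submodules.\<close>

definition internal_direct_sum :: "('k, 'v) module \<Rightarrow> 'i set \<Rightarrow> ('i \<Rightarrow> 'v set) \<Rightarrow> bool" where
  "internal_direct_sum V I W \<longleftrightarrow>
     finite I \<and> (\<forall>i\<in>I. W i \<subseteq> carrier V) \<and>
     (\<forall>v\<in>carrier V. \<exists>!w. w \<in> (\<Pi>\<^sub>E i\<in>I. W i) \<and> v = (\<Oplus>\<^bsub>V\<^esub>i\<in>I. w i))"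

definition indecomposable_decomposition ::
  "'k ring \<Rightarrow> ('k, 'l) module \<Rightarrow> ('k, 'v) module \<Rightarrow> ('l \<Rightarrow> 'v \<Rightarrow> 'v) \<Rightarrow>
   'i set \<Rightarrow> ('i \<Rightarrow> 'v set) \<Rightarrow> bool" where
  "indecomposable_decomposition R L V act I W \<longleftrightarrow>
     lie_module R L V act \<and> internal_direct_sum V I W \<and>
     (\<forall>i\<in>I. lie_submodule (W i) R L V act \<and>
        indecomposable_lie_module R L (V\<lparr>carrier := W i\<rparr>) act)"

section \<open>Hochschild cohomology in degrees 0 and 1\<close>

definition HH0 :: "('k, 'b) module \<Rightarrow> ('k, 'b) module" where
  "HH0 B = B\<lparr>carrier := {z \<in> carrier B. \<forall>x\<in>carrier B. z \<otimes>\<^bsub>B\<^esub> x = x \<otimes>\<^bsub>B\<^esub> z}\<rparr>"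

definition is_derivation :: "('k, 'b) module \<Rightarrow> ('b \<Rightarrow> 'b) \<Rightarrow> bool" where
  "is_derivation B d \<longleftrightarrow>
     d \<in> carrier B \<rightarrow>\<^sub>E carrier B \<and>
     (\<forall>x\<in>carrier B. \<forall>y\<in>carrier B. d (x \<oplus>\<^bsub>B\<^esub> y) = d x \<oplus>\<^bsub>B\<^esub> d y) \<and>
     (\<forall>c. \<forall>x\<in>carrier B. d (c \<odot>\<^bsub>B\<^esub> x) = c \<odot>\<^bsub>B\<^esub> d x) \<and>
     (\<forall>x\<in>carrier B. \<forall>y\<in>carrier B.
        d (x \<otimes>\<^bsub>B\<^esub> y) = (d x \<otimes>\<^bsub>B\<^esub> y) \<oplus>\<^bsub>B\<^esub> (x \<otimes>\<^bsub>B\<^esub> d y))"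

definition derivations :: "('k, 'b) module \<Rightarrow> ('k, 'b \<Rightarrow> 'b) module" where
  "derivations B =
     \<lparr>carrier = {d. is_derivation B d},
      monoid.mult = (\<lambda>d e. \<lambda>x\<in>carrier B. d (e x) \<ominus>\<^bsub>B\<^esub> e (d x)),
      monoid.one = undefined,
      ring.zero = (\<lambda>x\<in>carrier B. \<zero>\<^bsub>B\<^esub>),
      ring.add = (\<lambda>d e. \<lambda>x\<in>carrier B. d x \<oplus>\<^bsub>B\<^esub> e x),
      module.smult = (\<lambda>c d. \<lambda>x\<in>carrier B. c \<odot>\<^bsub>B\<^esub> d x)\<rparr>"

definition inner_derivations :: "('k, 'b) module \<Rightarrow> ('b \<Rightarrow> 'b) set" where
  "inner_derivations B =
     (\<lambda>b. \<lambda>x\<in>carrier B. (b \<otimes>\<^bsub>B\<^esub> x) \<ominus>\<^bsub>B\<^esub> (x \<otimes>\<^bsub>B\<^esub> b)) ` carrier B"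

definition HH1 :: "('k, 'b) module \<Rightarrow> ('k, ('b \<Rightarrow> 'b) set) module" where
  "HH1 B = quotient_algebra (derivations B) (inner_derivations B)"

text \<open>
  Inner derivations vanish on the center, so for \<open>C\<close> in \<^term>\<open>carrier (HH1 B)\<close> and central \<open>z\<close>
  the set of values below is a singleton.
\<close>

definition HH1_act :: "('b \<Rightarrow> 'b) set \<Rightarrow> 'b \<Rightarrow> 'b" where
  "HH1_act C z = the_elem ((\<lambda>d. d z) ` C)"

section \<open>Path algebras\<close>

text \<open>
  A path is a pair of a start vertex and a list of consecutive arrows, so that the trivial paths
  are the pairs \<open>(v, [])\<close>. Composition is from left to right.
\<close>

definition paths :: "('v, 'a) pre_digraph \<Rightarrow> ('v \<times> 'a list) set" where
  "paths G = {(u, p). \<exists>v. pre_digraph.awalk G u p v}"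

definition path_algebra ::
  "('v, 'a) pre_digraph \<Rightarrow> ('k::field, ('v \<times> 'a list) \<Rightarrow>\<^sub>0 'k) module" where
  "path_algebra G =
     \<lparr>carrier = {x. Poly_Mapping.keys x \<subseteq> paths G},
      monoid.mult = (\<lambda>x y. \<Sum>(u, p)\<in>Poly_Mapping.keys x. \<Sum>(v, q)\<in>Poly_Mapping.keys y.
        if pre_digraph.awlast G u p = v
        then Poly_Mapping.single (u, p @ q)
               (Poly_Mapping.lookup x (u, p) * Poly_Mapping.lookup y (v, q))
        else 0),
      monoid.one = (\<Sum>v\<in>verts G. Poly_Mapping.single (v, []) 1),
      ring.zero = 0,
      ring.add = (+),
      module.smult = (\<lambda>c. Poly_Mapping.map ((*) c))\<rparr>"

section \<open>The algebra\<close>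

text \<open>Vertices and arrows are indexed by the representatives \<open>0, \<dots>, m - 1\<close> of the residues.\<close>

datatype arrow = Arr int | Bar int

definition quiver :: "nat \<Rightarrow> (int, arrow) pre_digraph" where
  "quiver m =
     \<lparr>verts = {0..<int m},
      arcs = Arr ` {0..<int m} \<union> Bar ` {0..<int m},
      tail = (\<lambda>e. case e of Arr i \<Rightarrow> i | Bar i \<Rightarrow> (i + 1) mod int m),
      head = (\<lambda>e. case e of Arr i \<Rightarrow> (i + 1) mod int m | Bar i \<Rightarrow> i)\<rparr>"

type_synonym 'k kQ = "(int \<times> arrow list) \<Rightarrow>\<^sub>0 'k"

abbreviation kQ :: "nat \<Rightarrow> ('k::field, 'k kQ) module" where
  "kQ m \<equiv> path_algebra (quiver m)"

definition arr :: "nat \<Rightarrow> int \<Rightarrow> 'k::field kQ" where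
  "arr m i = Poly_Mapping.single (i mod int m, [Arr (i mod int m)]) 1"

definition bar :: "nat \<Rightarrow> int \<Rightarrow> 'k::field kQ" where
  "bar m i = Poly_Mapping.single ((i + 1) mod int m, [Bar (i mod int m)]) 1"

definition relations :: "nat \<Rightarrow> nat \<Rightarrow> 'k::field kQ set" where
  "relations m N = (\<Union>i\<in>{0..<int m}.
     {arr m i \<otimes>\<^bsub>kQ m\<^esub> arr m (i + 1),
      bar m (i + 1) \<otimes>\<^bsub>kQ m\<^esub> bar m i,
      (arr m i \<otimes>\<^bsub>kQ m\<^esub> bar m i) [^]\<^bsub>kQ m\<^esub> N
        \<ominus>\<^bsub>kQ m\<^esub> (bar m (i - 1) \<otimes>\<^bsub>kQ m\<^esub> arr m (i - 1)) [^]\<^bsub>kQ m\<^esub> N})"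

definition relation_ideal :: "nat \<Rightarrow> nat \<Rightarrow> 'k::field kQ set" where
  "relation_ideal m N = Idl\<^bsub>kQ m\<^esub> (relations m N)"

definition algA :: "nat \<Rightarrow> nat \<Rightarrow> ('k::field, 'k kQ set) module" where
  "algA m N = quotient_algebra (kQ m) (relation_ideal m N)"

definition arrA :: "nat \<Rightarrow> nat \<Rightarrow> int \<Rightarrow> 'k::field kQ set" where
  "arrA m N i = relation_ideal m N +>\<^bsub>kQ m\<^esub> arr m i"

definition barA :: "nat \<Rightarrow> nat \<Rightarrow> int \<Rightarrow> 'k::field kQ set" where
  "barA m N i = relation_ideal m N +>\<^bsub>kQ m\<^esub> bar m i"

definition eps :: "nat \<Rightarrow> nat \<Rightarrow> int \<Rightarrow> 'k::field kQ set" where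
  "eps m N i = (arrA m N i \<otimes>\<^bsub>algA m N\<^esub> barA m N i) [^]\<^bsub>algA m N\<^esub> N"

definition ff :: "nat \<Rightarrow> nat \<Rightarrow> int \<Rightarrow> 'k::field kQ set" where
  "ff m N i = (arrA m N i \<otimes>\<^bsub>algA m N\<^esub> barA m N i)
     \<oplus>\<^bsub>algA m N\<^esub> (barA m N i \<otimes>\<^bsub>algA m N\<^esub> arrA m N i)"

text \<open>The summands: \<^term>\<open>None\<close> stands for the span of 1, and \<^term>\<open>Some i\<close> for the one at \<open>i\<close>.\<close>

definition summand_index :: "nat \<Rightarrow> int option set" where
  "summand_index m = insert None (Some ` {0..<int m})"

definition summand :: "nat \<Rightarrow> nat \<Rightarrow> int option \<Rightarrow> 'k::field kQ set set" where
  "summand m N j = linear_span (algA m N)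
     (case j of
        None \<Rightarrow> {\<one>\<^bsub>algA m N\<^esub>}
      | Some i \<Rightarrow> {ff m N i [^]\<^bsub>algA m N\<^esub> s | s::nat. 1 \<le> s \<and> s \<le> N - 1}
                \<union> {eps m N i \<oplus>\<^bsub>algA m N\<^esub> eps m N (i + 1)})"

end

theory Submission
  imports Defs
begin

text \<open>
  Write \<open>b\<^sub>i\<close> for the arrow opposite to \<open>a\<^sub>i\<close>. The relation ideal is cut out by
  linear conditions on the coefficients of the zigzag paths \<open>a\<^sub>i b\<^sub>i a\<^sub>i \<dots>\<close> and \<open>b\<^sub>i a\<^sub>i b\<^sub>i \<dots>\<close>: those of length less than \<open>2N\<close> vanish, and
  the two of length \<open>2N\<close> around a vertex cancel. Comparing coefficients then determines the center. As \<open>m\<close> is odd and 2 is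
  invertible, the sums \<open>\<epsilon>\<^sub>i + \<epsilon>\<^sub>i\<^sub>+\<^sub>1 = f\<^sub>i\<^sup>N\<close> form a basis of the span of the \<open>\<epsilon>\<^sub>i\<close>, whence the direct sum.

  A derivation maps \<open>f\<^sub>i = a\<^sub>i b\<^sub>i + b\<^sub>i a\<^sub>i\<close> to a central element built from zigzags at \<open>i\<close>, that is, to a
  combination of the powers \<open>f\<^sub>i, \<dots>, f\<^sub>i\<^sup>N\<close>, so the span of these powers is stable. The derivations
  \<open>E\<^sub>1\<^sub>,\<^sub>i\<^sub>,\<^sub>s\<close> send \<open>f\<^sub>i\<close> to \<open>f\<^sub>i\<^sup>s\<^sup>+\<^sup>1\<close>; hence a submodule containing an element with non-zero \<open>f\<^sub>i\<close>-coefficient is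
  the whole span. In any decomposition into two submodules one of them contains such an element.
\<close>

section \<open>Quotients of nonassociative algebras\<close>

text \<open>The delicate data sit in length \<open>2 * N\<close>, where two paths become one element
  of the quotient: a class determines only the sum \<open>topc\<close> of their coefficients. Hence
  the coefficients of a central element at the sums of neighbouring socle elements cannot be read
  off one at a time; they solve \<open>\<delta> i + \<delta> (i - 1) = \<gamma> i\<close> around a
  cycle of odd length. Stability is proved for every derivation at once, by a rotation argument. For
  \<open>f = a b + b a\<close> the image \<open>d f\<close> consists of \<open>d a b + b d a\<close>
  and \<open>a d b + d b a\<close>, and each pair is symmetric under rotating a closed zigzag by one
  arrow. So both directions receive equal coefficients even in length \<open>2 * N\<close>, where
  centrality imposes no condition. For indecomposability, the derivation used sends
  \<open>f^t\<close> to \<open>t f^(s+t)\<close>, and the scalar \<open>t\<close> may vanish in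
  positive characteristic. Only the coefficient of \<open>f\<close> itself, where
  \<open>t = 1\<close>, is a safe starting point, so this coefficient decides between two
  submodules.\<close>

abbreviation (input) scalars :: "'k::field ring" where
  "scalars \<equiv> ring_of_type_algebra"

lemma scalars_simps [simp]:
  "carrier (scalars :: 'k::field ring) = UNIV"
  "a \<otimes>\<^bsub>(scalars :: 'k ring)\<^esub> b = a * b"
  "a \<oplus>\<^bsub>(scalars :: 'k ring)\<^esub> b = a + b"
  "\<one>\<^bsub>(scalars :: 'k ring)\<^esub> = 1"
  "\<zero>\<^bsub>(scalars :: 'k ring)\<^esub> = 0"
  by (simp_all add: ring_of_type_algebra_def)

lemma scalars_cring: "cring (scalars :: 'k::field ring)"
  by (rule cring_from_type_algebra)

lemma scalars_minus [simp]: "\<ominus>\<^bsub>(scalars :: 'k::field ring)\<^esub> a = - a"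
proof -
  interpret cring "scalars :: 'k ring" by (rule scalars_cring)
  show ?thesis by (rule minus_equality) auto
qed

text \<open>The same quotient construction serves the path algebra modulo its relations and the Lie
  algebra of derivations modulo the inner ones, so neither associativity nor a unit law is built
  in.\<close>

locale nonassoc_algebra = module "scalars :: 'k::field ring" B for B :: "('k::field, 'b) module" (structure) +
  assumes mult_closed: "\<lbrakk>x \<in> carrier B; y \<in> carrier B\<rbrakk> \<Longrightarrow> x \<otimes> y \<in> carrier B"
    and mult_add_left:
      "\<lbrakk>x \<in> carrier B; y \<in> carrier B; z \<in> carrier B\<rbrakk> \<Longrightarrow> (x \<oplus> y) \<otimes> z = x \<otimes> z \<oplus> y \<otimes> z"
    and mult_add_right:
      "\<lbrakk>x \<in> carrier B; y \<in> carrier B; z \<in> carrier B\<rbrakk> \<Longrightarrow> x \<otimes> (y \<oplus> z) = x \<otimes> y \<oplus> x \<otimes> z"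
    and mult_smult_left: "\<lbrakk>x \<in> carrier B; y \<in> carrier B\<rbrakk> \<Longrightarrow> (c \<odot> x) \<otimes> y = c \<odot> (x \<otimes> y)"
    and mult_smult_right: "\<lbrakk>x \<in> carrier B; y \<in> carrier B\<rbrakk> \<Longrightarrow> x \<otimes> (c \<odot> y) = c \<odot> (x \<otimes> y)"

lemma (in module) smult_minus_distr:
  "\<lbrakk>c \<in> carrier R; x \<in> carrier M; y \<in> carrier M\<rbrakk> \<Longrightarrow>
    c \<odot>\<^bsub>M\<^esub> (x \<ominus>\<^bsub>M\<^esub> y) = c \<odot>\<^bsub>M\<^esub> x \<ominus>\<^bsub>M\<^esub> c \<odot>\<^bsub>M\<^esub> y"
  by (simp add: M.minus_eq smult_r_distr smult_r_minus)

lemma (in nonassoc_algebra) smult_mem [simp, intro]: "x \<in> carrier B \<Longrightarrow> c \<odot> x \<in> carrier B"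
  by (simp add: smult_closed)

locale nonassoc_ideal = nonassoc_algebra B + submodule I "scalars :: 'k::field ring" B
  for I and B :: "('k::field, 'b) module" (structure) +
  assumes ideal_left: "\<lbrakk>a \<in> I; x \<in> carrier B\<rbrakk> \<Longrightarrow> x \<otimes> a \<in> I"
    and ideal_right: "\<lbrakk>a \<in> I; x \<in> carrier B\<rbrakk> \<Longrightarrow> a \<otimes> x \<in> I"
begin

abbreviation Q where "Q \<equiv> quotient_algebra B I"
abbreviation cls where "cls x \<equiv> I +> x"

lemma abelian_subgroup_I: "abelian_subgroup I B"
  by (intro abelian_subgroupI3 additive_subgroup.intro) (unfold_locales)

sublocale I: abelian_subgroup I B by (rule abelian_subgroup_I)

section \<open>Cosets and operations on them\<close>

lemma I_carrier: "a \<in> I \<Longrightarrow> a \<in> carrier B"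
  using I.a_subset by blast

lemma cls_eq_iff:
  assumes "x \<in> carrier B" "y \<in> carrier B"
  shows "cls x = cls y \<longleftrightarrow> x \<ominus> y \<in> I"
proof
  assume "cls x = cls y"
  then have "x \<in> cls y" using I.a_rcos_self[OF assms(1)] by simp
  then show "x \<ominus> y \<in> I" using I.a_rcos_module[OF assms(2,1)] by (simp add: minus_eq)
next
  assume "x \<ominus> y \<in> I"
  then have "x \<in> cls y" using I.a_rcos_module[OF assms(2,1)] by (simp add: minus_eq)
  then show "cls x = cls y" using a_repr_independence[OF _ assms(2)] I.a_subgroup by simp
qed

lemma cls_self: "x \<in> carrier B \<Longrightarrow> x \<in> cls x"
  by (rule I.a_rcos_self)

lemma cls_memE:
  assumes "y \<in> cls x" "x \<in> carrier B"
  obtains a where "a \<in> I" "y = a \<oplus> x"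
  using assms by (auto simp: a_r_coset_def')

lemma cls_mem: 
  assumes "x \<in> carrier B" "y \<in> cls x"
  shows "y \<in> carrier B" "cls y = cls x"
proof -
  obtain a where a: "a \<in> I" "y = a \<oplus> x" using assms cls_memE by metis
  then show y: "y \<in> carrier B" using assms I_carrier by auto
  have "y \<ominus> x = a" using a assms I_carrier[of a]
    by (simp add: minus_eq a_assoc r_neg)
  then show "cls y = cls x" using a y assms by (simp add: cls_eq_iff)
qed

lemma carrier_Q: "carrier Q = cls ` carrier B"
  by (auto simp: quotient_algebra_def FactRing_simps)

lemma cls_carrier: "x \<in> carrier B \<Longrightarrow> cls x \<in> carrier Q"
  by (simp add: carrier_Q)

lemma cls_zero: "cls \<zero> = \<zero>\<^bsub>Q\<^esub>"
  using a_coset_join2[of \<zero> I] I.a_subgroup by (simp add: quotient_algebra_def FactRing_def)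

lemma cls_one: "cls \<one> = \<one>\<^bsub>Q\<^esub>"
  by (simp add: quotient_algebra_def FactRing_def)

lemma cls_add: "\<lbrakk>x \<in> carrier B; y \<in> carrier B\<rbrakk> \<Longrightarrow> cls x \<oplus>\<^bsub>Q\<^esub> cls y = cls (x \<oplus> y)"
  by (simp add: quotient_algebra_def FactRing_def I.a_rcos_sum)

text \<open>With \<open>a = u \<oplus> x\<close> and \<open>b = v \<oplus> y\<close> the difference
  is \<open>u \<otimes> b \<oplus> x \<otimes> v\<close>, where \<open>u\<close> and
  \<open>v\<close> lie in the ideal.\<close>

lemma I_diff_mult:
  assumes "a \<in> carrier B" "x \<in> carrier B" "b \<in> carrier B" "y \<in> carrier B" "a \<ominus> x \<in> I" "b \<ominus> y \<in> I"
  shows "a \<otimes> b \<ominus> x \<otimes> y \<in> I"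
proof -
  define u v where "u = a \<ominus> x" and "v = b \<ominus> y"
  have uv: "u \<in> I" "v \<in> I" "u \<in> carrier B" "v \<in> carrier B"
    using assms by (auto simp: u_def v_def)
  have a: "a = u \<oplus> x" "b = v \<oplus> y" using assms
    by (simp_all add: u_def v_def minus_eq a_assoc l_neg)
  have "a \<otimes> b = (u \<otimes> b \<oplus> x \<otimes> v) \<oplus> x \<otimes> y"
    using uv assms unfolding a
    by (simp add: mult_add_left mult_add_right mult_closed a_ac)
  then have "a \<otimes> b \<ominus> x \<otimes> y = u \<otimes> b \<oplus> x \<otimes> v"
    using uv assms by (simp add: mult_closed minus_eq a_assoc r_neg)
  then show ?thesis using uv assms by (simp add: ideal_left ideal_right I.a_closed)
qed

text \<open>\<open>Quot\<close> multiplies cosets by taking the union of the cosets of all products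
  of representatives; all members of this union coincide.\<close>

lemma cls_mult:
  assumes "x \<in> carrier B" "y \<in> carrier B"
  shows "cls x \<otimes>\<^bsub>Q\<^esub> cls y = cls (x \<otimes> y)"
proof -
  have *: "cls (a \<otimes> b) = cls (x \<otimes> y)" if "a \<in> cls x" "b \<in> cls y" for a b
  proof -
    note m = cls_mem[OF assms(1) that(1)] cls_mem[OF assms(2) that(2)]
    show ?thesis using m assms
      by (simp add: cls_eq_iff mult_closed I_diff_mult)
  qed
  have "cls x \<otimes>\<^bsub>Q\<^esub> cls y = (\<Union>a\<in>cls x. \<Union>b\<in>cls y. cls (a \<otimes> b))"
    by (simp add: quotient_algebra_def FactRing_def rcoset_mult_def)
  also have "\<dots> = (\<Union>a\<in>cls x. \<Union>b\<in>cls y. cls (x \<otimes> y))"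
    using * by auto
  also have "\<dots> = cls (x \<otimes> y)" using cls_self assms by auto
  finally show ?thesis .
qed

lemma cls_smult:
  assumes "x \<in> carrier B"
  shows "c \<odot>\<^bsub>Q\<^esub> cls x = cls (c \<odot> x)"
proof -
  have *: "cls (c \<odot> a) = cls (c \<odot> x)" if "a \<in> cls x" for a
  proof -
    have "a \<ominus> x \<in> I" using cls_mem[OF assms that] assms by (simp add: cls_eq_iff)
    then have "c \<odot> (a \<ominus> x) \<in> I" using smult_closed[of c] by simp
    then show ?thesis using cls_mem[OF assms that] assms by (simp add: cls_eq_iff smult_minus_distr)
  qed
  have "c \<odot>\<^bsub>Q\<^esub> cls x = (\<Union>a\<in>cls x. cls (c \<odot> a))"
    by (simp add: quotient_algebra_def)
  also have "\<dots> = (\<Union>a\<in>cls x. cls (c \<odot> x))" using * by auto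
  also have "\<dots> = cls (c \<odot> x)" using cls_self assms by auto
  finally show ?thesis .
qed

lemma Q_cases:
  assumes "U \<in> carrier Q"
  obtains x where "x \<in> carrier B" "U = cls x"
  using assms by (auto simp: carrier_Q)

section \<open>Algebraic structure of the quotient\<close>

lemma quotient_abelian_group: "abelian_group Q"
proof (rule abelian_groupI)
  show "\<zero>\<^bsub>Q\<^esub> \<in> carrier Q" by (metis cls_zero cls_carrier zero_closed)
  fix U assume "U \<in> carrier Q"
  then obtain x where x: "x \<in> carrier B" "U = cls x" by (rule Q_cases)
  show "\<zero>\<^bsub>Q\<^esub> \<oplus>\<^bsub>Q\<^esub> U = U" using x by (simp flip: cls_zero add: cls_add)
  show "\<exists>Y\<in>carrier Q. Y \<oplus>\<^bsub>Q\<^esub> U = \<zero>\<^bsub>Q\<^esub>"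
    using x by (intro bexI[of _ "cls (\<ominus> x)"]) (simp_all flip: cls_zero add: cls_add cls_carrier l_neg)
  fix Y assume "Y \<in> carrier Q"
  then obtain y where y: "y \<in> carrier B" "Y = cls y" by (rule Q_cases)
  show "U \<oplus>\<^bsub>Q\<^esub> Y \<in> carrier Q" using x y by (simp add: cls_add cls_carrier)
  show "U \<oplus>\<^bsub>Q\<^esub> Y = Y \<oplus>\<^bsub>Q\<^esub> U" using x y by (simp add: cls_add a_comm)
  fix Z assume "Z \<in> carrier Q"
  then obtain z where z: "z \<in> carrier B" "Z = cls z" by (rule Q_cases)
  show "U \<oplus>\<^bsub>Q\<^esub> Y \<oplus>\<^bsub>Q\<^esub> Z = U \<oplus>\<^bsub>Q\<^esub> (Y \<oplus>\<^bsub>Q\<^esub> Z)" using x y z by (simp add: cls_add a_assoc)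
qed

lemma quotient_module: "module (scalars :: 'k ring) Q"
proof (rule moduleI[OF scalars_cring quotient_abelian_group])
  fix U and a b :: 'k assume "U \<in> carrier Q"
  then obtain x where x: "x \<in> carrier B" "U = cls x" by (rule Q_cases)
  show "a \<odot>\<^bsub>Q\<^esub> U \<in> carrier Q" using x by (simp add: cls_smult cls_carrier)
  show "(a \<oplus>\<^bsub>scalars\<^esub> b) \<odot>\<^bsub>Q\<^esub> U = a \<odot>\<^bsub>Q\<^esub> U \<oplus>\<^bsub>Q\<^esub> b \<odot>\<^bsub>Q\<^esub> U"
    using x smult_l_distr[of a b x] by (simp add: cls_smult cls_add)
  show "(a \<otimes>\<^bsub>scalars\<^esub> b) \<odot>\<^bsub>Q\<^esub> U = a \<odot>\<^bsub>Q\<^esub> (b \<odot>\<^bsub>Q\<^esub> U)"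
    using x smult_assoc1[of a b x] by (simp add: cls_smult)
  show "\<one>\<^bsub>scalars\<^esub> \<odot>\<^bsub>Q\<^esub> U = U"
    using x smult_one[of x] by (simp add: cls_smult)
  fix Y assume "Y \<in> carrier Q"
  then obtain y where y: "y \<in> carrier B" "Y = cls y" by (rule Q_cases)
  show "a \<odot>\<^bsub>Q\<^esub> (U \<oplus>\<^bsub>Q\<^esub> Y) = a \<odot>\<^bsub>Q\<^esub> U \<oplus>\<^bsub>Q\<^esub> a \<odot>\<^bsub>Q\<^esub> Y"
    using x y smult_r_distr[of a x y] by (simp add: cls_smult cls_add)
qed

lemma quotient_nonassoc_algebra: "nonassoc_algebra Q"
proof (intro nonassoc_algebra.intro quotient_module nonassoc_algebra_axioms.intro)
  fix U Y assume "U \<in> carrier Q" "Y \<in> carrier Q"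
  then obtain x y where x: "x \<in> carrier B" "U = cls x" "y \<in> carrier B" "Y = cls y"
    by (metis Q_cases)
  show "U \<otimes>\<^bsub>Q\<^esub> Y \<in> carrier Q" using x by (simp add: cls_mult cls_carrier mult_closed)
  show "(c \<odot>\<^bsub>Q\<^esub> U) \<otimes>\<^bsub>Q\<^esub> Y = c \<odot>\<^bsub>Q\<^esub> (U \<otimes>\<^bsub>Q\<^esub> Y)" for c
    using x by (simp add: cls_mult cls_smult mult_closed mult_smult_left)
  show "U \<otimes>\<^bsub>Q\<^esub> (c \<odot>\<^bsub>Q\<^esub> Y) = c \<odot>\<^bsub>Q\<^esub> (U \<otimes>\<^bsub>Q\<^esub> Y)" for c
    using x by (simp add: cls_mult cls_smult mult_closed mult_smult_right)
  fix Z assume "Z \<in> carrier Q"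
  then obtain z where z: "z \<in> carrier B" "Z = cls z" by (rule Q_cases)
  show "(U \<oplus>\<^bsub>Q\<^esub> Y) \<otimes>\<^bsub>Q\<^esub> Z = U \<otimes>\<^bsub>Q\<^esub> Z \<oplus>\<^bsub>Q\<^esub> Y \<otimes>\<^bsub>Q\<^esub> Z"
    "U \<otimes>\<^bsub>Q\<^esub> (Y \<oplus>\<^bsub>Q\<^esub> Z) = U \<otimes>\<^bsub>Q\<^esub> Y \<oplus>\<^bsub>Q\<^esub> U \<otimes>\<^bsub>Q\<^esub> Z"
    using x z by (simp_all add: cls_mult cls_add mult_closed mult_add_left mult_add_right)
qed

end

lemma lie_algebraI:
  fixes L :: "('k::field, 'l) module" (structure)
  assumes "nonassoc_algebra L"
    and "\<And>x. x \<in> carrier L \<Longrightarrow> x \<otimes> x = \<zero>"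
    and "\<And>x y z. \<lbrakk>x \<in> carrier L; y \<in> carrier L; z \<in> carrier L\<rbrakk> \<Longrightarrow>
        (x \<otimes> (y \<otimes> z)) \<oplus> ((y \<otimes> (z \<otimes> x)) \<oplus> (z \<otimes> (x \<otimes> y))) = \<zero>"
  shows "lie_algebra (scalars :: 'k ring) L"
proof -
  interpret nonassoc_algebra L by fact
  show ?thesis
    by (intro lie_algebra.intro lie_algebra_axioms.intro module_axioms)
      (auto simp: assms mult_closed mult_add_left mult_add_right mult_smult_left mult_smult_right)
qed

lemma (in nonassoc_ideal) quotient_lie_algebra:
  assumes "lie_algebra (scalars :: 'k ring) B"
  shows "lie_algebra (scalars :: 'k ring) Q"
proof (rule lie_algebraI[OF quotient_nonassoc_algebra])
  interpret lie_algebra "scalars :: 'k ring" B by fact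
  fix U assume "U \<in> carrier Q"
  then obtain x where x: "x \<in> carrier B" "U = cls x" by (rule Q_cases)
  show "U \<otimes>\<^bsub>Q\<^esub> U = \<zero>\<^bsub>Q\<^esub>" using x by (simp add: cls_mult bracket_self cls_zero)
  fix Y Z assume "Y \<in> carrier Q" "Z \<in> carrier Q"
  then obtain y z where y: "y \<in> carrier B" "Y = cls y" "z \<in> carrier B" "Z = cls z" by (metis Q_cases)
  show "(U \<otimes>\<^bsub>Q\<^esub> (Y \<otimes>\<^bsub>Q\<^esub> Z)) \<oplus>\<^bsub>Q\<^esub> ((Y \<otimes>\<^bsub>Q\<^esub> (Z \<otimes>\<^bsub>Q\<^esub> U)) \<oplus>\<^bsub>Q\<^esub> (Z \<otimes>\<^bsub>Q\<^esub> (U \<otimes>\<^bsub>Q\<^esub> Y))) = \<zero>\<^bsub>Q\<^esub>"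
    using x y by (simp add: cls_mult cls_add mult_closed jacobi cls_zero)
qed

section \<open>Derivations of an associative algebra\<close>

locale assoc_algebra = nonassoc_algebra B + ring B for B :: "('k::field, 'b) module" (structure)

lemma (in nonassoc_ideal) quotient_assoc_algebra:
  assumes "ring B"
  shows "assoc_algebra Q"
proof -
  interpret ring B by fact
  interpret Q: nonassoc_algebra Q by (rule quotient_nonassoc_algebra)
  have "Group.monoid Q"
  proof (rule monoidI)
    show "\<one>\<^bsub>Q\<^esub> \<in> carrier Q" by (metis cls_one cls_carrier one_closed)
    fix U assume "U \<in> carrier Q"
    then obtain u where u: "u \<in> carrier B" "U = cls u" by (rule Q_cases)
    show "\<one>\<^bsub>Q\<^esub> \<otimes>\<^bsub>Q\<^esub> U = U" "U \<otimes>\<^bsub>Q\<^esub> \<one>\<^bsub>Q\<^esub> = U"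
      using u by (simp_all flip: cls_one add: cls_mult)
    fix Y assume "Y \<in> carrier Q"
    then obtain y where y: "y \<in> carrier B" "Y = cls y" by (rule Q_cases)
    show "U \<otimes>\<^bsub>Q\<^esub> Y \<in> carrier Q" using u y by (simp add: cls_mult cls_carrier)
    fix Z assume "Z \<in> carrier Q"
    then obtain z where z: "z \<in> carrier B" "Z = cls z" by (rule Q_cases)
    show "U \<otimes>\<^bsub>Q\<^esub> Y \<otimes>\<^bsub>Q\<^esub> Z = U \<otimes>\<^bsub>Q\<^esub> (Y \<otimes>\<^bsub>Q\<^esub> Z)" using u y z by (simp add: cls_mult m_assoc)
  qed
  then have "ring Q"
    by (intro ringI quotient_abelian_group) (auto simp: Q.mult_add_left Q.mult_add_right)
  then show ?thesis by (intro assoc_algebra.intro Q.nonassoc_algebra_axioms)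
qed

context assoc_algebra
begin

section \<open>Elementary properties of derivations\<close>

lemma der_closed: "is_derivation B d \<Longrightarrow> x \<in> carrier B \<Longrightarrow> d x \<in> carrier B"
  by (auto simp: is_derivation_def)

lemma der_add: "is_derivation B d \<Longrightarrow> x \<in> carrier B \<Longrightarrow> y \<in> carrier B \<Longrightarrow> d (x \<oplus> y) = d x \<oplus> d y"
  by (auto simp: is_derivation_def)

lemma der_smult: "is_derivation B d \<Longrightarrow> x \<in> carrier B \<Longrightarrow> d (c \<odot> x) = c \<odot> d x"
  by (auto simp: is_derivation_def)

lemma der_mult:
  "is_derivation B d \<Longrightarrow> x \<in> carrier B \<Longrightarrow> y \<in> carrier B \<Longrightarrow> d (x \<otimes> y) = d x \<otimes> y \<oplus> x \<otimes> d y"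
  by (auto simp: is_derivation_def)

lemmas der_simps = der_closed der_add der_smult der_mult

lemma der_zero: "is_derivation B d \<Longrightarrow> d \<zero> = \<zero>"
  using der_add[of d \<zero> \<zero>] der_closed[of d \<zero>] by simp

lemma der_uminus:
  assumes "is_derivation B d" "x \<in> carrier B"
  shows "d (\<ominus> x) = \<ominus> d x"
proof -
  have "d (\<ominus> x) \<oplus> d x = \<zero>"
    using der_add[of d "\<ominus> x" x] assms by (simp add: der_zero l_neg)
  then show ?thesis using assms by (metis minus_equality der_closed a_inv_closed)
qed

lemma der_minus:
  "is_derivation B d \<Longrightarrow> x \<in> carrier B \<Longrightarrow> y \<in> carrier B \<Longrightarrow> d (x \<ominus> y) = d x \<ominus> d y"
  by (simp add: minus_eq der_add der_uminus)

text \<open>Since \<open>\<one> \<otimes> \<one> = \<one>\<close>, the value at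
  \<open>\<one>\<close> equals its own double. This makes the span of 1 a trivial module.\<close>

lemma der_one:
  assumes "is_derivation B d"
  shows "d \<one> = \<zero>"
  using der_mult[OF assms, of \<one> \<one>] der_closed[OF assms, of \<one>] by simp

text \<open>Derivations take the value \<open>undefined\<close> outside the carrier, so agreement on
  the carrier is equality of functions.\<close>

lemma der_ext:
  "is_derivation B d \<Longrightarrow> is_derivation B e \<Longrightarrow> (\<And>x. x \<in> carrier B \<Longrightarrow> d x = e x) \<Longrightarrow> d = e"
  unfolding is_derivation_def by (meson PiE_ext)

lemma der_undefined: "is_derivation B d \<Longrightarrow> x \<notin> carrier B \<Longrightarrow> d x = undefined"
  by (auto simp: is_derivation_def)

lemma is_derivationI:
  assumes "d \<in> carrier B \<rightarrow>\<^sub>E carrier B"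
    and "\<And>x y. x \<in> carrier B \<Longrightarrow> y \<in> carrier B \<Longrightarrow> d (x \<oplus> y) = d x \<oplus> d y"
    and "\<And>c x. x \<in> carrier B \<Longrightarrow> d (c \<odot> x) = c \<odot> d x"
    and "\<And>x y. x \<in> carrier B \<Longrightarrow> y \<in> carrier B \<Longrightarrow> d (x \<otimes> y) = d x \<otimes> y \<oplus> x \<otimes> d y"
  shows "is_derivation B d"
  using assms by (auto simp: is_derivation_def)

lemma smult_add: "x \<in> carrier B \<Longrightarrow> y \<in> carrier B \<Longrightarrow> c \<odot> (x \<oplus> y) = c \<odot> x \<oplus> c \<odot> y"
  by (simp add: smult_r_distr)

lemma smult_minus: "x \<in> carrier B \<Longrightarrow> y \<in> carrier B \<Longrightarrow> c \<odot> (x \<ominus> y) = c \<odot> x \<ominus> c \<odot> y"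
  by (simp add: smult_minus_distr)

lemma smult_comm: "x \<in> carrier B \<Longrightarrow> c \<odot> (d \<odot> x) = d \<odot> (c \<odot> x)"
  using smult_assoc1[of c d x] smult_assoc1[of d c x] by (simp add: mult.commute)

section \<open>Operations that produce derivations\<close>

lemma der_zero_map: "is_derivation B (\<lambda>x\<in>carrier B. \<zero>)"
  by (rule is_derivationI) (simp_all add: smult_r_null)

lemma der_plus:
  assumes "is_derivation B d" "is_derivation B e"
  shows "is_derivation B (\<lambda>x\<in>carrier B. d x \<oplus> e x)"
proof (rule is_derivationI)
  fix x y assume "x \<in> carrier B" "y \<in> carrier B"
  moreover from this have "d x \<in> carrier B" "d y \<in> carrier B" "e x \<in> carrier B" "e y \<in> carrier B"
    using assms by (simp_all add: der_closed)
  ultimately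
  show "(\<lambda>x\<in>carrier B. d x \<oplus> e x) (x \<oplus> y) = (\<lambda>x\<in>carrier B. d x \<oplus> e x) x \<oplus> (\<lambda>x\<in>carrier B. d x \<oplus> e x) y"
    "(\<lambda>x\<in>carrier B. d x \<oplus> e x) (x \<otimes> y) =
      (\<lambda>x\<in>carrier B. d x \<oplus> e x) x \<otimes> y \<oplus> x \<otimes> (\<lambda>x\<in>carrier B. d x \<oplus> e x) y"
    using assms by (simp_all add: der_add der_mult l_distr r_distr a_ac)
qed (use assms in \<open>auto simp: der_simps smult_add\<close>)

lemma der_scale:
  assumes "is_derivation B d"
  shows "is_derivation B (\<lambda>x\<in>carrier B. c \<odot> d x)"
  by (rule is_derivationI)
    (use assms in \<open>auto simp: der_simps smult_add mult_smult_left mult_smult_right smult_comm\<close>)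

lemma der_commutator:
  assumes "is_derivation B d" "is_derivation B e"
  shows "is_derivation B (\<lambda>x\<in>carrier B. d (e x) \<ominus> e (d x))"
proof (rule is_derivationI)
  fix x y assume xy: "x \<in> carrier B" "y \<in> carrier B"
  then have c: "d x \<in> carrier B" "d y \<in> carrier B" "e x \<in> carrier B" "e y \<in> carrier B"
    "d (e x) \<in> carrier B" "d (e y) \<in> carrier B" "e (d x) \<in> carrier B" "e (d y) \<in> carrier B"
    using assms by (simp_all add: der_closed)
  have "d (e x) \<oplus> d (e y) \<ominus> (e (d x) \<oplus> e (d y)) = (d (e x) \<ominus> e (d x)) \<oplus> (d (e y) \<ominus> e (d y))"
    using c by algebra
  then show "(\<lambda>x\<in>carrier B. d (e x) \<ominus> e (d x)) (x \<oplus> y) =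
      (\<lambda>x\<in>carrier B. d (e x) \<ominus> e (d x)) x \<oplus> (\<lambda>x\<in>carrier B. d (e x) \<ominus> e (d x)) y"
    using assms xy c by (simp add: der_add)
  \<comment> \<open>The mixed products \<open>d x \<otimes> e y\<close> and
    \<open>e x \<otimes> d y\<close> occur in both composites and cancel.\<close>
  have "d (e x) \<otimes> y \<oplus> e x \<otimes> d y \<oplus> (d x \<otimes> e y \<oplus> x \<otimes> d (e y))
      \<ominus> (e (d x) \<otimes> y \<oplus> d x \<otimes> e y \<oplus> (e x \<otimes> d y \<oplus> x \<otimes> e (d y)))
      = (d (e x) \<ominus> e (d x)) \<otimes> y \<oplus> x \<otimes> (d (e y) \<ominus> e (d y))"
    using xy c by algebra
  then show "(\<lambda>x\<in>carrier B. d (e x) \<ominus> e (d x)) (x \<otimes> y) =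
      (\<lambda>x\<in>carrier B. d (e x) \<ominus> e (d x)) x \<otimes> y \<oplus> x \<otimes> (\<lambda>x\<in>carrier B. d (e x) \<ominus> e (d x)) y"
    using assms xy c by (simp add: der_mult der_add)
qed (use assms in \<open>auto simp: der_simps smult_minus\<close>)

lemma der_inner:
  assumes "b \<in> carrier B"
  shows "is_derivation B (\<lambda>x\<in>carrier B. b \<otimes> x \<ominus> x \<otimes> b)"
proof (rule is_derivationI)
  fix x y assume xy: "x \<in> carrier B" "y \<in> carrier B"
  have "b \<otimes> (x \<oplus> y) \<ominus> (x \<oplus> y) \<otimes> b = (b \<otimes> x \<ominus> x \<otimes> b) \<oplus> (b \<otimes> y \<ominus> y \<otimes> b)"
    "b \<otimes> (x \<otimes> y) \<ominus> x \<otimes> y \<otimes> b = (b \<otimes> x \<ominus> x \<otimes> b) \<otimes> y \<oplus> x \<otimes> (b \<otimes> y \<ominus> y \<otimes> b)"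
    using xy assms by algebra+
  then show "(\<lambda>x\<in>carrier B. b \<otimes> x \<ominus> x \<otimes> b) (x \<oplus> y) =
      (\<lambda>x\<in>carrier B. b \<otimes> x \<ominus> x \<otimes> b) x \<oplus> (\<lambda>x\<in>carrier B. b \<otimes> x \<ominus> x \<otimes> b) y"
    "(\<lambda>x\<in>carrier B. b \<otimes> x \<ominus> x \<otimes> b) (x \<otimes> y) =
      (\<lambda>x\<in>carrier B. b \<otimes> x \<ominus> x \<otimes> b) x \<otimes> y \<oplus> x \<otimes> (\<lambda>x\<in>carrier B. b \<otimes> x \<ominus> x \<otimes> b) y"
    using xy assms by simp_all
qed (use assms in \<open>auto simp: mult_smult_left mult_smult_right smult_minus\<close>)

section \<open>The Lie algebra of derivations\<close>

abbreviation Der where "Der \<equiv> derivations B"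

lemma Der_simps:
  "carrier Der = {d. is_derivation B d}"
  "\<zero>\<^bsub>Der\<^esub> = (\<lambda>x\<in>carrier B. \<zero>)"
  "d \<otimes>\<^bsub>Der\<^esub> e = (\<lambda>x\<in>carrier B. d (e x) \<ominus> e (d x))"
  "d \<oplus>\<^bsub>Der\<^esub> e = (\<lambda>x\<in>carrier B. d x \<oplus> e x)"
  "c \<odot>\<^bsub>Der\<^esub> d = (\<lambda>x\<in>carrier B. c \<odot> d x)"
  by (simp_all add: derivations_def)

lemma Der_abelian_group: "abelian_group Der"
proof (rule abelian_groupI)
  fix d assume d: "d \<in> carrier Der"
  then have d': "is_derivation B d" by (simp add: Der_simps)
  show "\<zero>\<^bsub>Der\<^esub> \<oplus>\<^bsub>Der\<^esub> d = d"
    using d' by (auto simp: Der_simps fun_eq_iff der_closed der_undefined)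
  show "\<exists>e\<in>carrier Der. e \<oplus>\<^bsub>Der\<^esub> d = \<zero>\<^bsub>Der\<^esub>"
  proof (intro bexI[of _ "\<lambda>x\<in>carrier B. (- 1) \<odot> d x"])
    show "(\<lambda>x\<in>carrier B. (- 1) \<odot> d x) \<oplus>\<^bsub>Der\<^esub> d = \<zero>\<^bsub>Der\<^esub>"
    proof (rule der_ext)
      fix x assume x: "x \<in> carrier B"
      then have "(- 1) \<odot> d x = \<ominus> (1 \<odot> d x)"
        using smult_l_minus[of 1 "d x"] d' by (simp add: der_closed)
      also have "1 \<odot> d x = d x" using smult_one[of "d x"] d' x by (simp add: der_closed)
      finally show "((\<lambda>x\<in>carrier B. (- 1) \<odot> d x) \<oplus>\<^bsub>Der\<^esub> d) x = \<zero>\<^bsub>Der\<^esub> x"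
        using x d' by (simp add: Der_simps der_closed l_neg)
    qed (use d' in \<open>simp_all add: Der_simps der_plus der_zero_map der_scale del: restrict_apply\<close>)
  qed (use d' in \<open>simp add: Der_simps der_scale\<close>)
  fix e assume e: "e \<in> carrier Der"
  then show "d \<oplus>\<^bsub>Der\<^esub> e \<in> carrier Der" using d by (simp add: Der_simps der_plus)
  show "d \<oplus>\<^bsub>Der\<^esub> e = e \<oplus>\<^bsub>Der\<^esub> d"
    using d e by (auto simp: Der_simps fun_eq_iff der_closed a_comm)
  fix f assume "f \<in> carrier Der"
  then show "d \<oplus>\<^bsub>Der\<^esub> e \<oplus>\<^bsub>Der\<^esub> f = d \<oplus>\<^bsub>Der\<^esub> (e \<oplus>\<^bsub>Der\<^esub> f)"
    using d e by (auto simp: Der_simps fun_eq_iff der_closed a_assoc)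
qed (simp add: Der_simps der_zero_map)

lemma Der_module: "module (scalars :: 'k ring) Der"
proof (rule moduleI[OF scalars_cring Der_abelian_group])
  fix d and a b :: 'k assume "d \<in> carrier Der"
  then have d: "is_derivation B d" by (simp add: Der_simps)
  show "a \<odot>\<^bsub>Der\<^esub> d \<in> carrier Der" using d by (simp add: Der_simps der_scale)
  show "(a \<oplus>\<^bsub>scalars\<^esub> b) \<odot>\<^bsub>Der\<^esub> d = a \<odot>\<^bsub>Der\<^esub> d \<oplus>\<^bsub>Der\<^esub> b \<odot>\<^bsub>Der\<^esub> d"
    using d smult_l_distr[of a b "d _"] by (auto simp: Der_simps fun_eq_iff der_closed)
  show "(a \<otimes>\<^bsub>scalars\<^esub> b) \<odot>\<^bsub>Der\<^esub> d = a \<odot>\<^bsub>Der\<^esub> (b \<odot>\<^bsub>Der\<^esub> d)"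
    using d smult_assoc1[of a b "d _"] by (auto simp: Der_simps fun_eq_iff der_closed)
  show "\<one>\<^bsub>scalars\<^esub> \<odot>\<^bsub>Der\<^esub> d = d"
    using d smult_one[of "d _"] der_scale[OF d, of 1]
    by (intro der_ext) (auto simp: Der_simps der_closed)
  fix e assume "e \<in> carrier Der"
  then show "a \<odot>\<^bsub>Der\<^esub> (d \<oplus>\<^bsub>Der\<^esub> e) = a \<odot>\<^bsub>Der\<^esub> d \<oplus>\<^bsub>Der\<^esub> a \<odot>\<^bsub>Der\<^esub> e"
    using d by (auto simp: Der_simps fun_eq_iff der_closed smult_add)
qed

lemma Der_nonassoc_algebra: "nonassoc_algebra Der"
proof (intro nonassoc_algebra.intro nonassoc_algebra_axioms.intro Der_module)
  fix d e assume "d \<in> carrier Der" "e \<in> carrier Der"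
  then have d: "is_derivation B d" "is_derivation B e" by (simp_all add: Der_simps)
  show "d \<otimes>\<^bsub>Der\<^esub> e \<in> carrier Der" using d by (simp add: Der_simps der_commutator)
  show "(c \<odot>\<^bsub>Der\<^esub> d) \<otimes>\<^bsub>Der\<^esub> e = c \<odot>\<^bsub>Der\<^esub> (d \<otimes>\<^bsub>Der\<^esub> e)" for c
    using d by (auto simp: Der_simps fun_eq_iff der_closed der_smult smult_minus)
  show "d \<otimes>\<^bsub>Der\<^esub> (c \<odot>\<^bsub>Der\<^esub> e) = c \<odot>\<^bsub>Der\<^esub> (d \<otimes>\<^bsub>Der\<^esub> e)" for c
    using d by (auto simp: Der_simps fun_eq_iff der_closed der_smult smult_minus)
  fix f assume "f \<in> carrier Der"
  then have f: "is_derivation B f" by (simp add: Der_simps)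
  have *: "(p \<oplus> q) \<ominus> (r \<oplus> s) = (p \<ominus> r) \<oplus> (q \<ominus> s)"
    if "p \<in> carrier B" "q \<in> carrier B" "r \<in> carrier B" "s \<in> carrier B" for p q r s
    using that by algebra
  show "(d \<oplus>\<^bsub>Der\<^esub> e) \<otimes>\<^bsub>Der\<^esub> f = (d \<otimes>\<^bsub>Der\<^esub> f) \<oplus>\<^bsub>Der\<^esub> (e \<otimes>\<^bsub>Der\<^esub> f)"
    using d f by (auto simp: Der_simps fun_eq_iff der_closed der_add *)
  show "d \<otimes>\<^bsub>Der\<^esub> (e \<oplus>\<^bsub>Der\<^esub> f) = (d \<otimes>\<^bsub>Der\<^esub> e) \<oplus>\<^bsub>Der\<^esub> (d \<otimes>\<^bsub>Der\<^esub> f)"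
    using d f by (auto simp: Der_simps fun_eq_iff der_closed der_add *)
qed

lemma Der_lie_algebra: "lie_algebra (scalars :: 'k ring) Der"
proof (rule lie_algebraI[OF Der_nonassoc_algebra])
  fix d assume "d \<in> carrier Der"
  then have d: "is_derivation B d" by (simp add: Der_simps)
  then show "d \<otimes>\<^bsub>Der\<^esub> d = \<zero>\<^bsub>Der\<^esub>"
    by (auto simp: Der_simps fun_eq_iff der_closed minus_eq r_neg)
  fix e f assume "e \<in> carrier Der" "f \<in> carrier Der"
  then have ef: "is_derivation B e" "is_derivation B f" by (simp_all add: Der_simps)
  show "(d \<otimes>\<^bsub>Der\<^esub> (e \<otimes>\<^bsub>Der\<^esub> f)) \<oplus>\<^bsub>Der\<^esub> ((e \<otimes>\<^bsub>Der\<^esub> (f \<otimes>\<^bsub>Der\<^esub> d)) \<oplus>\<^bsub>Der\<^esub> (f \<otimes>\<^bsub>Der\<^esub> (d \<otimes>\<^bsub>Der\<^esub> e))) = \<zero>\<^bsub>Der\<^esub>"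
  proof
    fix x
    show "((d \<otimes>\<^bsub>Der\<^esub> (e \<otimes>\<^bsub>Der\<^esub> f)) \<oplus>\<^bsub>Der\<^esub> ((e \<otimes>\<^bsub>Der\<^esub> (f \<otimes>\<^bsub>Der\<^esub> d)) \<oplus>\<^bsub>Der\<^esub> (f \<otimes>\<^bsub>Der\<^esub> (d \<otimes>\<^bsub>Der\<^esub> e)))) x = \<zero>\<^bsub>Der\<^esub> x"
    proof (cases "x \<in> carrier B")
      case x: True
      then have c: "d (e (f x)) \<in> carrier B" "d (f (e x)) \<in> carrier B" "e (d (f x)) \<in> carrier B"
        "e (f (d x)) \<in> carrier B" "f (d (e x)) \<in> carrier B" "f (e (d x)) \<in> carrier B"
        using d ef by (simp_all add: der_closed)
      \<comment> \<open>Each of the six triple composites occurs twice, with opposite signs.\<close>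
      have "(d (e (f x)) \<ominus> d (f (e x))) \<ominus> (e (f (d x)) \<ominus> f (e (d x)))
          \<oplus> ((e (f (d x)) \<ominus> e (d (f x))) \<ominus> (f (d (e x)) \<ominus> d (f (e x)))
          \<oplus> ((f (d (e x)) \<ominus> f (e (d x))) \<ominus> (d (e (f x)) \<ominus> e (d (f x))))) = \<zero>"
        using c by algebra
      then show ?thesis using x d ef by (simp add: Der_simps der_closed der_minus)
    qed (simp add: Der_simps)
  qed
qed

text \<open>The Leibniz rule gives \<open>[d, ad b] = ad (d b)\<close>, so a bracket with an inner
  derivation is inner; for the reversed bracket the witness is \<open>\<ominus> d b\<close>.\<close>

lemma inner_nonassoc_ideal: "nonassoc_ideal (inner_derivations B) Der"
proof -
  interpret D: nonassoc_algebra Der by (rule Der_nonassoc_algebra)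
  let ?ad = "\<lambda>b. \<lambda>x\<in>carrier B. b \<otimes> x \<ominus> x \<otimes> b"
  have ad_scale: "c \<odot>\<^bsub>Der\<^esub> ?ad b = ?ad (c \<odot> b)" if "b \<in> carrier B" for b c
    using that by (auto simp: Der_simps fun_eq_iff mult_smult_left mult_smult_right smult_minus)
  have ad_add: "?ad b \<oplus>\<^bsub>Der\<^esub> ?ad c = ?ad (b \<oplus> c)" if "b \<in> carrier B" "c \<in> carrier B" for b c
  proof
    fix x show "(?ad b \<oplus>\<^bsub>Der\<^esub> ?ad c) x = ?ad (b \<oplus> c) x"
    proof (cases "x \<in> carrier B")
      case True
      then have "(b \<otimes> x \<ominus> x \<otimes> b) \<oplus> (c \<otimes> x \<ominus> x \<otimes> c) = (b \<oplus> c) \<otimes> x \<ominus> x \<otimes> (b \<oplus> c)"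
        using that by algebra
      then show ?thesis using True by (simp add: Der_simps)
    qed (simp add: Der_simps)
  qed
  have "submodule (inner_derivations B) (scalars :: 'k ring) Der"
  proof (rule D.submoduleI)
    show "inner_derivations B \<subseteq> carrier Der"
      by (auto simp: inner_derivations_def Der_simps der_inner)
    show "\<zero>\<^bsub>Der\<^esub> \<in> inner_derivations B"
      unfolding inner_derivations_def
      by (rule image_eqI[of _ _ \<zero>]) (auto simp: Der_simps fun_eq_iff minus_eq)
    show "a \<oplus>\<^bsub>Der\<^esub> b \<in> inner_derivations B" if "a \<in> inner_derivations B" "b \<in> inner_derivations B" for a b
      using that by (auto simp: inner_derivations_def ad_add)
    show smult: "a \<odot>\<^bsub>Der\<^esub> d \<in> inner_derivations B" if "d \<in> inner_derivations B" for a d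
      using that by (auto simp: inner_derivations_def ad_scale)
    fix d assume d: "d \<in> inner_derivations B"
    then have "d \<in> carrier Der" by (auto simp: inner_derivations_def Der_simps der_inner)
    then have "\<ominus>\<^bsub>Der\<^esub> d = (- 1) \<odot>\<^bsub>Der\<^esub> d"
      using D.smult_l_minus[of 1 d] D.smult_one[of d] by simp
    then show "\<ominus>\<^bsub>Der\<^esub> d \<in> inner_derivations B" using smult[OF d, of "- 1"] by simp
  qed
  moreover have "d \<otimes>\<^bsub>Der\<^esub> a \<in> inner_derivations B" "a \<otimes>\<^bsub>Der\<^esub> d \<in> inner_derivations B"
    if a: "a \<in> inner_derivations B" and D: "d \<in> carrier Der" for a d
  proof -
    have d: "is_derivation B d" using D by (simp add: Der_simps)
    obtain b where b: "b \<in> carrier B" "a = ?ad b" using a by (auto simp: inner_derivations_def)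
    note db = der_closed[OF d b(1)]
    have "d \<otimes>\<^bsub>Der\<^esub> a = ?ad (d b)" 
    proof
      fix x show "(d \<otimes>\<^bsub>Der\<^esub> a) x = ?ad (d b) x"
      proof (cases "x \<in> carrier B")
        case True
        note dx = der_closed[OF d True]
        have "(d b \<otimes> x \<oplus> b \<otimes> d x) \<ominus> (d x \<otimes> b \<oplus> x \<otimes> d b) \<ominus> (b \<otimes> d x \<ominus> d x \<otimes> b) = d b \<otimes> x \<ominus> x \<otimes> d b"
          using True b db dx by algebra
        then show ?thesis using True b db dx d by (simp add: Der_simps der_minus der_mult)
      qed (simp add: Der_simps)
    qed
    then show "d \<otimes>\<^bsub>Der\<^esub> a \<in> inner_derivations B" using db by (auto simp: inner_derivations_def)
    have "a \<otimes>\<^bsub>Der\<^esub> d = ?ad (\<ominus> d b)" 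
    proof
      fix x show "(a \<otimes>\<^bsub>Der\<^esub> d) x = ?ad (\<ominus> d b) x"
      proof (cases "x \<in> carrier B")
        case True
        note dx = der_closed[OF d True]
        have "(b \<otimes> d x \<ominus> d x \<otimes> b) \<ominus> ((d b \<otimes> x \<oplus> b \<otimes> d x) \<ominus> (d x \<otimes> b \<oplus> x \<otimes> d b)) = (\<ominus> d b) \<otimes> x \<ominus> x \<otimes> (\<ominus> d b)"
          using True b db dx by algebra
        then show ?thesis using True b db dx d by (simp add: Der_simps der_minus der_mult)
      qed (simp add: Der_simps)
    qed
    then show "a \<otimes>\<^bsub>Der\<^esub> d \<in> inner_derivations B" using db by (auto simp: inner_derivations_def)
  qed
  ultimately show ?thesis
    by (intro nonassoc_ideal.intro nonassoc_ideal_axioms.intro Der_nonassoc_algebra)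
qed

sublocale Inner: nonassoc_ideal "inner_derivations B" Der
  by (rule inner_nonassoc_ideal)

lemma HH1_lie_algebra: "lie_algebra (scalars :: 'k ring) (HH1 B)"
  unfolding HH1_def by (rule Inner.quotient_lie_algebra[OF Der_lie_algebra])

section \<open>The center as a Lie module\<close>

lemma HH0_carrier: "carrier (HH0 B) = {z \<in> carrier B. \<forall>x\<in>carrier B. z \<otimes> x = x \<otimes> z}"
  by (simp add: HH0_def)

lemma HH0_simps:
  "x \<oplus>\<^bsub>HH0 B\<^esub> y = x \<oplus> y" "\<zero>\<^bsub>HH0 B\<^esub> = \<zero>" "c \<odot>\<^bsub>HH0 B\<^esub> x = c \<odot> x"
  by (simp_all add: HH0_def)

lemma HH0_submodule: "submodule (carrier (HH0 B)) (scalars :: 'k ring) B"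
  by (rule submoduleI)
    (auto simp: HH0_carrier l_distr r_distr l_minus r_minus mult_smult_left mult_smult_right)

lemma HH0_module: "module (scalars :: 'k ring) (HH0 B)"
  using submodule.submodule_is_module[OF HH0_submodule module_axioms]
  by (simp add: HH0_def)

text \<open>Apply \<open>d\<close> to \<open>z \<otimes> x = x \<otimes> z\<close>; the terms
  \<open>z \<otimes> d x\<close> and \<open>d x \<otimes> z\<close> agree because \<open>z\<close>
  is central, and what remains is the claim.\<close>

lemma HH0_der:
  assumes "is_derivation B d" "z \<in> carrier (HH0 B)"
  shows "d z \<in> carrier (HH0 B)"
proof -
  have z: "z \<in> carrier B" and comm: "\<And>x. x \<in> carrier B \<Longrightarrow> z \<otimes> x = x \<otimes> z"
    using assms by (auto simp: HH0_carrier)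
  have "d z \<otimes> x = x \<otimes> d z" if x: "x \<in> carrier B" for x
  proof -
    have "d z \<otimes> x \<oplus> z \<otimes> d x = d x \<otimes> z \<oplus> x \<otimes> d z"
      using arg_cong[OF comm[OF x], of d] z x assms(1) by (simp add: der_mult)
    also have "\<dots> = x \<otimes> d z \<oplus> z \<otimes> d x"
      using comm[of "d x"] z x assms(1) by (simp add: der_closed a_comm)
    finally show ?thesis using z x assms(1) by (simp add: der_closed)
  qed
  then show ?thesis using z assms(1) by (auto simp: HH0_carrier der_closed)
qed

text \<open>Members of the class differ from \<open>d\<close> by a commutator with some
  \<open>b\<close>, which vanishes at the central \<open>z\<close>; so \<open>the_elem\<close> is
  applied to a singleton.\<close>

lemma HH1_act_class:
  assumes "is_derivation B d" "z \<in> carrier (HH0 B)"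
  shows "HH1_act (Inner.cls d) z = d z"
proof -
  have z: "z \<in> carrier B" and comm: "\<And>x. x \<in> carrier B \<Longrightarrow> z \<otimes> x = x \<otimes> z"
    using assms by (auto simp: HH0_carrier)
  have d: "d \<in> carrier Der" using assms by (simp add: Der_simps)
  have "e z = d z" if e: "e \<in> Inner.cls d" for e
  proof -
    obtain a where a: "a \<in> inner_derivations B" "e = a \<oplus>\<^bsub>Der\<^esub> d" using Inner.cls_memE[OF e d] .
    then obtain b where b: "b \<in> carrier B" "a = (\<lambda>x\<in>carrier B. b \<otimes> x \<ominus> x \<otimes> b)"
      by (auto simp: inner_derivations_def)
    have "a z = \<zero>" using b z comm[of b] by (simp add: minus_eq r_neg)
    then show ?thesis using a z assms by (simp add: Der_simps der_closed)
  qed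
  then have "(\<lambda>d. d z) ` Inner.cls d = {d z}"
    using Inner.cls_self[OF d] by blast
  then show ?thesis by (simp add: HH1_act_def)
qed

lemma HH1_cases:
  assumes "C \<in> carrier (HH1 B)"
  obtains d where "is_derivation B d" "C = Inner.cls d"
  using assms unfolding HH1_def Inner.carrier_Q by (auto simp: Der_simps)

lemma HH1_class: "is_derivation B d \<Longrightarrow> Inner.cls d \<in> carrier (HH1 B)"
  by (simp add: HH1_def Inner.cls_carrier Der_simps)

lemma HH0_lie_module: "lie_module (scalars :: 'k ring) (HH1 B) (HH0 B) HH1_act"
proof (intro lie_module.intro lie_module_axioms.intro HH1_lie_algebra HH0_module)
  fix C v assume C: "C \<in> carrier (HH1 B)" and v: "v \<in> carrier (HH0 B)"
  obtain d where d: "is_derivation B d" "C = Inner.cls d" using C by (rule HH1_cases)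
  interpret V: module "scalars :: 'k ring" "HH0 B" by (rule HH0_module)
  have v': "v \<in> carrier B" using v by (simp add: HH0_carrier)
  have dD: "d \<in> carrier Der" using d by (simp add: Der_simps)
  show "HH1_act C v \<in> carrier (HH0 B)" using d v by (simp add: HH1_act_class HH0_der)
  show "HH1_act (c \<odot>\<^bsub>HH1 B\<^esub> C) v = c \<odot>\<^bsub>HH0 B\<^esub> HH1_act C v" for c
  proof -
    have "c \<odot>\<^bsub>HH1 B\<^esub> C = Inner.cls (\<lambda>x\<in>carrier B. c \<odot> d x)"
      using Inner.cls_smult[OF dD, of c] d by (simp add: HH1_def Der_simps)
    then show ?thesis using d v v' by (simp add: HH1_act_class der_scale HH0_simps)
  qed
  show "HH1_act C (c \<odot>\<^bsub>HH0 B\<^esub> v) = c \<odot>\<^bsub>HH0 B\<^esub> HH1_act C v" for c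
    using d v v' V.smult_closed[of c v] by (simp add: HH1_act_class HH0_simps der_smult)
  fix w assume w: "w \<in> carrier (HH0 B)"
  then have "w \<in> carrier B" by (simp add: HH0_carrier)
  then show "HH1_act C (v \<oplus>\<^bsub>HH0 B\<^esub> w) = HH1_act C v \<oplus>\<^bsub>HH0 B\<^esub> HH1_act C w"
    using d v w v' V.a_closed[of v w] by (simp add: HH1_act_class HH0_simps der_add)
next
  fix C E v assume C: "C \<in> carrier (HH1 B)" "E \<in> carrier (HH1 B)" and v: "v \<in> carrier (HH0 B)"
  interpret V: module "scalars :: 'k ring" "HH0 B" by (rule HH0_module)
  obtain d e where d: "is_derivation B d" "C = Inner.cls d" "is_derivation B e" "E = Inner.cls e"
    using C by (metis HH1_cases)
  have v': "v \<in> carrier B" using v by (simp add: HH0_carrier)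
  have D: "d \<in> carrier Der" "e \<in> carrier Der" using d by (simp_all add: Der_simps)
  have "C \<oplus>\<^bsub>HH1 B\<^esub> E = Inner.cls (\<lambda>x\<in>carrier B. d x \<oplus> e x)"
    using Inner.cls_add[OF D] d by (simp add: HH1_def Der_simps)
  then show "HH1_act (C \<oplus>\<^bsub>HH1 B\<^esub> E) v = HH1_act C v \<oplus>\<^bsub>HH0 B\<^esub> HH1_act E v"
    using d v v' by (simp add: HH1_act_class der_plus HH0_simps)
  have "C \<otimes>\<^bsub>HH1 B\<^esub> E = Inner.cls (\<lambda>x\<in>carrier B. d (e x) \<ominus> e (d x))"
    using Inner.cls_mult[OF D] d by (simp add: HH1_def Der_simps)
  \<comment> \<open>Subtraction is not a field of the record but is derived from additive inverses
    within the carrier, so it has to be compared anew once the carrier is restricted to the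
    center.\<close>
  moreover have "x \<ominus>\<^bsub>HH0 B\<^esub> y = x \<ominus> y" if "x \<in> carrier (HH0 B)" "y \<in> carrier (HH0 B)" for x y
  proof -
    have y: "y \<in> carrier B" using that by (simp add: HH0_carrier)
    have m: "\<ominus> y \<in> carrier (HH0 B)" using submoduleE(3)[OF HH0_submodule that(2)] .
    have "\<ominus>\<^bsub>HH0 B\<^esub> y = \<ominus> y"
      by (rule V.minus_equality) (use that m y in \<open>simp_all add: HH0_simps l_neg\<close>)
    then show ?thesis by (simp add: V.minus_eq minus_eq HH0_simps)
  qed
  ultimately show "HH1_act (C \<otimes>\<^bsub>HH1 B\<^esub> E) v = HH1_act C (HH1_act E v) \<ominus>\<^bsub>HH0 B\<^esub> HH1_act E (HH1_act C v)"
    using d v v' by (simp add: HH1_act_class der_commutator HH0_der)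
qed

end

lemma lie_module_restrict:
  assumes "lie_module R L V act" "lie_submodule W R L V act"
  shows "lie_module R L (V\<lparr>carrier := W\<rparr>) act"
proof -
  interpret V: lie_module R L V act by fact
  interpret W: lie_submodule W R L V act by fact
  have sm: "submodule W R V" by unfold_locales
  have m: "module R (V\<lparr>carrier := W\<rparr>)"
    using W.submodule_is_module[OF V.V.module_axioms] .
  interpret W': module R "V\<lparr>carrier := W\<rparr>" by (rule m)
  have mem: "w \<in> W \<Longrightarrow> w \<in> carrier V" for w using V.V.submoduleE(1)[OF sm] by blast
  \<comment> \<open>Again the derived subtraction of the restricted record must be identified with
    the original one.\<close>
  have minus: "x \<ominus>\<^bsub>V\<lparr>carrier := W\<rparr>\<^esub> y = x \<ominus>\<^bsub>V\<^esub> y" if "x \<in> W" "y \<in> W" for x y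
  proof -
    have "\<ominus>\<^bsub>V\<^esub> y \<in> W" using V.V.submoduleE(3)[OF sm] that by simp
    then have "\<ominus>\<^bsub>V\<lparr>carrier := W\<rparr>\<^esub> y = \<ominus>\<^bsub>V\<^esub> y"
      by (intro W'.minus_equality) (use that mem in \<open>simp_all add: V.V.l_neg\<close>)
    then show ?thesis by (simp add: W'.minus_eq V.V.minus_eq)
  qed
  show ?thesis
    by (intro lie_module.intro lie_module_axioms.intro V.L.lie_algebra_axioms m)
      (auto simp: W.act_stable mem V.act_add_left V.act_add_right V.act_smult_left V.act_smult_right V.act_bracket minus)
qed

section \<open>The path algebra of a finite quiver\<close>

abbreviation lk :: "('a \<Rightarrow>\<^sub>0 'b::zero) \<Rightarrow> 'a \<Rightarrow> 'b" where
  "lk \<equiv> Poly_Mapping.lookup"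

lemma path_algebra_simps:
  "carrier (path_algebra G) = {x. Poly_Mapping.keys x \<subseteq> paths G}"
  "x \<oplus>\<^bsub>path_algebra G\<^esub> y = x + y"
  "\<zero>\<^bsub>path_algebra G\<^esub> = 0"
  "c \<odot>\<^bsub>path_algebra G\<^esub> x = Poly_Mapping.map ((*) c) x"
  by (simp_all add: path_algebra_def)

lemma lookup_scale: "lk (Poly_Mapping.map ((*) (c::'k::field)) x) p = c * lk x p"
  by (simp add: Poly_Mapping.map.rep_eq when_def)

lemma (in pre_digraph) awlast_append: "awlast u (p @ q) = awlast (awlast u p) q"
  by (induction p arbitrary: u) auto

text \<open>A path has one factorization per cut point, so the double sum over the supports
  collapses to a convolution over \<open>k\<close>. All later computations with products start from
  this form.\<close>

lemma lookup_path_mult: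
  fixes x y :: "('v \<times> 'a list) \<Rightarrow>\<^sub>0 'k::field"
  shows "lk (x \<otimes>\<^bsub>path_algebra G\<^esub> y) (u, r) =
    (\<Sum>k\<le>length r. lk x (u, take k r) * lk y (pre_digraph.awlast G u (take k r), drop k r))"
proof -
  let ?al = "pre_digraph.awlast G"
  define f where "f = (\<lambda>(v, p). lk x (v, p) * lk y (?al v p, drop (length p) r))"
  define P where "P = (\<lambda>k. (u, take k r)) ` {..length r}"
  \<comment> \<open>For a fixed left factor \<open>(w, p)\<close> at most one right factor
    contributes at \<open>(u, r)\<close>, namely what remains of \<open>r\<close> after
    \<open>p\<close>, and only if \<open>w = u\<close> and \<open>p\<close> is an initial segment of
    \<open>r\<close>.\<close>
  have inner: "(\<Sum>(v, q)\<in>Poly_Mapping.keys y. lk (if ?al w p = v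
        then Poly_Mapping.single (w, p @ q) (lk x (w, p) * lk y (v, q)) else 0) (u, r))
      = (if (w, p) \<in> P then f (w, p) else 0)" for w p
  proof (cases "(w, p) \<in> P")
    case True
    then obtain k where k: "k \<le> length r" "w = u" "p = take k r" by (auto simp: P_def)
    then have w: "w = u" "r = p @ drop (length p) r" by (simp_all add: min_def)
    have "(\<Sum>(v, q)\<in>Poly_Mapping.keys y. lk (if ?al w p = v
        then Poly_Mapping.single (w, p @ q) (lk x (w, p) * lk y (v, q)) else 0) (u, r))
      = (\<Sum>c\<in>Poly_Mapping.keys y. if c = (?al w p, drop (length p) r) then lk x (w, p) * lk y c else 0)"
    proof (intro sum.cong refl)
      fix c :: "'v \<times> 'a list"
      obtain v q where c: "c = (v, q)" by (cases c)
      have "p @ q = r \<longleftrightarrow> q = drop (length p) r" using w(2) by (metis append_eq_conv_conj)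
      then show "(case c of (v, q) \<Rightarrow> lk (if ?al w p = v
          then Poly_Mapping.single (w, p @ q) (lk x (w, p) * lk y (v, q)) else 0) (u, r))
        = (if c = (?al w p, drop (length p) r) then lk x (w, p) * lk y c else 0)"
        using w(1) w(2)[symmetric] by (simp add: c lookup_single when_def)
    qed
    also have "\<dots> = f (w, p)"
      by (auto simp: sum.delta f_def in_keys_iff)
    finally show ?thesis using True by simp
  next
    case False
    have "p @ q = r \<Longrightarrow> w = u \<Longrightarrow> False" for q
    proof -
      assume "p @ q = r" "w = u"
      then have "(w, p) = (u, take (length p) r)" and "length p \<le> length r"
        by (metis append_eq_conv_conj, metis length_append le_add1)
      then have "(w, p) \<in> P" unfolding P_def by (metis atMost_iff image_eqI)
      then show "False" using False by simp
    qed
    then show ?thesis using False by (auto simp: lookup_single when_def intro!: sum.neutral)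
  qed
  have "lk (x \<otimes>\<^bsub>path_algebra G\<^esub> y) (u, r) = 
      (\<Sum>(w, p)\<in>Poly_Mapping.keys x. (\<Sum>(v, q)\<in>Poly_Mapping.keys y. lk (if ?al w p = v
        then Poly_Mapping.single (w, p @ q) (lk x (w, p) * lk y (v, q)) else 0) (u, r)))"
    by (simp add: path_algebra_def lookup_sum case_prod_unfold)
  also have "\<dots> = (\<Sum>c\<in>Poly_Mapping.keys x. if c \<in> P then f c else 0)"
    unfolding inner by (rule sum.cong) auto
  also have "\<dots> = (\<Sum>c\<in>Poly_Mapping.keys x \<inter> P. f c)"
    by (simp add: sum.inter_restrict)
  also have "\<dots> = (\<Sum>c\<in>P. f c)"
    by (rule sum.mono_neutral_left) (auto simp: P_def f_def in_keys_iff)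
  also have "\<dots> = (\<Sum>k\<le>length r. f (u, take k r))"
  proof -
    have inj: "inj_on (\<lambda>k. (u, take k r)) {..length r}"
    proof (rule inj_onI)
      fix k l assume "k \<in> {..length r}" "l \<in> {..length r}" "(u, take k r) = (u, take l r)"
      then have "length (take k r) = length (take l r)" by simp
      then show "k = l" using \<open>k \<in> _\<close> \<open>l \<in> _\<close> by simp
    qed
    show ?thesis unfolding P_def by (simp add: sum.reindex[OF inj])
  qed
  also have "\<dots> = (\<Sum>k\<le>length r. lk x (u, take k r) * lk y (?al u (take k r), drop k r))"
    by (rule sum.cong) (auto simp: f_def min_def)
  finally show ?thesis .
qed

text \<open>Both sides sum over the ways to cut \<open>r\<close> into three pieces;
  \<open>g j l\<close> is the contribution of the cut into pieces of lengths \<open>j\<close>,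
  \<open>l\<close> and the rest.\<close>

lemma path_mult_assoc:
  fixes x y z :: "('v \<times> 'a list) \<Rightarrow>\<^sub>0 'k::field"
  shows "x \<otimes>\<^bsub>path_algebra G\<^esub> y \<otimes>\<^bsub>path_algebra G\<^esub> z = x \<otimes>\<^bsub>path_algebra G\<^esub> (y \<otimes>\<^bsub>path_algebra G\<^esub> z)"
proof (rule poly_mapping_eqI)
  fix c :: "'v \<times> 'a list"
  obtain u r where c: "c = (u, r)" by (cases c)
  let ?al = "pre_digraph.awlast G" and ?n = "length r"
  define g where "g j l = lk x (u, take j r) * (lk y (?al u (take j r), take l (drop j r)) *
    lk z (?al u (take (j + l) r), drop (j + l) r))" for j l
  have "lk (x \<otimes>\<^bsub>path_algebra G\<^esub> y \<otimes>\<^bsub>path_algebra G\<^esub> z) c =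
      (\<Sum>k\<le>?n. \<Sum>j\<le>k. g j (k - j))"
    unfolding c lookup_path_mult sum_distrib_right
    by (intro sum.cong refl) (auto simp: g_def min_def drop_take mult.assoc intro!: sum.cong)
  also have "\<dots> = (\<Sum>(j, l)\<in>{(j, l). j + l \<le> ?n}. g j l)"
    by (rule sum.triangle_reindex_eq[symmetric])
  also have "\<dots> = (\<Sum>j\<le>?n. \<Sum>l\<le>?n - j. g j l)"
    by (subst sum.Sigma) (auto intro!: sum.cong)
  also have "\<dots> = lk (x \<otimes>\<^bsub>path_algebra G\<^esub> (y \<otimes>\<^bsub>path_algebra G\<^esub> z)) c"
    unfolding c lookup_path_mult sum_distrib_left
  proof (intro sum.cong refl)
    fix j l
    have "drop l (drop j r) = drop (j + l) r" by (simp add: add.commute)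
    moreover have "?al (?al u (take j r)) (take l (drop j r)) = ?al u (take (j + l) r)"
      by (simp only: take_add pre_digraph.awlast_append)
    ultimately show "g j l = lk x (u, take j r) * (lk y (?al u (take j r), take l (drop j r)) *
        lk z (?al (?al u (take j r)) (take l (drop j r)), drop l (drop j r)))"
      by (simp only: g_def)
  qed simp
  finally show "lk (x \<otimes>\<^bsub>path_algebra G\<^esub> y \<otimes>\<^bsub>path_algebra G\<^esub> z) c = lk (x \<otimes>\<^bsub>path_algebra G\<^esub> (y \<otimes>\<^bsub>path_algebra G\<^esub> z)) c" .
qed

lemma path_mult_distrib:
  fixes x y z :: "('v \<times> 'a list) \<Rightarrow>\<^sub>0 'k::field"
  shows "(x + y) \<otimes>\<^bsub>path_algebra G\<^esub> z = x \<otimes>\<^bsub>path_algebra G\<^esub> z + y \<otimes>\<^bsub>path_algebra G\<^esub> z"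
    and "x \<otimes>\<^bsub>path_algebra G\<^esub> (y + z) = x \<otimes>\<^bsub>path_algebra G\<^esub> y + x \<otimes>\<^bsub>path_algebra G\<^esub> z"
  by (auto intro!: poly_mapping_eqI simp: lookup_path_mult lookup_add algebra_simps sum.distrib)

lemma path_mult_scale:
  fixes x y :: "('v \<times> 'a list) \<Rightarrow>\<^sub>0 'k::field"
  shows "Poly_Mapping.map ((*) c) x \<otimes>\<^bsub>path_algebra G\<^esub> y = Poly_Mapping.map ((*) c) (x \<otimes>\<^bsub>path_algebra G\<^esub> y)"
    and "x \<otimes>\<^bsub>path_algebra G\<^esub> Poly_Mapping.map ((*) c) y = Poly_Mapping.map ((*) c) (x \<otimes>\<^bsub>path_algebra G\<^esub> y)"
  by (auto intro!: poly_mapping_eqI simp: lookup_path_mult lookup_scale sum_distrib_left algebra_simps)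

lemma path_mult_single:
  fixes a b :: "'k::field"
  shows "Poly_Mapping.single (u, p) a \<otimes>\<^bsub>path_algebra G\<^esub> Poly_Mapping.single (v, q) b =
    (if pre_digraph.awlast G u p = v then Poly_Mapping.single (u, p @ q) (a * b) else 0)"
  by (simp add: path_algebra_def)

locale finite_quiver = wf_digraph G for G :: "('v, 'a) pre_digraph" +
  assumes finite_verts: "finite (verts G)"
begin

section \<open>Ring and vector space structure of the path algebra\<close>

lemma paths_iff: "(u, p) \<in> paths G \<longleftrightarrow> u \<in> verts G \<and> set p \<subseteq> arcs G \<and> cas u p (awlast u p)"
  by (auto simp: paths_def awalk_def awlast_if_cas)

lemma paths_append_iff:
  "(u, p @ q) \<in> paths G \<longleftrightarrow> (u, p) \<in> paths G \<and> (awlast u p, q) \<in> paths G"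
proof
  assume "(u, p @ q) \<in> paths G"
  then obtain w where "awalk u (p @ q) w" by (auto simp: paths_def)
  then show "(u, p) \<in> paths G \<and> (awlast u p, q) \<in> paths G"
    by (auto simp: paths_def)
next
  assume "(u, p) \<in> paths G \<and> (awlast u p, q) \<in> paths G"
  then obtain w where "awalk u p (awlast u p)" "awalk (awlast u p) q w"
    by (auto simp: paths_def)
  then show "(u, p @ q) \<in> paths G" by (auto simp: paths_def)
qed

lemma paths_end: "(u, p) \<in> paths G \<Longrightarrow> awlast u p \<in> verts G"
  using paths_append_iff[of u p "[]"] by (simp add: paths_iff)

lemma lookup_outside: "x \<in> carrier (path_algebra G) \<Longrightarrow> c \<notin> paths G \<Longrightarrow> lk x c = 0"
  by (auto simp: path_algebra_simps in_keys_iff)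

lemma carrierI: "(\<And>c. c \<notin> paths G \<Longrightarrow> lk x c = 0) \<Longrightarrow> x \<in> carrier (path_algebra G)"
  by (auto simp: path_algebra_simps in_keys_iff)

lemma single_carrier: "c \<in> paths G \<Longrightarrow> Poly_Mapping.single c a \<in> carrier (path_algebra G)"
  by (rule carrierI) (auto simp: lookup_single when_def)

lemma lookup_one:
  "lk (\<one>\<^bsub>path_algebra G\<^esub> :: _ \<Rightarrow>\<^sub>0 'k::field) (v, q) = (if q = [] \<and> v \<in> verts G then 1 else 0)"
proof -
  have "lk (\<one>\<^bsub>path_algebra G\<^esub> :: _ \<Rightarrow>\<^sub>0 'k) (v, q) = (\<Sum>w\<in>verts G. if w = v then (if q = [] then 1 else 0) else 0)"
    unfolding path_algebra_def by (auto simp: lookup_sum lookup_single when_def intro!: sum.cong)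
  then show ?thesis using finite_verts by (simp add: sum.delta)
qed

lemma path_one_mult:
  assumes "x \<in> carrier (path_algebra G)"
  shows "\<one>\<^bsub>path_algebra G\<^esub> \<otimes>\<^bsub>path_algebra G\<^esub> x = (x :: _ \<Rightarrow>\<^sub>0 'k::field)"
proof (rule poly_mapping_eqI)
  fix c :: "'v \<times> 'a list"
  obtain u r where c: "c = (u, r)" by (cases c)
  have "lk (\<one>\<^bsub>path_algebra G\<^esub> \<otimes>\<^bsub>path_algebra G\<^esub> x) c = 
    (\<Sum>k\<le>length r. if k = 0 then (if u \<in> verts G then lk x (u, r) else 0) else 0)"
    unfolding c lookup_path_mult by (intro sum.cong refl) (auto simp: lookup_one)
  also have "\<dots> = lk x c"
    using lookup_outside[OF assms, of "(u, r)"] by (auto simp: sum.delta c paths_iff)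
  finally show "lk (\<one>\<^bsub>path_algebra G\<^esub> \<otimes>\<^bsub>path_algebra G\<^esub> x) c = lk x c" .
qed

lemma path_mult_one:
  assumes "x \<in> carrier (path_algebra G)"
  shows "x \<otimes>\<^bsub>path_algebra G\<^esub> \<one>\<^bsub>path_algebra G\<^esub> = (x :: _ \<Rightarrow>\<^sub>0 'k::field)"
proof (rule poly_mapping_eqI)
  fix c :: "'v \<times> 'a list"
  obtain u r where c: "c = (u, r)" by (cases c)
  have "lk (x \<otimes>\<^bsub>path_algebra G\<^esub> \<one>\<^bsub>path_algebra G\<^esub>) c = 
    (\<Sum>k\<le>length r. if k = length r then (if awlast u r \<in> verts G then lk x (u, r) else 0) else 0)"
    unfolding c lookup_path_mult by (intro sum.cong refl) (auto simp: lookup_one)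
  also have "\<dots> = lk x c"
    using lookup_outside[OF assms, of "(u, r)"] by (auto simp: sum.delta c dest: paths_end)
  finally show "lk (x \<otimes>\<^bsub>path_algebra G\<^esub> \<one>\<^bsub>path_algebra G\<^esub>) c = lk x c" .
qed

text \<open>If \<open>(u, r)\<close> is not a path, then at every cut point one of the two pieces is
  not a path either, so each term of the convolution vanishes.\<close>

lemma path_mult_closed:
  assumes "x \<in> carrier (path_algebra G)" "y \<in> carrier (path_algebra G)"
  shows "x \<otimes>\<^bsub>path_algebra G\<^esub> y \<in> carrier (path_algebra G :: ('k::field, _) module)"
proof (rule carrierI)
  fix c assume c: "c \<notin> paths G"
  obtain u r where ur: "c = (u, r)" by (cases c)
  have "lk x (u, take k r) * lk y (awlast u (take k r), drop k r) = 0" for k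
  proof -
    have "(u, take k r) \<notin> paths G \<or> (awlast u (take k r), drop k r) \<notin> paths G"
      using c paths_append_iff[of u "take k r" "drop k r"] by (auto simp: ur)
    then show ?thesis using lookup_outside assms by fastforce
  qed
  then show "lk (x \<otimes>\<^bsub>path_algebra G\<^esub> y) c = 0" by (simp only: ur lookup_path_mult sum.neutral_const)
qed

lemma path_algebra_abelian_group: "abelian_group (path_algebra G :: ('k::field, _) module)"
proof (rule abelian_groupI)
  fix x :: "_ \<Rightarrow>\<^sub>0 'k" assume "x \<in> carrier (path_algebra G)"
  then show "\<exists>y\<in>carrier (path_algebra G). y \<oplus>\<^bsub>path_algebra G\<^esub> x = \<zero>\<^bsub>path_algebra G\<^esub>"
    by (intro bexI[of _ "- x"]) (auto simp: path_algebra_simps)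
  fix y :: "_ \<Rightarrow>\<^sub>0 'k" assume "x \<in> carrier (path_algebra G)" "y \<in> carrier (path_algebra G)"
  then show "x \<oplus>\<^bsub>path_algebra G\<^esub> y \<in> carrier (path_algebra G)"
    by (intro carrierI) (simp add: path_algebra_simps(2) lookup_add lookup_outside)
qed (simp_all add: path_algebra_simps add.assoc add.commute)

lemma path_algebra_assoc_algebra: "assoc_algebra (path_algebra G :: ('k::field, _) module)"
proof -
  let ?A = "path_algebra G :: ('k, _) module"
  have ring: "ring ?A"
  proof (rule ringI[OF path_algebra_abelian_group monoidI])
    show "\<one>\<^bsub>?A\<^esub> \<in> carrier ?A"
      by (rule carrierI) (auto simp: lookup_one paths_iff)
  qed (simp_all add: path_mult_closed path_mult_assoc path_one_mult path_mult_one
      path_mult_distrib path_algebra_simps(2))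
  have "module (scalars :: 'k ring) ?A"
  proof (rule moduleI[OF scalars_cring path_algebra_abelian_group])
    fix a :: 'k and x assume "x \<in> carrier ?A"
    then show "a \<odot>\<^bsub>?A\<^esub> x \<in> carrier ?A"
      by (intro carrierI) (simp add: path_algebra_simps(4) lookup_scale lookup_outside)
  qed (auto intro!: poly_mapping_eqI simp: path_algebra_simps lookup_scale lookup_add algebra_simps)
  then have "nonassoc_algebra ?A"
    by (intro nonassoc_algebra.intro nonassoc_algebra_axioms.intro)
      (simp_all add: path_mult_closed path_mult_scale path_mult_distrib path_algebra_simps(2,4))
  then show ?thesis using ring by (rule assoc_algebra.intro)
qed

lemma path_minus:
  assumes "x \<in> carrier (path_algebra G)" "y \<in> carrier (path_algebra G)"
  shows "x \<ominus>\<^bsub>path_algebra G\<^esub> y = (x - y :: _ \<Rightarrow>\<^sub>0 'k::field)"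
proof -
  interpret abelian_group "path_algebra G :: ('k, _) module" by (rule path_algebra_abelian_group)
  have "\<ominus>\<^bsub>path_algebra G\<^esub> y = - y"
    by (rule minus_equality) (use assms in \<open>simp_all add: path_algebra_simps\<close>)
  then show ?thesis by (simp add: minus_eq path_algebra_simps)
qed

end

section \<open>Zigzag coefficients and the relation ideal\<close>

text \<open>
  A path of positive length that is not one of the zigzags \<open>zz i b l\<close> below contains a monomial
  relation. The locale parameter \<open>K\<close> only fixes the type of the scalars. Arrow indices are
  reduced modulo \<open>m\<close>, so that \<open>i\<close> ranges over all integers.
\<close>

locale zigzag =
  fixes m N :: nat and K :: "'k::field itself"
  assumes m_ge: "m \<ge> 3" and N_ge: "N \<ge> 1"
begin

text \<open>The flag \<open>b\<close> tells the direction of the first arrow: \<open>True\<close>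
  for an \<open>Arr\<close>, leaving vertex \<open>i\<close>, and \<open>False\<close> for a
  \<open>Bar\<close>, leaving vertex \<open>i + 1\<close>.\<close>

definition start :: "int \<Rightarrow> bool \<Rightarrow> int" where
  "start i b = (if b then i else i + 1) mod int m"

definition arw :: "int \<Rightarrow> bool \<Rightarrow> arrow" where
  "arw i b = (if b then Arr (i mod int m) else Bar (i mod int m))"

fun zz :: "int \<Rightarrow> bool \<Rightarrow> nat \<Rightarrow> arrow list" where
  "zz i b 0 = []"
| "zz i b (Suc l) = arw i b # zz i (\<not> b) l"

definition coef :: "'k kQ \<Rightarrow> int \<Rightarrow> bool \<Rightarrow> nat \<Rightarrow> 'k" where
  "coef x i b l = lk x (start i b, zz i b l)"

definition zpath :: "int \<Rightarrow> bool \<Rightarrow> nat \<Rightarrow> 'k kQ" where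
  "zpath i b l = Poly_Mapping.single (start i b, zz i b l) 1"

text \<open>The two zigzags of length \<open>2 * N\<close> starting at vertex \<open>i\<close> are
  identified by the relations; this sum is the coefficient of their common class
  \<open>eps m N i\<close>.\<close>

definition topc :: "'k kQ \<Rightarrow> int \<Rightarrow> 'k" where
  "topc x i = coef x i True (2 * N) + coef x (i - 1) False (2 * N)"

abbreviation P :: "('k, 'k kQ) module" where "P \<equiv> kQ m"

lemma m_pos: "int m > 0" using m_ge by simp

lemma quiver_simps:
  "verts (quiver m) = {0..<int m}"
  "arcs (quiver m) = Arr ` {0..<int m} \<union> Bar ` {0..<int m}"
  "tail (quiver m) (Arr i) = i" "tail (quiver m) (Bar i) = (i + 1) mod int m"
  "head (quiver m) (Arr i) = (i + 1) mod int m" "head (quiver m) (Bar i) = i"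
  by (simp_all add: quiver_def)

sublocale G: finite_quiver "quiver m"
  by unfold_locales (use m_pos in \<open>auto simp: quiver_simps\<close>)

sublocale P: assoc_algebra P
  by (rule G.path_algebra_assoc_algebra)

section \<open>Combinatorics of zigzags\<close>

lemma start_mod [simp]: "start (i mod int m) b = start i b"
  by (simp add: start_def mod_add_left_eq)

lemma arw_mod [simp]: "arw (i mod int m) b = arw i b"
  by (simp add: arw_def)

lemma zz_mod [simp]: "zz (i mod int m) b l = zz i b l"
  by (induction l arbitrary: b) simp_all

lemma zz_cong: "i mod int m = j mod int m \<Longrightarrow> zz i b l = zz j b l"
  using zz_mod[of i b l] zz_mod[of j b l] by simp

lemma coef_mod [simp]: "coef x (i mod int m) b l = coef x i b l"
  by (simp add: coef_def)

lemma coef_cong: "i mod int m = j mod int m \<Longrightarrow> coef x i b l = coef x j b l"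
  by (metis coef_mod)

lemma zpath_mod [simp]: "zpath (i mod int m) b l = zpath i b l"
  by (simp add: zpath_def)

lemma zpath_cong: "i mod int m = j mod int m \<Longrightarrow> zpath i b l = zpath j b l"
  by (metis zpath_mod)

lemma tail_arw: "tail (quiver m) (arw i b) = start i b"
  by (simp add: arw_def start_def quiver_simps mod_add_left_eq)

lemma head_arw: "head (quiver m) (arw i b) = start i (\<not> b)"
  by (simp add: arw_def start_def quiver_simps mod_add_left_eq)

lemma arw_arc: "arw i b \<in> arcs (quiver m)"
  using m_pos by (auto simp: arw_def quiver_simps)

lemma start_vert: "start i b \<in> verts (quiver m)"
  using m_pos by (auto simp: start_def quiver_simps)

lemma length_zz [simp]: "length (zz i b l) = l"
  by (induction l arbitrary: b) simp_all

text \<open>The flag flips with every arrow, so after \<open>k\<close> arrows it is \<open>b\<close>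
  for even \<open>k\<close> and \<open>\<not> b\<close> for odd \<open>k\<close>; both cases are the
  formula \<open>b = even k\<close>.\<close>

lemma zz_append: "zz i b (k + l) = zz i b k @ zz i (b = even k) l"
proof (induction k arbitrary: b)
  case (Suc k)
  then show ?case by (cases b) simp_all
qed simp

lemma take_zz: "k \<le> l \<Longrightarrow> take k (zz i b l) = zz i b k"
  using zz_append[of i b k "l - k"] by simp

lemma drop_zz: "k \<le> l \<Longrightarrow> drop k (zz i b l) = zz i (b = even k) (l - k)"
  using zz_append[of i b k "l - k"] by simp

lemma awlast_zz: "G.awlast (start i b) (zz i b l) = start i (b = even l)"
proof (induction l arbitrary: b)
  case (Suc l)
  then show ?case by (cases b) (simp_all add: head_arw)
qed simp

lemma zz_path: "(start i b, zz i b l) \<in> paths (quiver m)"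
proof -
  have "set (zz i b l) \<subseteq> arcs (quiver m)"
    by (induction l arbitrary: b) (simp_all add: arw_arc)
  moreover have "G.cas (start i b) (zz i b l) (start i (b = even l))"
  proof (induction l arbitrary: b)
    case (Suc l)
    from Suc[of "\<not> b"] show ?case by (cases b) (simp_all add: tail_arw head_arw)
  qed simp
  ultimately show ?thesis by (simp add: G.paths_iff start_vert awlast_zz)
qed

lemma zz_eq_iff:
  "zz i b l = zz j c k \<longleftrightarrow> l = k \<and> (l = 0 \<or> (b = c \<and> i mod int m = j mod int m))"
proof -
  have "zz i b l = zz j c l \<longleftrightarrow> l = 0 \<or> (b = c \<and> i mod int m = j mod int m)"
    by (induction l arbitrary: b c) (auto simp: arw_def)
  then show ?thesis by (metis length_zz)
qed

lemma start_cong: "i mod int m = j mod int m \<Longrightarrow> start i b = start j b"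
  by (metis start_mod)

lemma zpath_carrier [simp, intro]: "zpath i b l \<in> carrier P"
  by (simp add: zpath_def G.single_carrier zz_path)

lemma coef_zpath:
  "l > 0 \<Longrightarrow> coef (zpath i b l) j c k = (if k = l \<and> b = c \<and> i mod int m = j mod int m then 1 else 0)"
  by (auto simp: coef_def zpath_def lookup_single when_def zz_eq_iff dest: start_cong)

text \<open>Every piece of a zigzag is a zigzag, so the zigzag coefficients of a product involve
  only those of its factors. All other paths can therefore be ignored from here on.\<close>

lemma coef_mult:
  "coef (x \<otimes>\<^bsub>P\<^esub> y) i b l = (\<Sum>k\<le>l. coef x i b k * coef y i (b = even k) (l - k))"
  unfolding coef_def lookup_path_mult
  by (intro sum.cong) (auto simp: take_zz drop_zz awlast_zz)

lemma coef_zero_length: "coef x i False 0 = coef x (i + 1) True 0"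
  by (simp add: coef_def start_def)

lemma coef_add: "coef (x + y) i b l = coef x i b l + coef y i b l"
  by (simp add: coef_def lookup_add)

lemma coef_module_ops:
  "coef (x \<oplus>\<^bsub>P\<^esub> y) i b l = coef x i b l + coef y i b l"
  "coef \<zero>\<^bsub>P\<^esub> i b l = 0"
  "coef (c \<odot>\<^bsub>P\<^esub> x) i b l = c * coef x i b l"
  by (simp_all add: coef_def lookup_add lookup_scale path_algebra_simps(2-4))

lemma coef_diff: "coef (x - y) i b l = coef x i b l - coef y i b l"
  by (simp add: coef_def lookup_minus)

lemma coef_zero: "coef 0 i b l = 0"
  by (simp add: coef_def)

lemma coef_scale: "coef (Poly_Mapping.map ((*) c) x) i b l = c * coef x i b l"
  by (simp add: coef_def lookup_scale)

lemma coef_sum: "coef (\<Sum>j\<in>S. f j) i b l = (\<Sum>j\<in>S. coef (f j) i b l)"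
  by (simp add: coef_def lookup_sum)

lemma coef_one: "coef \<one>\<^bsub>P\<^esub> i b l = (if l = 0 then 1 else 0)"
  using start_vert[of i b] by (cases l) (simp_all add: coef_def G.lookup_one)

lemma zpath_mult: "zpath i b k \<otimes>\<^bsub>P\<^esub> zpath i (b = even k) l = zpath i b (k + l)"
  by (simp add: zpath_def path_mult_single awlast_zz zz_append)

lemma arr_zpath: "arr m i = zpath i True 1"
  by (simp add: arr_def zpath_def start_def arw_def)

lemma bar_zpath: "bar m i = zpath i False 1"
  by (simp add: bar_def zpath_def start_def arw_def)

lemma arr_bar: "arr m i \<otimes>\<^bsub>P\<^esub> bar m i = zpath i True 2"
  using zpath_mult[of i True 1 1] by (simp add: arr_zpath bar_zpath numeral_2_eq_2)

lemma bar_arr: "bar m i \<otimes>\<^bsub>P\<^esub> arr m i = zpath i False 2"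
  using zpath_mult[of i False 1 1] by (simp add: arr_zpath bar_zpath numeral_2_eq_2)

lemma zpath_pow: "n > 0 \<Longrightarrow> zpath i b 2 [^]\<^bsub>P\<^esub> (n::nat) = zpath i b (2 * n)"
proof (induction n rule: nat_induct_non_zero)
  case (Suc n)
  then show ?case using zpath_mult[of i b "2 * n" 2] by (simp add: add.commute)
qed simp

text \<open>An explicit form of the relation ideal that turns equality in the quotient into a
  comparison of coefficients. Non-zigzag paths of positive length and zigzags longer than
  \<open>2 * N\<close> are left unconstrained.\<close>

definition J :: "'k kQ set" where
  "J = {x \<in> carrier P. (\<forall>i b l. l < 2 * N \<longrightarrow> coef x i b l = 0) \<and> (\<forall>i. topc x i = 0)}"

text \<open>Up to length \<open>2 * N\<close>, the only term of a product that survives pairs a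
  zigzag of length \<open>2 * N\<close> with a trivial path. So multiplication scales
  \<open>topc x i\<close> by the coefficient of the trivial path at vertex \<open>i\<close>.\<close>

lemma ideal_J: "ideal J P"
proof (rule idealI)
  show "ring P" by unfold_locales
  have "submodule J (scalars :: 'k ring) P"
  proof (rule P.submoduleI)
    fix x assume x: "x \<in> J"
    then have "\<ominus>\<^bsub>P\<^esub> x = - x"
      by (intro P.minus_equality) (auto simp: J_def path_algebra_simps)
    moreover have "coef (- x) i b l = - coef x i b l" for i b l by (simp add: coef_def)
    ultimately have c: "coef (\<ominus>\<^bsub>P\<^esub> x) i b l = - coef x i b l" for i b l by simp
    show "\<ominus>\<^bsub>P\<^esub> x \<in> J" using x by (auto simp: J_def topc_def c neg_eq_iff_add_eq_0)
  next
    fix x y assume "x \<in> J" "y \<in> J"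
    then show "x \<oplus>\<^bsub>P\<^esub> y \<in> J"
      by (auto simp: J_def topc_def coef_module_ops P.a_closed algebra_simps)
  next
    fix a :: 'k and x assume "x \<in> J"
    then show "a \<odot>\<^bsub>P\<^esub> x \<in> J"
      by (auto simp: J_def topc_def coef_module_ops simp flip: distrib_left)
  qed (auto simp: J_def topc_def coef_module_ops)
  then show "subgroup J (add_monoid P)" by (simp add: submodule_def)
  fix x y assume x: "x \<in> J" and y: "y \<in> carrier P"
  have low: "coef x i b l = 0" if "l < 2 * N" for i b l using x that by (simp add: J_def)
  have top: "topc x i = 0" for i using x by (simp add: J_def)
  have xy: "coef (x \<otimes>\<^bsub>P\<^esub> y) i b l = (if l = 2 * N then coef x i b l * coef y i b 0 else 0)"
    if "l \<le> 2 * N" for i b l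
  proof -
    have "coef (x \<otimes>\<^bsub>P\<^esub> y) i b l = (\<Sum>k\<le>l. if k = 2 * N then coef x i b k * coef y i b (l - k) else 0)"
      unfolding coef_mult using that by (intro sum.cong) (auto simp: low)
    then show ?thesis using that by (auto simp: sum.delta)
  qed
  have yx: "coef (y \<otimes>\<^bsub>P\<^esub> x) i b l = (if l = 2 * N then coef y i b 0 * coef x i b l else 0)"
    if "l \<le> 2 * N" for i b l
  proof -
    have "coef (y \<otimes>\<^bsub>P\<^esub> x) i b l = (\<Sum>k\<le>l. if k = 0 then (if l = 2 * N then coef y i b 0 * coef x i b l else 0) else 0)"
      unfolding coef_mult using that by (intro sum.cong) (auto simp: low)
    then show ?thesis using that by (simp add: sum.delta)
  qed
  \<comment> \<open>Both zigzags of length \<open>2 * N\<close> at vertex \<open>i\<close> begin and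
    end there, so their coefficients are scaled by the same factor.\<close>
  have z: "coef y (i - 1) False 0 = coef y i True 0" for i
    using coef_zero_length[of y "i - 1"] by simp
  have "topc (x \<otimes>\<^bsub>P\<^esub> y) i = topc x i * coef y i True 0" "topc (y \<otimes>\<^bsub>P\<^esub> x) i = topc x i * coef y i True 0" for i
    by (simp_all add: topc_def xy yx z algebra_simps)
  then show "x \<otimes>\<^bsub>P\<^esub> y \<in> J" "y \<otimes>\<^bsub>P\<^esub> x \<in> J"
    using x y by (auto simp: J_def xy yx top)
qed

lemma zz_not_monotone: "zz j c l \<noteq> [Arr p, Arr q]" "zz j c l \<noteq> [Bar p, Bar q]"
  by (cases l; cases "l - 1"; auto simp: arw_def split: if_splits)+

lemma arr_arr: "arr m i \<otimes>\<^bsub>P\<^esub> arr m (i + 1) =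
    Poly_Mapping.single (i mod int m, [Arr (i mod int m), Arr ((i + 1) mod int m)]) 1"
  by (simp add: arr_def path_mult_single quiver_simps mod_add_left_eq)

lemma bar_bar: "bar m (i + 1) \<otimes>\<^bsub>P\<^esub> bar m i =
    Poly_Mapping.single ((i + 2) mod int m, [Bar ((i + 1) mod int m), Bar (i mod int m)]) 1"
  by (simp add: bar_def path_mult_single quiver_simps add.assoc)

lemma top_relation:
  "(arr m i \<otimes>\<^bsub>P\<^esub> bar m i) [^]\<^bsub>P\<^esub> N \<ominus>\<^bsub>P\<^esub> (bar m (i - 1) \<otimes>\<^bsub>P\<^esub> arr m (i - 1)) [^]\<^bsub>P\<^esub> N
    = zpath i True (2 * N) - zpath (i - 1) False (2 * N)"
  using N_ge by (simp add: arr_bar bar_arr zpath_pow G.path_minus)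

text \<open>The monomial relations are supported off the zigzags, and the third kind has
  coefficients 1 and -1 on the two zigzags of length \<open>2 * N\<close> at one vertex.\<close>

lemma relations_subset_J: "relations m N \<subseteq> J"
proof -
  have "arr m i \<otimes>\<^bsub>P\<^esub> arr m (i + 1) \<in> J" for i
  proof -
    have "arr m i \<otimes>\<^bsub>P\<^esub> arr m (i + 1) \<in> carrier P" by (simp add: arr_zpath)
    then show ?thesis unfolding J_def topc_def arr_arr
      by (auto simp: coef_def lookup_single when_def zz_not_monotone zz_not_monotone[symmetric])
  qed
  moreover have "bar m (i + 1) \<otimes>\<^bsub>P\<^esub> bar m i \<in> J" for i
  proof -
    have "bar m (i + 1) \<otimes>\<^bsub>P\<^esub> bar m i \<in> carrier P" by (simp add: bar_zpath)
    then show ?thesis unfolding J_def topc_def bar_bar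
      by (auto simp: coef_def lookup_single when_def zz_not_monotone zz_not_monotone[symmetric])
  qed
  moreover have "zpath i True (2 * N) - zpath (i - 1) False (2 * N) \<in> J" for i
  proof -
    have "zpath i True (2 * N) - zpath (i - 1) False (2 * N) \<in> carrier P"
      by (simp flip: G.path_minus)
    \<comment> \<open>Guarantees that the coefficients 1 and -1 enter the same
      \<open>topc\<close>.\<close>
    moreover have "i mod int m = j mod int m \<longleftrightarrow> (i - 1) mod int m = (j - 1) mod int m" for j
      by (simp add: mod_eq_dvd_iff)
    ultimately show ?thesis using N_ge
      by (auto simp: J_def topc_def coef_diff coef_zpath)
  qed
  ultimately show ?thesis unfolding relations_def top_relation by blast
qed

section \<open>The ideal generated by the relations\<close>

abbreviation I :: "'k kQ set" where "I \<equiv> relation_ideal m N"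

lemma relations_carrier: "relations m N \<subseteq> carrier P"
  using relations_subset_J by (auto simp: J_def)

lemma I_subset_J: "I \<subseteq> J"
  unfolding relation_ideal_def by (rule P.genideal_minimal[OF ideal_J relations_subset_J])

lemma ideal_I: "ideal I P"
  unfolding relation_ideal_def by (rule P.genideal_ideal[OF relations_carrier])

lemma relations_I: "relations m N \<subseteq> I"
  unfolding relation_ideal_def by (rule P.genideal_self[OF relations_carrier])

text \<open>\<open>Idl\<close> produces a ring ideal; it is also a subspace because scaling by
  \<open>c\<close> is multiplication by \<open>c \<odot> \<one>\<close>.\<close>

lemma nonassoc_ideal_I: "nonassoc_ideal I P"
proof -
  interpret I: ideal I P by (rule ideal_I)
  have "submodule I (scalars :: 'k ring) P"
  proof (intro submodule.intro submodule_axioms.intro)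
    show "subgroup I (add_monoid P)" by (rule I.a_subgroup)
    fix c :: 'k and x assume x: "x \<in> I"
    then have "x \<in> carrier P" by simp
    then have "c \<odot>\<^bsub>P\<^esub> x = (c \<odot>\<^bsub>P\<^esub> \<one>\<^bsub>P\<^esub>) \<otimes>\<^bsub>P\<^esub> x" by (simp add: P.mult_smult_left)
    also have "\<dots> \<in> I" using x by (intro I.I_l_closed) auto
    finally show "c \<odot>\<^bsub>P\<^esub> x \<in> I" .
  qed
  then show ?thesis
    by (intro nonassoc_ideal.intro nonassoc_ideal_axioms.intro P.nonassoc_algebra_axioms)
      (auto intro: I.I_l_closed I.I_r_closed)
qed

sublocale A: nonassoc_ideal I P by (rule nonassoc_ideal_I)

lemma I_add: "x \<in> I \<Longrightarrow> y \<in> I \<Longrightarrow> x + y \<in> I"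
  using A.I.a_closed by (simp add: path_algebra_simps)

lemma I_zero: "0 \<in> I"
  using A.I.zero_closed by (simp add: path_algebra_simps)

lemma I_scale: "x \<in> I \<Longrightarrow> Poly_Mapping.map ((*) c) x \<in> I"
  using A.smult_closed[of c x] by (simp add: path_algebra_simps)

lemma I_sum: "(\<And>i. i \<in> S \<Longrightarrow> f i \<in> I) \<Longrightarrow> (\<Sum>i\<in>S. f i) \<in> I"
  by (induction S rule: infinite_finite_induct) (auto simp: I_add I_zero)

lemma relations_I_mem:
  assumes "i \<in> {0..<int m}"
  shows "arr m i \<otimes>\<^bsub>P\<^esub> arr m (i + 1) \<in> I" "bar m (i + 1) \<otimes>\<^bsub>P\<^esub> bar m i \<in> I"
    "zpath i True (2 * N) - zpath (i - 1) False (2 * N) \<in> I"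
proof -
  define S where "S i = {arr m i \<otimes>\<^bsub>P\<^esub> arr m (i + 1), bar m (i + 1) \<otimes>\<^bsub>P\<^esub> bar m i,
      zpath i True (2 * N) - zpath (i - 1) False (2 * N)}" for i
  have "relations m N = (\<Union>i\<in>{0..<int m}. S i)"
    unfolding relations_def top_relation S_def ..
  then have "S i \<subseteq> I" using relations_I assms by (simp only:) blast
  then show "arr m i \<otimes>\<^bsub>P\<^esub> arr m (i + 1) \<in> I" "bar m (i + 1) \<otimes>\<^bsub>P\<^esub> bar m i \<in> I"
    "zpath i True (2 * N) - zpath (i - 1) False (2 * N) \<in> I"
    by (simp_all only: S_def insert_subset)
qed

lemma relation_ideal_top: "zpath i True (2 * N) - zpath (i - 1) False (2 * N) \<in> I"
proof -
  have "zpath i True (2 * N) = zpath (i mod int m) True (2 * N)"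
    "zpath (i - 1) False (2 * N) = zpath (i mod int m - 1) False (2 * N)"
    by (simp, rule zpath_cong, simp add: mod_diff_left_eq)
  moreover have "i mod int m \<in> {0..<int m}" using m_pos by simp
  ultimately show ?thesis
    using relations_I_mem(3)[of "i mod int m"] by simp
qed

lemma arr_arr_I: "Poly_Mapping.single (i mod int m, [Arr (i mod int m), Arr ((i + 1) mod int m)]) 1 \<in> I"
proof -
  have "arr m (i mod int m) \<otimes>\<^bsub>P\<^esub> arr m (i mod int m + 1) \<in> I"
    using m_pos by (intro relations_I_mem(1)) simp
  then show ?thesis unfolding arr_arr by (simp add: mod_add_left_eq)
qed

lemma bar_bar_I: "Poly_Mapping.single ((i + 2) mod int m, [Bar ((i + 1) mod int m), Bar (i mod int m)]) 1 \<in> I"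
proof -
  have "bar m (i mod int m + 1) \<otimes>\<^bsub>P\<^esub> bar m (i mod int m) \<in> I"
    using m_pos by (intro relations_I_mem(2)) simp
  then show ?thesis unfolding bar_bar by (simp add: mod_add_left_eq)
qed

text \<open>The pairs of consecutive arrows in the same direction around the cycle, that is, the
  monomial relations.\<close>

definition monotone_pair :: "arrow \<Rightarrow> arrow \<Rightarrow> bool" where
  "monotone_pair e e' \<longleftrightarrow> (\<exists>i. e = Arr (i mod int m) \<and> e' = Arr ((i + 1) mod int m)) \<or>
     (\<exists>i. e = Bar ((i + 1) mod int m) \<and> e' = Bar (i mod int m))"

text \<open>Cut the path around the pair: the middle factor is a monomial relation, whose start
  vertex is forced by the tail of \<open>e\<close>, and the ideal absorbs the outer factors.\<close>

lemma monotone_pair_I: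
  assumes "monotone_pair e e'" "(u, p @ [e, e'] @ q) \<in> paths (quiver m)"
  shows "Poly_Mapping.single (u, p @ [e, e'] @ q) c \<in> I"
proof -
  define v w where "v = G.awlast u p" and "w = G.awlast v [e, e']"
  have paths: "(u, p) \<in> paths (quiver m)" "(v, [e, e']) \<in> paths (quiver m)" "(w, q) \<in> paths (quiver m)"
    using assms(2) unfolding v_def w_def by (auto simp only: G.paths_append_iff)
  then have tail: "v = tail (quiver m) e" by (simp add: G.paths_iff)
  from assms(1) have "Poly_Mapping.single (v, [e, e']) 1 \<in> I"
    unfolding monotone_pair_def
  proof (elim disjE exE conjE)
    fix i assume "e = Arr (i mod int m)" "e' = Arr ((i + 1) mod int m)"
    then show ?thesis using arr_arr_I[of i] tail by (simp add: quiver_simps)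
  next
    fix i assume "e = Bar ((i + 1) mod int m)" "e' = Bar (i mod int m)"
    then show ?thesis using bar_bar_I[of i] tail by (simp add: quiver_simps mod_add_left_eq add.assoc)
  qed
  then have "Poly_Mapping.single (u, p) c \<otimes>\<^bsub>P\<^esub> (Poly_Mapping.single (v, [e, e']) 1 \<otimes>\<^bsub>P\<^esub> Poly_Mapping.single (w, q) 1) \<in> I"
    using paths by (intro A.ideal_left A.ideal_right G.single_carrier)
  then show ?thesis by (simp add: path_mult_single v_def w_def)
qed

lemma start_eq_iff: "start i b = start j b \<longleftrightarrow> i mod int m = j mod int m"
proof -
  have "(i + 1) mod int m = (j + 1) mod int m \<longleftrightarrow> i mod int m = j mod int m"
    by (simp only: mod_eq_dvd_iff add_diff_cancel_right)
  then show ?thesis by (simp add: start_def)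
qed

lemma monotone_pairI:
  assumes "start i (\<not> b) = start j b"
  shows "monotone_pair (arw i b) (arw j b)"
proof (cases b)
  case True
  then have "arw i b = Arr (i mod int m)" "arw j b = Arr ((i + 1) mod int m)"
    using assms by (simp_all add: start_def arw_def)
  then show ?thesis unfolding monotone_pair_def by blast
next
  case False
  then have "arw i b = Bar ((j + 1) mod int m)" "arw j b = Bar (j mod int m)"
    using assms by (simp_all add: start_def arw_def)
  then show ?thesis unfolding monotone_pair_def by blast
qed

text \<open>Prepending an arrow to a zigzag either prolongs it or, if the first two arrows then
  point in the same direction, creates a monotone pair.\<close>

lemma path_cases:
  assumes "(u, q) \<in> paths (quiver m)"
  shows "q = [] \<or> (\<exists>i b l. u = start i b \<and> q = zz i b l) \<or>
    (\<exists>p e e' r. q = p @ [e, e'] @ r \<and> monotone_pair e e')"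
  using assms
proof (induction q arbitrary: u)
  case Nil
  show ?case by (rule disjI1) (rule refl)
next
  case (Cons e q)
  have "(u, [e]) \<in> paths (quiver m)" and q: "(head (quiver m) e, q) \<in> paths (quiver m)"
    using Cons.prems G.paths_append_iff[of u "[e]" q] by simp_all
  then have e: "e \<in> arcs (quiver m)" "tail (quiver m) e = u"
    by (simp_all add: G.paths_iff)
  obtain i b where eib: "e = arw i b"
  proof (cases e)
    case (Arr i)
    then have "e = arw i True" using e(1) by (auto simp: arw_def quiver_simps)
    then show ?thesis by (rule that)
  next
    case (Bar i)
    then have "e = arw i False" using e(1) by (auto simp: arw_def quiver_simps)
    then show ?thesis by (rule that)
  qed
  have u: "u = start i b" using e(2) eib tail_arw by simp
  have zigzag: ?case if "e # q = zz i b l" for l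
    using u that by metis
  have monotone: ?case if "e # q = p @ [e1, e2] @ r" "monotone_pair e1 e2" for p e1 e2 r
    using that by metis
  from Cons.IH[OF q] show ?case
  proof (elim disjE exE conjE)
    assume "q = []"
    then show ?thesis by (intro zigzag[of 1]) (simp add: eib)
  next
    fix j c l assume st: "head (quiver m) e = start j c" and q: "q = zz j c l"
    show ?thesis
    proof (cases l)
      case 0
      then show ?thesis using q by (intro zigzag[of 1]) (simp add: eib)
    next
      case (Suc l')
      show ?thesis
      proof (cases "c = b")
        case True
        have "monotone_pair (arw i b) (arw j b)"
          using st True by (intro monotone_pairI) (simp add: eib head_arw)
        moreover have "e # q = [] @ [arw i b, arw j b] @ zz j (\<not> b) l'"
          using q Suc True by (simp add: eib)
        ultimately show ?thesis by (intro monotone)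
      next
        case False
        \<comment> \<open>Arrows of different kinds compose only if they have the same index, so the
          zigzag is continued backwards.\<close>
        then have c: "c = (\<not> b)" by simp
        then have "i mod int m = j mod int m"
          using st by (simp only: eib head_arw start_eq_iff)
        from zz_cong[OF this] have "q = zz i (\<not> b) l" using q c by simp
        then show ?thesis by (intro zigzag[of "Suc l"]) (simp add: eib)
      qed
    qed
  next
    fix p e1 e2 r assume *: "q = p @ [e1, e2] @ r" "monotone_pair e1 e2"
    then have "e # q = (e # p) @ [e1, e2] @ r" by simp
    then show ?thesis using *(2) by (rule monotone)
  qed
qed

lemma zz_snoc: "zz i b (Suc l) = zz i b l @ [arw i (b = even l)]"
  using zz_append[of i b l 1] by simp

text \<open>
  The relations identify the two zigzags of length \<open>2 * N\<close> around a vertex, and continuing one of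
  them in the direction of the other yields a monomial relation.
\<close>

lemma long_zz_I:
  assumes "l > 2 * N"
  shows "Poly_Mapping.single (start i b, zz i b l) c \<in> I"
proof -
  \<comment> \<open>With this neighbouring index, \<open>zz j (\<not> b)\<close> is the other zigzag
    at the start vertex of \<open>zz i b\<close>.\<close>
  define j where "j = (if b then i - 1 else i + 1)"
  have st: "start j (\<not> b) = start i b" by (simp add: start_def j_def)
  have diff: "zpath i b (2 * N) - zpath j (\<not> b) (2 * N) \<in> I"
  proof (cases b)
    case True then show ?thesis using relation_ideal_top[of i] by (simp add: j_def)
  next
    case False
    have "zpath i b (2 * N) - zpath j (\<not> b) (2 * N) = Poly_Mapping.map ((*) (- 1)) (zpath j True (2 * N) - zpath (j - 1) False (2 * N))"
      using False by (intro poly_mapping_eqI) (simp add: j_def lookup_scale lookup_minus)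
    then show ?thesis using I_scale[OF relation_ideal_top[of j]] by simp
  qed
  obtain k where k: "N = Suc k" using N_ge by (cases N) auto
  have last: "zz j (\<not> b) (2 * N) = zz j (\<not> b) (2 * k + 1) @ [arw j b]"
    using zz_snoc[of j "\<not> b" "2 * k + 1"] by (simp add: k)
  have mono: "monotone_pair (arw j b) (arw i b)"
    by (rule monotone_pairI[OF st])
  have "zpath j (\<not> b) (2 * N) \<otimes>\<^bsub>P\<^esub> zpath i b 1 =
      Poly_Mapping.single (start j (\<not> b), zz j (\<not> b) (2 * k + 1) @ [arw j b, arw i b] @ []) 1"
    using awlast_zz[of j "\<not> b" "2 * N"] st
    by (simp add: zpath_def path_mult_single last)
  also have "\<dots> \<in> I"
  proof (rule monotone_pair_I[OF mono])
    have "(start j (\<not> b), zz j (\<not> b) (2 * N) @ zz i b 1) \<in> paths (quiver m)"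
      unfolding G.paths_append_iff awlast_zz using zz_path[of j "\<not> b" "2 * N"] zz_path[of i b 1] st
      by simp
    then show "(start j (\<not> b), zz j (\<not> b) (2 * k + 1) @ [arw j b, arw i b] @ []) \<in> paths (quiver m)"
      by (simp add: last)
  qed
  finally have 1: "zpath j (\<not> b) (2 * N) \<otimes>\<^bsub>P\<^esub> zpath i b 1 \<in> I" .
  have "(zpath i b (2 * N) - zpath j (\<not> b) (2 * N)) \<otimes>\<^bsub>P\<^esub> zpath i b 1 \<in> I"
    using diff by (intro A.ideal_right) auto
  from I_add[OF this 1]
  have "((zpath i b (2 * N) - zpath j (\<not> b) (2 * N)) + zpath j (\<not> b) (2 * N)) \<otimes>\<^bsub>P\<^esub> zpath i b 1 \<in> I"
    by (simp only: path_mult_distrib)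
  then have "zpath i b (2 * N + 1) \<in> I"
    using zpath_mult[of i b "2 * N" 1] by simp
  then have "zpath i b (2 * N + 1) \<otimes>\<^bsub>P\<^esub> zpath i (\<not> b) (l - (2 * N + 1)) \<in> I"
    by (intro A.ideal_right) auto
  then have "zpath i b l \<in> I"
    using zpath_mult[of i b "2 * N + 1" "l - (2 * N + 1)"] assms by simp
  then have "Poly_Mapping.map ((*) c) (zpath i b l) \<in> I" by (rule I_scale)
  also have "Poly_Mapping.map ((*) c) (zpath i b l) = Poly_Mapping.single (start i b, zz i b l) c"
    by (rule poly_mapping_eqI) (auto simp: lookup_scale zpath_def lookup_single when_def)
  finally show ?thesis .
qed

lemma sum_singles: "(\<Sum>c\<in>Poly_Mapping.keys x. Poly_Mapping.single c (lk x c)) = x"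
  by (rule poly_mapping_eqI) (auto simp: lookup_sum lookup_single when_def sum.delta in_keys_iff)

text \<open>Subtracting multiples of the relations in length \<open>2 * N\<close> removes all
  coefficients of one direction there; \<open>topc = 0\<close> then removes those of the other. What
  is left is supported on paths with a monotone pair and on zigzags longer than
  \<open>2 * N\<close>, and each such path lies in the ideal.\<close>

lemma J_subset_I: "J \<subseteq> I"
proof
  fix x assume x: "x \<in> J"
  \<comment> \<open>The scalar makes \<open>s\<close> agree with \<open>x\<close> on the zigzags of
    length \<open>2 * N\<close> that begin with a \<open>Bar\<close>. The later summation range
    \<open>{1..int m}\<close> lets \<open>i - 1\<close> run through the representatives of the
    residues.\<close>
  define t where "t i = Poly_Mapping.map ((*) (- coef x (i - 1) False (2 * N))) (zpath i True (2 * N) - zpath (i - 1) False (2 * N))" for i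
  define s where "s = (\<Sum>i\<in>{1..int m}. t i)"
  have s: "s \<in> I" unfolding s_def t_def by (intro I_sum I_scale relation_ideal_top)
  define y where "y = x - s"
  have "y = x \<oplus>\<^bsub>P\<^esub> \<ominus>\<^bsub>P\<^esub> s"
    using s x I_subset_J G.path_minus[of x s] by (auto simp: y_def J_def P.minus_eq subset_iff)
  moreover have "\<ominus>\<^bsub>P\<^esub> s \<in> J"
    using additive_subgroup.a_inv_closed[OF ideal.axioms(1)[OF ideal_J]] s I_subset_J by blast
  ultimately have y: "y \<in> J"
    using additive_subgroup.a_closed[OF ideal.axioms(1)[OF ideal_J]] x by blast
  have F: "coef y i False (2 * N) = 0" for i
  proof -
    have "coef s i False (2 * N) = (\<Sum>j\<in>{1..int m}. if j = i mod int m + 1 then coef x i False (2 * N) else 0)"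
      unfolding s_def coef_sum
    proof (intro sum.cong refl)
      fix j assume "j \<in> {1..int m}"
      then have "(j - 1) mod int m = i mod int m \<longleftrightarrow> j = i mod int m + 1" by auto
      then show "coef (t j) i False (2 * N) = (if j = i mod int m + 1 then coef x i False (2 * N) else 0)"
        using N_ge by (auto simp: t_def coef_scale coef_diff coef_zpath)
    qed
    also have "\<dots> = coef x i False (2 * N)" 
      using pos_mod_bound[OF m_pos, of i] pos_mod_sign[OF m_pos, of i] by (subst sum.delta) auto
    finally show ?thesis by (simp add: y_def coef_diff)
  qed
  have T: "coef y i True (2 * N) = 0" for i
  proof -
    have "topc y i = 0" using y by (simp add: J_def)
    then show ?thesis by (simp add: topc_def F)
  qed
  have "Poly_Mapping.single c (lk y c) \<in> I" if c: "c \<in> Poly_Mapping.keys y" for c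
  proof -
    obtain u q where uq: "c = (u, q)" by (cases c)
    have path: "(u, q) \<in> paths (quiver m)" using y c uq by (auto simp: J_def path_algebra_simps)
    from path_cases[OF path] show ?thesis
    proof (elim disjE exE conjE)
      assume 1: "q = []"
      have "u = start u True" using path 1 by (auto simp: start_def G.paths_iff quiver_simps)
      then have "lk y c = coef y u True 0" using 1 by (simp add: uq coef_def)
      then show ?thesis using y N_ge c by (simp add: J_def in_keys_iff)
    next
      fix i b l assume 2: "u = start i b" "q = zz i b l"
      then have nz: "coef y i b l \<noteq> 0" using c by (simp add: uq coef_def in_keys_iff)
      have "coef y i b (2 * N) = 0" using T F by (cases b) simp_all
      then have "l \<noteq> 2 * N" using nz by metis
      moreover have "coef y i b k = 0" if "k < 2 * N" for k using y that by (simp add: J_def)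
      then have "\<not> l < 2 * N" using nz by auto
      ultimately have "l > 2 * N" by simp
      from long_zz_I[OF this, of i b "lk y c"] show ?thesis by (simp add: uq 2)
    next
      fix p e e' r assume "q = p @ [e, e'] @ r" "monotone_pair e e'"
      then show ?thesis using monotone_pair_I[of e e' u p r] path by (simp add: uq)
    qed
  qed
  then have "y \<in> I" using I_sum[of "Poly_Mapping.keys y"] by (metis sum_singles)
  then show "x \<in> I" using I_add[OF _ s, of y] by (simp add: y_def)
qed

lemma I_eq_J: "I = J"
  using I_subset_J J_subset_I by blast

end

section \<open>The center\<close>

context zigzag
begin

abbreviation scale :: "'k \<Rightarrow> 'k kQ \<Rightarrow> 'k kQ" where
  "scale c \<equiv> Poly_Mapping.map ((*) c)"

abbreviation cls :: "'k kQ \<Rightarrow> 'k kQ set" where "cls \<equiv> A.cls"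

abbreviation Q :: "('k, 'k kQ set) module" where "Q \<equiv> A.Q"

lemma Q_assoc_algebra: "assoc_algebra Q"
  by (rule A.quotient_assoc_algebra) (rule P.ring_axioms)

sublocale Q: assoc_algebra Q
  by (rule Q_assoc_algebra)

lemma carrier_add [simp, intro]: "x \<in> carrier P \<Longrightarrow> y \<in> carrier P \<Longrightarrow> x + y \<in> carrier P"
  using P.a_closed by (simp add: path_algebra_simps(2))

lemma carrier_scale [simp, intro]: "x \<in> carrier P \<Longrightarrow> scale c x \<in> carrier P"
  using P.smult_mem by (simp add: path_algebra_simps(4))

lemma carrier_zero [simp, intro]: "0 \<in> carrier P"
  using P.zero_closed by (simp add: path_algebra_simps(3))

lemma carrier_sum [intro]: "(\<And>i. i \<in> S \<Longrightarrow> f i \<in> carrier P) \<Longrightarrow> (\<Sum>i\<in>S. f i) \<in> carrier P"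
  by (induction S rule: infinite_finite_induct) auto

lemma cls_add: "x \<in> carrier P \<Longrightarrow> y \<in> carrier P \<Longrightarrow> cls x \<oplus>\<^bsub>Q\<^esub> cls y = cls (x + y)"
  using A.cls_add by (simp add: path_algebra_simps(2))

lemma cls_scale: "x \<in> carrier P \<Longrightarrow> c \<odot>\<^bsub>Q\<^esub> cls x = cls (scale c x)"
  using A.cls_smult by (simp add: path_algebra_simps(4))

lemma cls_zero: "cls 0 = \<zero>\<^bsub>Q\<^esub>"
  using A.cls_zero by (simp add: path_algebra_simps(3))

text \<open>This is \<open>I = J\<close> read as an equality test; the zigzag coefficients below
  length \<open>2 * N\<close> and the sums \<open>topc\<close> separate the elements of the
  quotient.\<close>

lemma cls_eq:
  assumes "x \<in> carrier P" "y \<in> carrier P"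
  shows "cls x = cls y \<longleftrightarrow>
    (\<forall>i b l. l < 2 * N \<longrightarrow> coef x i b l = coef y i b l) \<and> (\<forall>i. topc x i = topc y i)"
proof -
  have "x - y \<in> carrier P" using P.minus_closed[OF assms] by (simp add: G.path_minus assms)
  moreover have "topc (x - y) i = topc x i - topc y i" for i
    by (simp add: topc_def coef_diff)
  ultimately have "x - y \<in> J \<longleftrightarrow>
      (\<forall>i b l. l < 2 * N \<longrightarrow> coef x i b l = coef y i b l) \<and> (\<forall>i. topc x i = topc y i)"
    by (simp add: J_def coef_diff)
  moreover have "cls x = cls y \<longleftrightarrow> x - y \<in> J"
    unfolding A.cls_eq_iff[OF assms] G.path_minus[OF assms] by (simp only: I_eq_J)
  ultimately show ?thesis by simp
qed

lemma cls_eqI: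
  assumes "x \<in> carrier P" "y \<in> carrier P"
    and "\<And>i b l. l \<le> 2 * N \<Longrightarrow> coef x i b l = coef y i b l"
  shows "cls x = cls y"
  unfolding cls_eq[OF assms(1,2)] topc_def using assms(3) by simp

section \<open>Commutation with zigzags\<close>

lemma coef_mult_zpath:
  assumes "r > 0"
  shows "coef (x \<otimes>\<^bsub>P\<^esub> zpath j c r) i b l =
      (if r \<le> l \<and> j mod int m = i mod int m \<and> (b = even (l - r)) = c then coef x i b (l - r) else 0)"
proof -
  have "coef (x \<otimes>\<^bsub>P\<^esub> zpath j c r) i b l =
    (\<Sum>k\<le>l. if k = l - r then (if r \<le> l \<and> j mod int m = i mod int m \<and> (b = even (l - r)) = c
        then coef x i b (l - r) else 0) else 0)"
    unfolding coef_mult coef_zpath[OF assms]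
  proof (intro sum.cong refl)
    fix k assume "k \<in> {..l}"
    then have "l - k = r \<longleftrightarrow> r \<le> l \<and> k = l - r" using assms by auto
    moreover have "c = (b = even k) \<longleftrightarrow> (b = even k) = c" by blast
    ultimately show "coef x i b k * (if l - k = r \<and> c = (b = even k) \<and> j mod int m = i mod int m then 1 else 0) =
      (if k = l - r then (if r \<le> l \<and> j mod int m = i mod int m \<and> (b = even (l - r)) = c
        then coef x i b (l - r) else 0) else 0)"
      by (cases "r \<le> l \<and> k = l - r") (simp_all only: if_True if_False simp_thms mult_1_right mult_zero_right split: if_split, blast+)
  qed
  then show ?thesis by (simp add: sum.delta)
qed

lemma coef_zpath_mult:
  assumes "r > 0"
  shows "coef (zpath j c r \<otimes>\<^bsub>P\<^esub> x) i b l =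
      (if r \<le> l \<and> j mod int m = i mod int m \<and> b = c then coef x i (b = even r) (l - r) else 0)"
proof -
  have "coef (zpath j c r \<otimes>\<^bsub>P\<^esub> x) i b l =
    (\<Sum>k\<le>l. if k = r then (if j mod int m = i mod int m \<and> b = c
        then coef x i (b = even r) (l - r) else 0) else 0)"
    unfolding coef_mult coef_zpath[OF assms]
    by (intro sum.cong refl) (simp only: if_True if_False simp_thms mult_1_left mult_zero_left split: if_split, blast)
  then show ?thesis by (simp add: sum.delta)
qed

lemma pred_not_cong: "(i - 1) mod int m \<noteq> i mod int m"
proof
  assume "(i - 1) mod int m = i mod int m"
  then have "int m dvd 1" by (simp add: mod_eq_dvd_iff)
  then show False using m_ge by simp
qed

lemma start_neq: "start i True \<noteq> start i False"
  using pred_not_cong[of "i + 1"] by (simp add: start_def)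

text \<open>For \<open>s = 0\<close> the second condition compares the trivial paths at
  \<open>i\<close> and \<open>i + 1\<close>, so going around the cycle makes all of them share one
  coefficient. Length \<open>2 * N\<close> is unconstrained.\<close>

definition central_coef :: "'k kQ \<Rightarrow> bool" where
  "central_coef x \<longleftrightarrow>
     (\<forall>i b l. odd l \<longrightarrow> l < 2 * N \<longrightarrow> coef x i b l = 0) \<and>
     (\<forall>i s. s < N \<longrightarrow> coef x i True (2 * s) = coef x i False (2 * s))"

lemma central_coefD:
  assumes "central_coef x" "l < 2 * N"
  shows "odd l \<Longrightarrow> coef x i b l = 0" "even l \<Longrightarrow> coef x i b l = coef x i c l"
proof -
  show "odd l \<Longrightarrow> coef x i b l = 0" using assms by (auto simp: central_coef_def)
  assume "even l"
  then obtain s where s: "l = 2 * s" by (rule evenE)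
  then have "coef x i True l = coef x i False l" using assms by (auto simp: central_coef_def)
  then show "coef x i b l = coef x i c l" by (cases b; cases c; simp)
qed

text \<open>Match the cut at \<open>k\<close> on one side with the mirrored cut at
  \<open>l - k\<close> on the other. Terms with odd \<open>k\<close> vanish, for even
  \<open>k < 2 * N\<close> the direction of the zigzag is irrelevant, and \<open>k = 2 * N\<close>
  leaves only a trivial path for \<open>y\<close>.\<close>

lemma coef_mult_commute:
  assumes x: "central_coef x" and l: "l \<le> 2 * N"
  shows "coef (x \<otimes>\<^bsub>P\<^esub> y) i b l = coef (y \<otimes>\<^bsub>P\<^esub> x) i b l"
proof -
  have "coef (y \<otimes>\<^bsub>P\<^esub> x) i b l = (\<Sum>k\<le>l. coef y i b (l - k) * coef x i (b = even (l - k)) k)"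
    unfolding coef_mult by (rule sum.reindex_bij_witness[of _ "\<lambda>k. l - k" "\<lambda>k. l - k"]) auto
  also have "\<dots> = (\<Sum>k\<le>l. coef x i b k * coef y i (b = even k) (l - k))"
  proof (intro sum.cong refl)
    fix k assume k: "k \<in> {..l}"
    show "coef y i b (l - k) * coef x i (b = even (l - k)) k = coef x i b k * coef y i (b = even k) (l - k)"
    proof (cases "k = 2 * N")
      case True
      then have "l = k" using k l by simp
      moreover have "even k" unfolding True by simp
      ultimately show ?thesis by simp
    next
      case False
      then have k': "k < 2 * N" using k l by simp
      show ?thesis
      proof (cases "even k")
        case True
        then show ?thesis
          using central_coefD(2)[OF x k', of i b "b = even (l - k)"] by simp
      next
        case False
        then show ?thesis using central_coefD(1)[OF x k'] by simp
      qed
    qed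
  qed
  finally show ?thesis by (simp add: coef_mult)
qed

text \<open>For the converse it is enough to commute with single arrows. At odd length one of the
  two products has coefficient 0 on the chosen zigzag; at even length the two products exhibit the
  coefficients of the two directions.\<close>

lemma cls_central_iff:
  assumes x: "x \<in> carrier P"
  shows "cls x \<in> carrier (HH0 Q) \<longleftrightarrow> central_coef x"
proof
  assume c: "central_coef x"
  have "cls x \<otimes>\<^bsub>Q\<^esub> Y = Y \<otimes>\<^bsub>Q\<^esub> cls x" if Y: "Y \<in> carrier Q" for Y
  proof -
    obtain y where y: "y \<in> carrier P" "Y = cls y" using Y by (rule A.Q_cases)
    have "cls (x \<otimes>\<^bsub>P\<^esub> y) = cls (y \<otimes>\<^bsub>P\<^esub> x)"
      using x y by (intro cls_eqI coef_mult_commute[OF c]) simp_all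
    then show ?thesis using x y by (simp add: A.cls_mult)
  qed
  then show "cls x \<in> carrier (HH0 Q)" using x by (simp add: Q.HH0_carrier A.cls_carrier)
next
  assume c: "cls x \<in> carrier (HH0 Q)"
  have comm: "cls (x \<otimes>\<^bsub>P\<^esub> zpath i b 1) = cls (zpath i b 1 \<otimes>\<^bsub>P\<^esub> x)" for i b
  proof -
    have "cls x \<otimes>\<^bsub>Q\<^esub> cls (zpath i b 1) = cls (zpath i b 1) \<otimes>\<^bsub>Q\<^esub> cls x"
      using c A.cls_carrier[OF zpath_carrier] unfolding Q.HH0_carrier by blast
    then show ?thesis using x by (simp only: A.cls_mult zpath_carrier)
  qed
  have low: "coef (x \<otimes>\<^bsub>P\<^esub> zpath i b 1) i b (Suc l) = coef (zpath i b 1 \<otimes>\<^bsub>P\<^esub> x) i b (Suc l)"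
    if "Suc l < 2 * N" for i b l
    using comm[of i b] x that by (simp add: cls_eq)
  have top: "topc (x \<otimes>\<^bsub>P\<^esub> zpath i b 1) i = topc (zpath i b 1 \<otimes>\<^bsub>P\<^esub> x) i" for i b
    using comm[of i b] x by (simp add: cls_eq)
  obtain k where k: "2 * N = Suc k" "odd k" using N_ge by (cases "2 * N") (auto, metis even_Suc dvd_triv_left)
  show "central_coef x" unfolding central_coef_def
  proof (intro conjI allI impI)
    fix i s assume "s < N"
    then show "coef x i True (2 * s) = coef x i False (2 * s)"
      using low[of "2 * s" i True] by (simp add: coef_mult_zpath coef_zpath_mult)
  next
    fix i b l assume l: "odd l" "l < 2 * N"
    show "coef x i b l = 0"
    proof (cases "Suc l < 2 * N")
      case True
      then show ?thesis using low[OF True, of i "\<not> b"] l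
        by (simp add: coef_mult_zpath coef_zpath_mult)
    next
      \<comment> \<open>Length \<open>2 * N - 1\<close>: the products have length
        \<open>2 * N\<close> and are visible only through \<open>topc\<close>. The second summand of
        \<open>topc\<close> contributes 0 because \<open>i - 1\<close> and \<open>i\<close> are not
        congruent.\<close>
      case False
      then have "l = k" using k l by simp
      moreover have "coef x i True k = 0" using top[of i False] k(2)
        unfolding topc_def k by (simp add: coef_mult_zpath coef_zpath_mult pred_not_cong pred_not_cong[symmetric])
      moreover have "coef x i False k = 0" using top[of i True] k(2)
        unfolding topc_def k by (simp add: coef_mult_zpath coef_zpath_mult pred_not_cong pred_not_cong[symmetric])
      ultimately show ?thesis by (cases b) simp_all
    qed
  qed
qed

subsection \<open>The summands\<close>

text \<open>Represents \<open>f\<^sub>i\<^sup>s\<close> for \<open>s > 0\<close>; for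
  \<open>s = 0\<close> it is the sum of two trivial paths and not the unit. Using it up to
  \<open>s = N\<close> also covers the last generator of a summand.\<close>

definition hh :: "int \<Rightarrow> nat \<Rightarrow> 'k kQ" where
  "hh i s = zpath i True (2 * s) + zpath i False (2 * s)"

definition hsum :: "int \<Rightarrow> (nat \<Rightarrow> 'k) \<Rightarrow> 'k kQ" where
  "hsum i c = (\<Sum>s\<in>{1..N}. scale (c s) (hh i s))"

lemma hh_carrier [simp, intro]: "hh i s \<in> carrier P"
  by (simp add: hh_def)

lemma hsum_carrier [simp, intro]: "hsum i c \<in> carrier P"
  unfolding hsum_def by (intro carrier_sum) simp

lemma coef_hh:
  "s > 0 \<Longrightarrow> coef (hh i s) j b l = (if l = 2 * s \<and> i mod int m = j mod int m then 1 else 0)"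
  by (auto simp: hh_def coef_add coef_zpath)

lemma coef_hsum:
  "coef (hsum i c) j b l =
    (if even l \<and> l \<noteq> 0 \<and> l \<le> 2 * N \<and> i mod int m = j mod int m then c (l div 2) else 0)"
proof -
  have "coef (hsum i c) j b l = (\<Sum>s\<in>{1..N}. if s = l div 2 then
      (if even l \<and> i mod int m = j mod int m then c (l div 2) else 0) else 0)"
    unfolding hsum_def coef_sum
    by (intro sum.cong refl) (auto simp: coef_scale coef_hh)
  also have "\<dots> = (if l div 2 \<in> {1..N} then (if even l \<and> i mod int m = j mod int m then c (l div 2) else 0) else 0)"
    by (subst sum.delta) simp_all
  finally show ?thesis by (auto elim!: evenE)
qed

lemma topc_hsum:
  "topc (hsum i c) j = (if i mod int m = j mod int m then c N else 0) +
     (if i mod int m = (j - 1) mod int m then c N else 0)"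
  using N_ge by (simp add: topc_def coef_hsum)

lemma hsum_central: "central_coef (hsum i c)"
  by (auto simp: central_coef_def coef_hsum)

lemma hh_central: "s > 0 \<Longrightarrow> central_coef (hh i s)"
  by (auto simp: central_coef_def coef_hh)

lemma hh_mult: "hh i s \<otimes>\<^bsub>P\<^esub> hh i t = hh i (s + t)"
proof -
  have "zpath i b (2 * s) \<otimes>\<^bsub>P\<^esub> zpath i b (2 * t) = zpath i b (2 * (s + t))" for b
    using zpath_mult[of i b "2 * s" "2 * t"] by (simp add: distrib_left)
  \<comment> \<open>Mixed products vanish since one closed zigzag lives at vertex \<open>i\<close>
    and the other at \<open>i + 1\<close>.\<close>
  moreover have "zpath i b (2 * s) \<otimes>\<^bsub>P\<^esub> zpath i (\<not> b) (2 * t) = 0" for b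
    using start_neq[of i] awlast_zz[of i b "2 * s"]
    by (cases b) (simp_all add: zpath_def path_mult_single)
  from this[of True] this[of False] calculation[of True] calculation[of False]
  show ?thesis by (simp add: hh_def path_mult_distrib)
qed

lemma hh_large: "s > N \<Longrightarrow> cls (hh i s) = \<zero>\<^bsub>Q\<^esub>"
  unfolding cls_zero[symmetric] by (rule cls_eqI) (auto simp: coef_hh coef_zero)

lemma ff_eq: "ff m N i = cls (hh i 1)"
proof -
  have "arr m i \<in> carrier P" "bar m i \<in> carrier P" by (simp_all add: arr_zpath bar_zpath)
  then show ?thesis
    unfolding ff_def algA_def arrA_def barA_def
    by (simp add: A.cls_mult arr_bar bar_arr cls_add hh_def)
qed

lemma ff_pow: "s > 0 \<Longrightarrow> ff m N i [^]\<^bsub>Q\<^esub> (s::nat) = cls (hh i s)"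
proof (induction s rule: nat_induct_non_zero)
  case 1
  show ?case by (simp add: ff_eq A.cls_carrier)
next
  case (Suc s)
  then show ?case by (simp add: ff_eq A.cls_mult hh_mult)
qed

lemma cls_pow: "x \<in> carrier P \<Longrightarrow> cls x [^]\<^bsub>Q\<^esub> (n::nat) = cls (x [^]\<^bsub>P\<^esub> n)"
  by (induction n) (simp_all add: A.cls_one A.cls_mult)

lemma eps_eq: "eps m N i = cls (zpath i True (2 * N))"
proof -
  have "arr m i \<in> carrier P" "bar m i \<in> carrier P" by (simp_all add: arr_zpath bar_zpath)
  then show ?thesis
    unfolding eps_def algA_def arrA_def barA_def
    using N_ge by (simp add: A.cls_mult arr_bar cls_pow zpath_pow)
qed

text \<open>By the relation at vertex \<open>i + 1\<close>, the second term is also the class of the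
  zigzag that starts there with the arrow \<open>Bar\<close> of index \<open>i\<close>; together
  with the first term it forms \<open>f\<^sub>i\<^sup>N\<close>.\<close>

lemma eps_add: "eps m N i \<oplus>\<^bsub>Q\<^esub> eps m N (i + 1) = cls (hh i N)"
proof -
  have "cls (zpath (i + 1) True (2 * N)) = cls (zpath i False (2 * N))"
    using relation_ideal_top[of "i + 1"] by (simp add: A.cls_eq_iff G.path_minus)
  then show ?thesis by (simp add: eps_eq cls_add hh_def)
qed

end

lemma submodule_scalars_iff:
  assumes "module (scalars :: 'k::field ring) V"
  shows "submodule U (scalars :: 'k ring) V \<longleftrightarrow>
    U \<subseteq> carrier V \<and> \<zero>\<^bsub>V\<^esub> \<in> U \<and> (\<forall>x\<in>U. \<forall>y\<in>U. x \<oplus>\<^bsub>V\<^esub> y \<in> U) \<and> (\<forall>c. \<forall>x\<in>U. c \<odot>\<^bsub>V\<^esub> x \<in> U)"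
proof -
  interpret V: module "scalars :: 'k ring" V by fact
  show ?thesis
  proof
    assume U: "submodule U (scalars :: 'k ring) V"
    interpret U: submodule U "scalars :: 'k ring" V by fact
    show "U \<subseteq> carrier V \<and> \<zero>\<^bsub>V\<^esub> \<in> U \<and> (\<forall>x\<in>U. \<forall>y\<in>U. x \<oplus>\<^bsub>V\<^esub> y \<in> U) \<and> (\<forall>c. \<forall>x\<in>U. c \<odot>\<^bsub>V\<^esub> x \<in> U)"
      using V.submoduleE[OF U] U.one_closed by auto
  next
    assume U: "U \<subseteq> carrier V \<and> \<zero>\<^bsub>V\<^esub> \<in> U \<and> (\<forall>x\<in>U. \<forall>y\<in>U. x \<oplus>\<^bsub>V\<^esub> y \<in> U) \<and> (\<forall>c. \<forall>x\<in>U. c \<odot>\<^bsub>V\<^esub> x \<in> U)"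
    show "submodule U (scalars :: 'k ring) V"
    proof (rule V.submoduleI)
      fix x assume x: "x \<in> U"
      then have "\<ominus>\<^bsub>V\<^esub> x = (- 1) \<odot>\<^bsub>V\<^esub> x"
        using U V.smult_l_minus[of 1 x] V.smult_one[of x] by auto
      then show "\<ominus>\<^bsub>V\<^esub> x \<in> U" using U x by metis
    qed (use U in auto)
  qed
qed

context zigzag
begin

section \<open>Spans inside the quotient\<close>

lemma submodule_Q_iff:
  "submodule U (scalars :: 'k ring) Q \<longleftrightarrow>
    U \<subseteq> carrier Q \<and> \<zero>\<^bsub>Q\<^esub> \<in> U \<and> (\<forall>x\<in>U. \<forall>y\<in>U. x \<oplus>\<^bsub>Q\<^esub> y \<in> U) \<and> (\<forall>c. \<forall>x\<in>U. c \<odot>\<^bsub>Q\<^esub> x \<in> U)"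
  by (rule submodule_scalars_iff) (rule Q.module_axioms)

lemma submodule_cls_sum:
  assumes "submodule U (scalars :: 'k ring) Q"
    and "\<And>s. s \<in> S \<Longrightarrow> x s \<in> carrier P" "\<And>s. s \<in> S \<Longrightarrow> cls (x s) \<in> U"
  shows "cls (\<Sum>s\<in>S. x s) \<in> U"
  using assms(2,3)
proof (induction S rule: infinite_finite_induct)
  case (insert s S)
  then have "cls (x s) \<oplus>\<^bsub>Q\<^esub> cls (\<Sum>s\<in>S. x s) \<in> U"
    using assms(1) by (simp add: submodule_Q_iff)
  moreover have "(\<Sum>s\<in>S. x s) \<in> carrier P" using insert by auto
  ultimately show ?case using insert by (simp add: cls_add)
qed (use assms(1) in \<open>simp_all add: cls_zero submodule_Q_iff\<close>)

lemma submodule_cls_scale: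
  "submodule U (scalars :: 'k ring) Q \<Longrightarrow> x \<in> carrier P \<Longrightarrow> cls x \<in> U \<Longrightarrow> cls (scale c x) \<in> U"
  unfolding submodule_Q_iff by (metis cls_scale)

lemma submodule_cls_hsum:
  assumes "submodule U (scalars :: 'k ring) Q" "\<And>s. s \<in> {1..N} \<Longrightarrow> cls (hh i s) \<in> U"
  shows "cls (hsum i c) \<in> U"
  unfolding hsum_def using assms by (intro submodule_cls_sum submodule_cls_scale) auto

definition hspan :: "int \<Rightarrow> 'k kQ set set" where
  "hspan i = range (\<lambda>c. cls (hsum i c))"

lemma hspan_submodule: "submodule (hspan i) (scalars :: 'k ring) Q"
proof -
  have "\<zero>\<^bsub>Q\<^esub> = cls (hsum i (\<lambda>_. 0))"
    unfolding cls_zero[symmetric] by (rule cls_eqI) (simp_all add: coef_hsum coef_zero)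
  moreover have "cls (hsum i c) \<oplus>\<^bsub>Q\<^esub> cls (hsum i d) = cls (hsum i (\<lambda>s. c s + d s))" for c d
    by (simp add: cls_add, rule cls_eqI) (simp_all add: coef_hsum coef_add)
  moreover have "a \<odot>\<^bsub>Q\<^esub> cls (hsum i c) = cls (hsum i (\<lambda>s. a * c s))" for a c
    by (simp add: cls_scale, rule cls_eqI) (simp_all add: coef_hsum coef_scale)
  ultimately show ?thesis
    unfolding submodule_Q_iff hspan_def by (auto simp: A.cls_carrier)
qed

lemma hh_hspan:
  assumes "s > 0"
  shows "cls (hh i s) \<in> hspan i"
proof (cases "s \<le> N")
  case True
  have "cls (hh i s) = cls (hsum i (\<lambda>t. if t = s then 1 else 0))"
    by (rule cls_eqI) (use assms True in \<open>auto simp: coef_hh coef_hsum\<close>)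
  then show ?thesis by (simp add: hspan_def)
next
  case False
  then show ?thesis using hspan_submodule[of i] by (simp add: hh_large submodule_Q_iff)
qed

lemma linear_span_eqI:
  assumes "submodule U (scalars :: 'k ring) Q" "S \<subseteq> U"
    and "\<And>T. submodule T (scalars :: 'k ring) Q \<Longrightarrow> S \<subseteq> T \<Longrightarrow> U \<subseteq> T"
  shows "linear_span Q S = U"
  using assms unfolding linear_span_def by blast

lemma summand_Some: "summand m N (Some i) = hspan i"
proof -
  have pow: "{ff m N i [^]\<^bsub>Q\<^esub> s | s::nat. 1 \<le> s \<and> s \<le> N - 1} = {cls (hh i s) | s. 1 \<le> s \<and> s \<le> N - 1}"
  proof (intro Collect_cong ex_cong1)
    fix U and s :: nat
    show "(U = ff m N i [^]\<^bsub>Q\<^esub> s \<and> 1 \<le> s \<and> s \<le> N - 1) \<longleftrightarrow> (U = cls (hh i s) \<and> 1 \<le> s \<and> s \<le> N - 1)"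
      using ff_pow[of s i] by (cases "s > 0") auto
  qed
  have "summand m N (Some i) = linear_span Q ({cls (hh i s) | s. 1 \<le> s \<and> s \<le> N - 1} \<union> {cls (hh i N)})"
    unfolding summand_def algA_def option.case eps_add pow ..
  also have "\<dots> = hspan i"
  proof (rule linear_span_eqI[OF hspan_submodule])
    show "{cls (hh i s) | s. 1 \<le> s \<and> s \<le> N - 1} \<union> {cls (hh i N)} \<subseteq> hspan i"
      using N_ge by (auto simp: hh_hspan)
    fix T assume T: "submodule T (scalars :: 'k ring) Q"
      "{cls (hh i s) | s. 1 \<le> s \<and> s \<le> N - 1} \<union> {cls (hh i N)} \<subseteq> T"
    have "cls (hh i s) \<in> T" if "s \<in> {1..N}" for s
    proof (cases "s = N")
      case False
      then have "1 \<le> s \<and> s \<le> N - 1" using that by auto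
      then show ?thesis using T(2) by blast
    qed (use T(2) in auto)
    then show "hspan i \<subseteq> T" using submodule_cls_hsum[OF T(1)] by (auto simp: hspan_def)
  qed
  finally show ?thesis .
qed

abbreviation unit :: "'k kQ" where "unit \<equiv> \<one>\<^bsub>P\<^esub>"

lemma summand_None: "summand m N None = range (\<lambda>c. cls (scale c unit))"
proof -
  have "summand m N None = linear_span Q {cls unit}"
    unfolding summand_def algA_def option.case A.cls_one ..
  also have "\<dots> = range (\<lambda>c. cls (scale c unit))"
  proof (rule linear_span_eqI)
    have "\<zero>\<^bsub>Q\<^esub> = cls (scale 0 unit)"
      unfolding cls_zero[symmetric] by (rule cls_eqI) (simp_all add: coef_scale coef_zero)
    moreover have "cls (scale c unit) \<oplus>\<^bsub>Q\<^esub> cls (scale d unit) = cls (scale (c + d) unit)" for c d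
      by (simp add: cls_add, rule cls_eqI) (simp_all add: coef_scale coef_add distrib_right)
    moreover have "a \<odot>\<^bsub>Q\<^esub> cls (scale c unit) = cls (scale (a * c) unit)" for a c
      by (simp add: cls_scale, rule cls_eqI) (simp_all add: coef_scale)
    ultimately show "submodule (range (\<lambda>c. cls (scale c unit))) (scalars :: 'k ring) Q"
      unfolding submodule_Q_iff by (auto simp: A.cls_carrier)
    have "cls unit = cls (scale 1 unit)"
      by (rule cls_eqI) (simp_all add: coef_scale)
    then show "{cls unit} \<subseteq> range (\<lambda>c. cls (scale c unit))" by auto
    fix T assume "submodule T (scalars :: 'k ring) Q" "{cls unit} \<subseteq> T"
    then show "range (\<lambda>c. cls (scale c unit)) \<subseteq> T"
      by (auto intro: submodule_cls_scale)
  qed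
  finally show ?thesis .
qed

end

section \<open>The direct sum decomposition\<close>

text \<open>
  In the application \<open>\<gamma> i\<close> is the coefficient of \<open>\<epsilon>\<^sub>i\<close> in a central element, and \<open>\<delta> i\<close> becomes
  the coefficient of \<open>\<epsilon>\<^sub>i + \<epsilon>\<^sub>i\<^sub>+\<^sub>1\<close>.
\<close>

lemma odd_cycle_solvable:
  fixes \<gamma> :: "int \<Rightarrow> 'k::field"
  assumes "odd m" "(2::'k) \<noteq> 0"
    and periodic: "\<And>i j. i mod int m = j mod int m \<Longrightarrow> \<gamma> i = \<gamma> j"
  obtains \<delta> where "\<And>i j. i mod int m = j mod int m \<Longrightarrow> \<delta> i = \<delta> j"
    and "\<And>i. \<delta> i + \<delta> (i - 1) = \<gamma> i"
proof -
  \<comment> \<open>Iterating \<open>\<delta> i = \<gamma> i - \<delta> (i - 1)\<close> once around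
    the cycle returns to \<open>- \<delta> i\<close> because \<open>m\<close> is odd; solving for
    \<open>\<delta> i\<close> gives this alternating sum divided by 2.\<close>
  define \<delta> where "\<delta> i = (\<Sum>k<m. (- 1) ^ k * \<gamma> (i - int k)) / 2" for i
  have "\<delta> i = \<delta> j" if "i mod int m = j mod int m" for i j
  proof -
    have "\<gamma> (i - int k) = \<gamma> (j - int k)" for k
      using that by (intro periodic) (rule mod_diff_cong[OF _ refl])
    then show ?thesis by (simp add: \<delta>_def)
  qed
  moreover have "\<delta> i + \<delta> (i - 1) = \<gamma> i" for i
  proof -
    define F where "F k = (- 1) ^ k * \<gamma> (i - int k)" for k
    \<comment> \<open>Shifting \<open>i\<close> by one in the alternating sum shifts
      \<open>k\<close> and flips the sign, so the two sums telescope.\<close>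
    have "F k - F (Suc k) = (- 1) ^ k * \<gamma> (i - int k) + (- 1) ^ k * \<gamma> (i - 1 - int k)" for k
      by (simp add: F_def diff_diff_eq)
    then have "\<delta> i + \<delta> (i - 1) = (\<Sum>k<m. F k - F (Suc k)) / 2"
      by (simp add: \<delta>_def sum.distrib add_divide_distrib)
    also have "\<dots> = (F 0 - F m) / 2" by (simp only: sum_lessThan_telescope')
    also have "F m = - \<gamma> i" using assms(1) periodic[of "i - int m" i] by (simp add: F_def)
    finally show ?thesis using assms(2) by (simp add: F_def)
  qed
  ultimately show ?thesis by (rule that)
qed

text \<open>Each step back changes the sign, so one turn around a cycle of odd length gives
  \<open>\<delta> i = - \<delta> i\<close>.\<close>

lemma odd_cycle_unique:
  fixes \<delta> :: "int \<Rightarrow> 'k::field"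
  assumes "odd m" "(2::'k) \<noteq> 0" "\<And>i. \<delta> (i - int m) = \<delta> i" "\<And>i. \<delta> i + \<delta> (i - 1) = 0"
  shows "\<delta> i = 0"
proof -
  have "\<delta> (i - int k) = (- 1) ^ k * \<delta> i" for k
  proof (induction k)
    case (Suc k)
    have "\<delta> (i - int (Suc k)) = - \<delta> (i - int k)"
      using assms(4)[of "i - int k"] by (simp add: eq_neg_iff_add_eq_0 algebra_simps)
    then show ?case using Suc by simp
  qed simp
  from this[of m] have "\<delta> i = - \<delta> i" using assms(1,3) by simp
  then have "2 * \<delta> i = 0" by (simp add: eq_neg_iff_add_eq_0)
  then show ?thesis using assms(2) by simp
qed

lemma int_constant:
  fixes f :: "int \<Rightarrow> 'a"
  assumes "\<And>i. f (i + 1) = f i"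
  shows "f i = f 0"
proof (induction i rule: int_induct[where k = 0])
  case (step1 i)
  then show ?case using assms[of i] by simp
next
  case (step2 i)
  then show ?case using assms[of "i - 1"] by simp
qed simp

context zigzag
begin

definition lin :: "'k \<Rightarrow> (int \<Rightarrow> nat \<Rightarrow> 'k) \<Rightarrow> 'k kQ" where
  "lin a c = scale a unit + (\<Sum>i\<in>{0..<int m}. hsum i (c i))"

lemma lin_carrier [simp, intro]: "lin a c \<in> carrier P"
proof -
  have "(\<Sum>i\<in>{0..<int m}. hsum i (c i)) \<in> carrier P" by (rule carrier_sum) simp
  then show ?thesis by (simp add: lin_def)
qed

lemma coef_lin:
  "coef (lin a c) j b l =
    (if l = 0 then a else if even l \<and> l \<le> 2 * N then c (j mod int m) (l div 2) else 0)"
proof -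
  let ?C = "even l \<and> l \<noteq> 0 \<and> l \<le> 2 * N"
  have "coef (\<Sum>i\<in>{0..<int m}. hsum i (c i)) j b l =
      (\<Sum>i\<in>{0..<int m}. if i = j mod int m then (if ?C then c i (l div 2) else 0) else 0)"
    unfolding coef_sum coef_hsum by (intro sum.cong refl) auto
  also have "\<dots> = (if ?C then c (j mod int m) (l div 2) else 0)"
    using m_pos by (subst sum.delta) auto
  finally show ?thesis by (simp add: lin_def coef_add coef_scale coef_one)
qed

text \<open>The socle element at vertex \<open>j\<close> occurs in exactly two of the generators of
  length \<open>2 * N\<close>, those with index \<open>j\<close> and \<open>j - 1\<close>.\<close>

lemma topc_lin: "topc (lin a c) j = c (j mod int m) N + c ((j - 1) mod int m) N"
  using N_ge by (simp add: topc_def coef_lin)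

lemma topc_cong: "i mod int m = j mod int m \<Longrightarrow> topc x i = topc x j"
  unfolding topc_def by (intro arg_cong2[of _ _ _ _ "(+)"] coef_cong mod_diff_cong refl)

lemma central_lin:
  assumes "odd m" "(2::'k) \<noteq> 0" "central_coef x" "x \<in> carrier P"
  obtains a c where "cls x = cls (lin a c)"
proof -
  obtain \<delta> where per: "\<And>i j. i mod int m = j mod int m \<Longrightarrow> \<delta> i = \<delta> j"
    and \<delta>: "\<And>i. \<delta> i + \<delta> (i - 1) = topc x i"
    using odd_cycle_solvable[OF assms(1,2), of "topc x"] topc_cong by metis
  \<comment> \<open>Below length \<open>2 * N\<close> the coefficients of \<open>x\<close> can be
    copied; at \<open>N\<close> they come from solving the cycle equations for
    \<open>topc x\<close>.\<close>
  define c where "c i s = (if s = N then \<delta> i else coef x i True (2 * s))" for i s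
  have const: "coef x i True 0 = coef x 0 True 0" for i
  proof (rule int_constant)
    show "coef x (i + 1) True 0 = coef x i True 0" for i
      using central_coefD(2)[OF assms(3), of 0 i True False] N_ge by (simp add: coef_zero_length)
  qed
  have "cls x = cls (lin (coef x 0 True 0) c)"
    unfolding cls_eq[OF assms(4) lin_carrier]
  proof (intro conjI allI impI)
    fix i b l assume l: "l < 2 * N"
    show "coef x i b l = coef (lin (coef x 0 True 0) c) i b l"
    proof (cases "even l")
      case True
      then have *: "coef x i b l = coef x i True l" by (rule central_coefD(2)[OF assms(3) l])
      show ?thesis unfolding * coef_lin
        using True l const[of i] by (auto simp: c_def elim!: evenE)
    next
      case False
      then show ?thesis using central_coefD(1)[OF assms(3) l] by (auto simp: coef_lin)
    qed
  next
    fix i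
    show "topc x i = topc (lin (coef x 0 True 0) c) i"
      using per[of "i mod int m" i] per[of "(i - 1) mod int m" "i - 1"] \<delta>[of i]
      by (simp add: topc_lin c_def)
  qed
  then show ?thesis by (rule that)
qed

lemma lin_unique:
  assumes "odd m" "(2::'k) \<noteq> 0" "cls (lin a c) = cls (lin a' c')"
  shows "a = a'" "i \<in> {0..<int m} \<Longrightarrow> s \<in> {1..N} \<Longrightarrow> c i s = c' i s"
proof -
  have low: "coef (lin a c) i b l = coef (lin a' c') i b l" if "l < 2 * N" for i b l
    using assms(3) that by (simp add: cls_eq)
  have top: "topc (lin a c) i = topc (lin a' c') i" for i
    using assms(3) by (simp add: cls_eq)
  show "a = a'" using low[of 0 0 True] N_ge by (simp add: coef_lin)
  assume i: "i \<in> {0..<int m}" and s: "s \<in> {1..N}"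
  show "c i s = c' i s"
  proof (cases "s = N")
    case True
    \<comment> \<open>The difference of two solutions in top length satisfies the homogeneous cycle
      equation.\<close>
    define D where "D i = c (i mod int m) N - c' (i mod int m) N" for i
    have "D i = 0"
    proof (rule odd_cycle_unique[OF assms(1,2)])
      show "D (i - int m) = D i" for i by (simp add: D_def)
      show "D i + D (i - 1) = 0" for i using top[of i] by (simp add: D_def topc_lin algebra_simps)
    qed
    then show ?thesis using i True by (simp add: D_def)
  next
    case False
    then show ?thesis using low[of "2 * s" i True] i s by (simp add: coef_lin)
  qed
qed

section \<open>Components of central elements\<close>

lemma HH0_cases:
  assumes "U \<in> carrier (HH0 Q)"
  obtains x where "x \<in> carrier P" "U = cls x" "central_coef x"
proof -
  have "U \<in> carrier Q" using assms by (simp add: Q.HH0_carrier)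
  then obtain x where "x \<in> carrier P" "U = cls x" by (rule A.Q_cases)
  then show ?thesis using that assms cls_central_iff by blast
qed

lemma finsum_cls:
  assumes "finite S" "\<And>i. i \<in> S \<Longrightarrow> x i \<in> carrier P" "\<And>i. i \<in> S \<Longrightarrow> cls (x i) \<in> carrier (HH0 Q)"
  shows "(\<Oplus>\<^bsub>HH0 Q\<^esub>i\<in>S. cls (x i)) = cls (\<Sum>i\<in>S. x i)"
proof -
  interpret V: module "scalars :: 'k ring" "HH0 Q" by (rule Q.HH0_module)
  show ?thesis using assms
  proof (induction S rule: finite_induct)
    case (insert i S)
    have "(\<Oplus>\<^bsub>HH0 Q\<^esub>i\<in>insert i S. cls (x i)) = cls (x i) \<oplus>\<^bsub>HH0 Q\<^esub> (\<Oplus>\<^bsub>HH0 Q\<^esub>i\<in>S. cls (x i))"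
      using insert by (intro V.finsum_insert) auto
    moreover have "(\<Sum>i\<in>S. x i) \<in> carrier P" using insert by auto
    ultimately show ?case using insert by (simp add: Q.HH0_simps cls_add)
  qed (simp add: Q.HH0_simps cls_zero)
qed

definition rep :: "'k \<Rightarrow> (int \<Rightarrow> nat \<Rightarrow> 'k) \<Rightarrow> int option \<Rightarrow> 'k kQ" where
  "rep a c j = (case j of None \<Rightarrow> scale a unit | Some i \<Rightarrow> hsum i (c i))"

lemma scale_unit_central: "central_coef (scale a unit)"
  by (auto simp: central_coef_def coef_scale coef_one)

lemma rep_carrier [simp, intro]: "rep a c j \<in> carrier P"
  by (cases j) (simp_all add: rep_def)

lemma rep_central: "cls (rep a c j) \<in> carrier (HH0 Q)"
  unfolding cls_central_iff[OF rep_carrier]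
  by (cases j) (simp_all add: rep_def scale_unit_central hsum_central)

lemma rep_summand: "cls (rep a c j) \<in> summand m N j"
  by (cases j) (auto simp: rep_def summand_None summand_Some hspan_def)

lemma summand_index_finite: "finite (summand_index m)"
  by (simp add: summand_index_def)

lemma sum_rep: "(\<Sum>j\<in>summand_index m. rep a c j) = lin a c"
proof -
  have "(\<Sum>j\<in>Some ` {0..<int m}. rep a c j) = (\<Sum>i\<in>{0..<int m}. hsum i (c i))"
    by (subst sum.reindex) (simp_all add: rep_def)
  then show ?thesis
    by (simp add: summand_index_def lin_def rep_def image_iff)
qed

lemma summand_rep:
  assumes "w \<in> (\<Pi>\<^sub>E j\<in>summand_index m. summand m N j)"
  obtains a c where "\<And>j. j \<in> summand_index m \<Longrightarrow> w j = cls (rep a c j)"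
proof -
  have "w None \<in> summand m N None" using assms by (auto simp: summand_index_def)
  then obtain a where a: "w None = cls (scale a unit)" by (auto simp: summand_None)
  have "\<exists>c. w (Some i) = cls (hsum i c)" if "i \<in> {0..<int m}" for i
  proof -
    have "w (Some i) \<in> summand m N (Some i)" using assms that by (auto simp: summand_index_def)
    then show ?thesis by (auto simp: summand_Some hspan_def)
  qed
  then obtain c where c: "\<And>i. i \<in> {0..<int m} \<Longrightarrow> w (Some i) = cls (hsum i (c i))" by metis
  have "w j = cls (rep a c j)" if "j \<in> summand_index m" for j
    using that a c by (auto simp: summand_index_def rep_def)
  then show ?thesis by (rule that)
qed

lemma summand_subset: "summand m N j \<subseteq> carrier (HH0 Q)"
  by (cases j) (auto simp: summand_None summand_Some hspan_def cls_central_iff scale_unit_central hsum_central)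

lemma direct_sum:
  assumes "odd m" "(2::'k) \<noteq> 0"
  shows "internal_direct_sum (HH0 Q) (summand_index m) (summand m N)"
  unfolding internal_direct_sum_def
proof (intro conjI ballI summand_index_finite summand_subset)
  fix U assume "U \<in> carrier (HH0 Q)"
  then obtain x where x: "x \<in> carrier P" "U = cls x" "central_coef x" by (rule HH0_cases)
  obtain a c where ac: "cls x = cls (lin a c)" using central_lin[OF assms x(3,1)] .
  have sum: "(\<Oplus>\<^bsub>HH0 Q\<^esub>j\<in>summand_index m. w j) = cls (lin a c)"
    if "\<And>j. j \<in> summand_index m \<Longrightarrow> w j = cls (rep a c j)" for w a c
  proof -
    interpret V: module "scalars :: 'k ring" "HH0 Q" by (rule Q.HH0_module)
    have "(\<Oplus>\<^bsub>HH0 Q\<^esub>j\<in>summand_index m. w j) = (\<Oplus>\<^bsub>HH0 Q\<^esub>j\<in>summand_index m. cls (rep a c j))"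
      using that by (intro V.finsum_cong') (auto simp: rep_central)
    also have "\<dots> = cls (lin a c)"
      by (subst finsum_cls) (simp_all add: summand_index_finite rep_central sum_rep)
    finally show ?thesis .
  qed
  define w where "w = (\<lambda>j\<in>summand_index m. cls (rep a c j))"
  show "\<exists>!w. w \<in> (\<Pi>\<^sub>E j\<in>summand_index m. summand m N j) \<and> U = (\<Oplus>\<^bsub>HH0 Q\<^esub>j\<in>summand_index m. w j)"
  proof (intro ex1I[of _ w] conjI)
    show "w \<in> (\<Pi>\<^sub>E j\<in>summand_index m. summand m N j)" by (auto simp: w_def rep_summand)
    have "(\<Oplus>\<^bsub>HH0 Q\<^esub>j\<in>summand_index m. w j) = cls (lin a c)" by (rule sum) (simp add: w_def)
    then show "U = (\<Oplus>\<^bsub>HH0 Q\<^esub>j\<in>summand_index m. w j)" using x ac by simp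
  next
    fix v assume v: "v \<in> (\<Pi>\<^sub>E j\<in>summand_index m. summand m N j) \<and> U = (\<Oplus>\<^bsub>HH0 Q\<^esub>j\<in>summand_index m. v j)"
    obtain a' c' where v': "\<And>j. j \<in> summand_index m \<Longrightarrow> v j = cls (rep a' c' j)"
      by (rule summand_rep[OF conjunct1[OF v]]) (rule that)
    have "U = cls (lin a' c')" using conjunct2[OF v] sum[OF v'] by (rule trans)
    then have "cls (lin a c) = cls (lin a' c')" using x(2) ac by simp
    note u = lin_unique[OF assms this]
    have eq: "rep a c j = rep a' c' j" if j: "j \<in> summand_index m" for j
    proof (cases j)
      case None
      then show ?thesis using u(1) by (simp add: rep_def)
    next
      case (Some i)
      then have "i \<in> {0..<int m}" using j by (auto simp: summand_index_def)
      \<comment> \<open>\<open>hsum\<close> reads its coefficient function only on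
        \<open>{1..N}\<close>, exactly where uniqueness is available.\<close>
      then have "hsum i (c i) = hsum i (c' i)" unfolding hsum_def using u(2) by (intro sum.cong) auto
      then show ?thesis using Some by (simp add: rep_def)
    qed
    show "v = w"
    proof
      fix j show "v j = w j"
      proof (cases "j \<in> summand_index m")
        case True
        then show ?thesis using v' eq by (simp add: w_def)
      next
        case False
        \<comment> \<open>Outside the index set both families are \<open>undefined\<close>.\<close>
        then show ?thesis using PiE_arb[OF conjunct1[OF v] False] by (simp add: w_def)
      qed
    qed
  qed
qed

end

section \<open>Stability under derivations\<close>

context zigzag
begin

lemma coef_mult_hh:
  assumes "t > 0"
  shows "coef (x \<otimes>\<^bsub>P\<^esub> hh i t) j b l = (if 2 * t \<le> l \<and> i mod int m = j mod int m then coef x j b (l - 2 * t) else 0)"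
    and "coef (hh i t \<otimes>\<^bsub>P\<^esub> x) j b l = (if 2 * t \<le> l \<and> i mod int m = j mod int m then coef x j b (l - 2 * t) else 0)"
  using assms by (cases b; simp add: hh_def path_mult_distrib coef_add coef_mult_zpath coef_zpath_mult)+

lemma hspan_mult_hh:
  assumes "U \<in> hspan i" "t > 0"
  shows "U \<otimes>\<^bsub>Q\<^esub> cls (hh i t) \<in> hspan i"
proof -
  obtain c where c: "U = cls (hsum i c)" using assms by (auto simp: hspan_def)
  \<comment> \<open>The coefficients move up by \<open>t\<close>; those pushed beyond
    \<open>N\<close> are lost, in agreement with the vanishing of zigzags longer than
    \<open>2 * N\<close>.\<close>
  have "cls (hsum i c \<otimes>\<^bsub>P\<^esub> hh i t) = cls (hsum i (\<lambda>s. if s > t then c (s - t) else 0))"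
  proof (rule cls_eqI)
    fix j b l assume "l \<le> 2 * N"
    show "coef (hsum i c \<otimes>\<^bsub>P\<^esub> hh i t) j b l = coef (hsum i (\<lambda>s. if s > t then c (s - t) else 0)) j b l"
    proof (cases "even l")
      case True
      then obtain k where k: "l = 2 * k" by (rule evenE)
      have "2 * k - 2 * t = 2 * (k - t)" "k - t \<le> N" using k \<open>l \<le> 2 * N\<close> by simp_all
      then show ?thesis using k \<open>l \<le> 2 * N\<close> assms(2)
        by (simp add: coef_mult_hh coef_hsum)
    next
      case False
      then show ?thesis using assms(2) by (auto simp: coef_mult_hh coef_hsum)
    qed
  qed simp_all
  then show ?thesis by (simp add: c A.cls_mult hspan_def)
qed

lemma hspan_central: "hspan i \<subseteq> carrier (HH0 Q)"
  by (auto simp: hspan_def cls_central_iff hsum_central)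

text \<open>Each of the four Leibniz terms contains an arrow of index \<open>i\<close>, so only
  zigzags of index \<open>i\<close> occur. Centrality of the image excludes odd lengths, and
  rotation by one arrow equates the two directions in every even length, \<open>2 * N\<close>
  included.\<close>

lemma der_hh_1:
  assumes d: "is_derivation Q d"
  shows "d (cls (hh i 1)) \<in> hspan i"
proof -
  let ?a = "zpath i True 1" and ?b = "zpath i False 1"
  obtain y where y: "y \<in> carrier P" "d (cls ?a) = cls y"
    using A.Q_cases[OF Q.der_closed[OF d A.cls_carrier[OF zpath_carrier]]] .
  obtain y' where y': "y' \<in> carrier P" "d (cls ?b) = cls y'"
    using A.Q_cases[OF Q.der_closed[OF d A.cls_carrier[OF zpath_carrier]]] .
  define x where "x = (y \<otimes>\<^bsub>P\<^esub> ?b + ?a \<otimes>\<^bsub>P\<^esub> y') + (y' \<otimes>\<^bsub>P\<^esub> ?a + ?b \<otimes>\<^bsub>P\<^esub> y)"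
  have x: "x \<in> carrier P" using y y' by (simp add: x_def)
  have "cls (hh i 1) = (cls ?a \<otimes>\<^bsub>Q\<^esub> cls ?b) \<oplus>\<^bsub>Q\<^esub> (cls ?b \<otimes>\<^bsub>Q\<^esub> cls ?a)"
    using arr_bar[of i] bar_arr[of i]
    by (simp add: A.cls_mult cls_add hh_def arr_zpath bar_zpath)
  then have "d (cls (hh i 1)) = d ((cls ?a \<otimes>\<^bsub>Q\<^esub> cls ?b) \<oplus>\<^bsub>Q\<^esub> (cls ?b \<otimes>\<^bsub>Q\<^esub> cls ?a))"
    by (simp only:)
  also have "\<dots> = ((d (cls ?a) \<otimes>\<^bsub>Q\<^esub> cls ?b) \<oplus>\<^bsub>Q\<^esub> (cls ?a \<otimes>\<^bsub>Q\<^esub> d (cls ?b))) \<oplus>\<^bsub>Q\<^esub>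
      ((d (cls ?b) \<otimes>\<^bsub>Q\<^esub> cls ?a) \<oplus>\<^bsub>Q\<^esub> (cls ?b \<otimes>\<^bsub>Q\<^esub> d (cls ?a)))"
    by (simp add: Q.der_add[OF d] Q.der_mult[OF d] A.cls_carrier)
  also have "\<dots> = cls x"
    unfolding y(2) y'(2) using y(1) y'(1) by (simp add: A.cls_mult cls_add x_def)
  finally have dx: "d (cls (hh i 1)) = cls x" .
  have "cls x \<in> carrier (HH0 Q)"
    unfolding dx[symmetric] using Q.HH0_der[OF d] by (simp add: cls_central_iff hh_central)
  then have central: "central_coef x" using x by (simp add: cls_central_iff)
  \<comment> \<open>Each zigzag receives one contribution by removing its last arrow and one by
    removing its first arrow.\<close>
  have coef_x: "coef x j b l = (if l > 0 \<and> i mod int m = j mod int m then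
      (if (b = even (l - 1)) = False then coef y j b (l - 1) else coef y' j b (l - 1)) +
      (if b then coef y' j (\<not> b) (l - 1) else coef y j (\<not> b) (l - 1)) else 0)" for j b l
  proof (cases "l > 0 \<and> i mod int m = j mod int m")
    case True
    then show ?thesis
      by (cases b) (simp_all add: x_def coef_add coef_mult_zpath coef_zpath_mult Suc_le_eq)
  next
    case False
    then have "\<not> (1 \<le> l \<and> i mod int m = j mod int m \<and> R)" for R by auto
    then show ?thesis
      by (simp only: False x_def coef_add coef_mult_zpath[OF zero_less_one]
          coef_zpath_mult[OF zero_less_one] if_False add_0)
  qed
  have "cls x = cls (hsum i (\<lambda>s. coef x i True (2 * s)))"
  proof (rule cls_eqI[OF x hsum_carrier])
    fix j b l assume l: "l \<le> 2 * N"
    show "coef x j b l = coef (hsum i (\<lambda>s. coef x i True (2 * s))) j b l"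
    proof (cases "i mod int m = j mod int m \<and> l > 0")
      case True
      then have j: "coef x j b l = coef x i b l" by (metis coef_cong)
      show ?thesis
      proof (cases "even l")
        case even: True
        \<comment> \<open>For even \<open>l\<close> both directions give the sum of the same two
          coefficients: that of \<open>y\<close> on the zigzag starting with \<open>Arr\<close> and
          that of \<open>y'\<close> on the one starting with \<open>Bar\<close>, each of length
          \<open>l - 1\<close>.\<close>
        then have "coef x i b l = coef x i True l"
          using True by (cases b) (simp_all add: coef_x)
        then show ?thesis using j even True l by (simp add: coef_hsum)
      next
        case False
        then have "l < 2 * N" using l by (cases "l = 2 * N") auto
        then show ?thesis using False central_coefD(1)[OF central] by (simp add: coef_hsum)
      qed
    next
      case False
      then have "\<not> (l > 0 \<and> i mod int m = j mod int m)" by blast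
      then have "coef x j b l = 0" by (simp only: coef_x if_False)
      moreover have "coef (hsum i (\<lambda>s. coef x i True (2 * s))) j b l = 0"
        unfolding coef_hsum using False by (simp only: if_False simp_thms split: if_split) blast
      ultimately show ?thesis by simp
    qed
  qed
  then have "cls x \<in> hspan i" by (simp add: hspan_def)
  then show ?thesis by (simp only: dx)
qed

text \<open>Leibniz rule for \<open>f\<^sub>i\<^sup>s f\<^sub>i\<close>. The factor
  \<open>d f\<^sub>i\<close> is central, so both terms are an element of \<open>hspan i\<close>
  times a power of \<open>f\<^sub>i\<close>.\<close>

lemma der_hh:
  assumes d: "is_derivation Q d"
  shows "s > 0 \<Longrightarrow> d (cls (hh i s)) \<in> hspan i"
proof (induction s rule: nat_induct_non_zero)
  case 1
  show ?case using der_hh_1[OF d] by simp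
next
  case (Suc s)
  have U: "d (cls (hh i 1)) \<in> carrier (HH0 Q)" using der_hh_1[OF d] hspan_central by blast
  have "cls (hh i (Suc s)) = cls (hh i s) \<otimes>\<^bsub>Q\<^esub> cls (hh i 1)"
    by (simp add: A.cls_mult hh_mult)
  then have "d (cls (hh i (Suc s))) = (d (cls (hh i s)) \<otimes>\<^bsub>Q\<^esub> cls (hh i 1)) \<oplus>\<^bsub>Q\<^esub> (cls (hh i s) \<otimes>\<^bsub>Q\<^esub> d (cls (hh i 1)))"
    using d by (simp add: Q.der_mult A.cls_carrier)
  also have "cls (hh i s) \<otimes>\<^bsub>Q\<^esub> d (cls (hh i 1)) = d (cls (hh i 1)) \<otimes>\<^bsub>Q\<^esub> cls (hh i s)"
    using U A.cls_carrier[OF hh_carrier] unfolding Q.HH0_carrier by auto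
  finally show ?case
    using hspan_mult_hh[OF Suc.IH, of 1] hspan_mult_hh[OF der_hh_1[OF d] Suc.hyps] hspan_submodule[of i]
    by (simp add: submodule_Q_iff)
qed

text \<open>The preimage of \<open>hspan i\<close> under \<open>d\<close> is a subspace, so it
  suffices to treat the generators.\<close>

lemma der_hspan:
  assumes d: "is_derivation Q d" and U: "U \<in> hspan i"
  shows "d U \<in> hspan i"
proof -
  let ?T = "{U \<in> carrier Q. d U \<in> hspan i}"
  have "submodule ?T (scalars :: 'k ring) Q"
    using hspan_submodule[of i] d unfolding submodule_Q_iff
    by (auto simp: Q.der_add Q.der_smult Q.der_zero)
  moreover have "cls (hh i s) \<in> ?T" if "s \<in> {1..N}" for s
    using der_hh[OF d, of s] that by (auto simp: A.cls_carrier)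
  ultimately have "cls (hsum i c) \<in> ?T" for c by (rule submodule_cls_hsum)
  then show ?thesis using U by (auto simp: hspan_def)
qed

lemma summand_submodule: "submodule (summand m N j) (scalars :: 'k ring) Q"
proof (cases j)
  case None
  have "submodule (linear_span Q {\<one>\<^bsub>Q\<^esub>}) (scalars :: 'k ring) Q"
    unfolding linear_span_def submodule_Q_iff by auto
  then show ?thesis by (simp add: None summand_def algA_def)
next
  case (Some i)
  then show ?thesis by (simp add: summand_Some hspan_submodule)
qed

lemma der_summand:
  assumes d: "is_derivation Q d" and U: "U \<in> summand m N j"
  shows "d U \<in> summand m N j"
proof (cases j)
  case None
  then obtain c where "U = c \<odot>\<^bsub>Q\<^esub> \<one>\<^bsub>Q\<^esub>"
    using U by (auto simp: summand_None cls_scale simp flip: A.cls_one)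
  then have "d U = \<zero>\<^bsub>Q\<^esub>" using d Q.smult_r_null[of c] by (simp add: Q.der_smult Q.der_one)
  then show ?thesis using summand_submodule[of j] by (simp add: submodule_Q_iff)
next
  case (Some i)
  then show ?thesis using U der_hspan[OF d] by (simp add: summand_Some)
qed

lemma summand_lie_submodule:
  "lie_submodule (summand m N j) (scalars :: 'k ring) (HH1 Q) (HH0 Q) HH1_act"
proof (intro lie_submodule.intro lie_submodule_axioms.intro)
  show "submodule (summand m N j) (scalars :: 'k ring) (HH0 Q)"
    using summand_submodule[of j] summand_subset[of j]
    unfolding submodule_Q_iff submodule_scalars_iff[OF Q.HH0_module] by (simp add: Q.HH0_simps)
  fix C and U :: "'k kQ set" assume "C \<in> carrier (HH1 Q)" and U: "U \<in> summand m N j"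
  then obtain d where "is_derivation Q d" "C = Q.Inner.cls d" using Q.HH1_cases by blast
  then show "HH1_act C U \<in> summand m N j"
    using U summand_subset[of j] by (simp add: Q.HH1_act_class der_summand subset_iff)
qed

section \<open>The derivations used for indecomposability\<close>

definition count_arr :: "arrow list \<Rightarrow> nat" where
  "count_arr p = length (filter (\<lambda>e. case e of Arr _ \<Rightarrow> True | Bar _ \<Rightarrow> False) p)"

text \<open>The Euler derivation of the grading of the path algebra by the number of
  \<open>Arr\<close> arrows.\<close>

definition degree_der :: "'k kQ \<Rightarrow> 'k kQ" where
  "degree_der x = Poly_Mapping.mapp (\<lambda>(u, p) a. of_nat (count_arr p) * a) x"

lemma lookup_degree_der: "lk (degree_der x) (u, p) = of_nat (count_arr p) * lk x (u, p)"
  by (simp add: degree_der_def lookup_mapp when_def in_keys_iff)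

lemma coef_degree_der: "coef (degree_der x) i b l = of_nat (count_arr (zz i b l)) * coef x i b l"
  by (simp add: coef_def lookup_degree_der)

lemma count_arr_append: "count_arr (p @ q) = count_arr p + count_arr q"
  by (simp add: count_arr_def)

lemma count_arr_zz: "count_arr (zz i b (2 * s)) = s"
proof (induction s)
  case 0
  show ?case by (simp add: count_arr_def)
next
  case (Suc s)
  have "zz i b (2 * Suc s) = [arw i b, arw i (\<not> b)] @ zz i b (2 * s)" by simp
  moreover have "count_arr [arw i b, arw i (\<not> b)] = 1" by (cases b) (simp_all add: count_arr_def arw_def)
  ultimately show ?case using Suc by (simp only: count_arr_append)
qed

lemma degree_der_carrier [simp, intro]: "x \<in> carrier P \<Longrightarrow> degree_der x \<in> carrier P"
  by (rule G.carrierI) (auto simp: lookup_degree_der G.lookup_outside)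

lemma degree_der_add: "degree_der (x + y) = degree_der x + degree_der y"
  by (rule poly_mapping_eqI) (auto simp: lookup_degree_der lookup_add algebra_simps)

lemma degree_der_scale: "degree_der (scale c x) = scale c (degree_der x)"
  by (rule poly_mapping_eqI) (auto simp: lookup_degree_der lookup_scale)

lemma degree_der_mult:
  "degree_der (x \<otimes>\<^bsub>P\<^esub> y) = degree_der x \<otimes>\<^bsub>P\<^esub> y + x \<otimes>\<^bsub>P\<^esub> degree_der y"
proof (rule poly_mapping_eqI)
  fix c :: "int \<times> arrow list"
  obtain u r where c: "c = (u, r)" by (cases c)
  have cnt: "of_nat (count_arr r) = (of_nat (count_arr (take k r)) + of_nat (count_arr (drop k r)) :: 'k)" for k
    using count_arr_append[of "take k r" "drop k r"] by (simp flip: of_nat_add)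
  show "lk (degree_der (x \<otimes>\<^bsub>P\<^esub> y)) c = lk (degree_der x \<otimes>\<^bsub>P\<^esub> y + x \<otimes>\<^bsub>P\<^esub> degree_der y) c"
    unfolding c lookup_add lookup_degree_der lookup_path_mult sum_distrib_left sum.distrib[symmetric]
  proof (intro sum.cong refl)
    fix k
    show "of_nat (count_arr r) * (lk x (u, take k r) * lk y (G.awlast u (take k r), drop k r)) =
      of_nat (count_arr (take k r)) * lk x (u, take k r) * lk y (G.awlast u (take k r), drop k r) +
      lk x (u, take k r) * (of_nat (count_arr (drop k r)) * lk y (G.awlast u (take k r), drop k r))"
      unfolding cnt[of k] by (simp only: algebra_simps)
  qed
qed

text \<open>The relations are homogeneous: both zigzags of length \<open>2 * N\<close> at a vertex
  contain \<open>N\<close> arrows of type \<open>Arr\<close>, so \<open>topc\<close> is simply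
  multiplied by \<open>N\<close>.\<close>

lemma degree_der_cong:
  assumes "x \<in> carrier P" "y \<in> carrier P" "cls x = cls y"
  shows "cls (degree_der x) = cls (degree_der y)"
proof -
  have "topc (degree_der z) i = of_nat N * topc z i" for z i
    by (simp add: topc_def coef_degree_der count_arr_zz distrib_left)
  then show ?thesis using assms by (simp add: cls_eq coef_degree_der)
qed

text \<open>
  \<open>degree_der\<close> induces the derivation \<open>\<phi>\<^sub>1\<^sub>,\<^sub>0\<close> of the quotient, and \<open>hder i s\<close> is its product with
  the central element \<open>f\<^sub>i\<^sup>s\<close>. That is the derivation \<open>E\<^sub>1\<^sub>,\<^sub>i\<^sub>,\<^sub>s\<close>.
\<close>

definition hder :: "int \<Rightarrow> nat \<Rightarrow> 'k kQ set \<Rightarrow> 'k kQ set" where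
  "hder i s = (\<lambda>U\<in>carrier Q. cls (hh i s \<otimes>\<^bsub>P\<^esub> degree_der (SOME x. x \<in> carrier P \<and> U = cls x)))"

text \<open>Independence of the representative picked by \<open>SOME\<close> is
  \<open>degree_der_cong\<close>.\<close>

lemma hder_cls:
  assumes "x \<in> carrier P"
  shows "hder i s (cls x) = cls (hh i s) \<otimes>\<^bsub>Q\<^esub> cls (degree_der x)"
proof -
  define y where "y = (SOME y. y \<in> carrier P \<and> cls x = cls y)"
  have y: "y \<in> carrier P" "cls x = cls y"
    using someI[of "\<lambda>y. y \<in> carrier P \<and> cls x = cls y" x] assms by (auto simp: y_def)
  have "hder i s (cls x) = cls (hh i s \<otimes>\<^bsub>P\<^esub> degree_der y)"
    using assms by (simp add: hder_def A.cls_carrier y_def)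
  also have "\<dots> = cls (hh i s) \<otimes>\<^bsub>Q\<^esub> cls (degree_der y)" using y by (simp add: A.cls_mult)
  also have "cls (degree_der y) = cls (degree_der x)"
    using degree_der_cong[OF y(1) assms] y(2) by simp
  finally show ?thesis .
qed

lemma hder_derivation:
  assumes "s > 0"
  shows "is_derivation Q (hder i s)"
proof (rule Q.is_derivationI)
  have "hder i s U \<in> carrier Q" if U: "U \<in> carrier Q" for U
  proof -
    obtain x where "x \<in> carrier P" "U = cls x" using U by (rule A.Q_cases)
    then show ?thesis by (simp add: hder_cls A.cls_carrier)
  qed
  then show "hder i s \<in> carrier Q \<rightarrow>\<^sub>E carrier Q" by (auto simp: hder_def)
  fix U assume "U \<in> carrier Q"
  then obtain x where x: "x \<in> carrier P" "U = cls x" by (rule A.Q_cases)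
  show "hder i s (c \<odot>\<^bsub>Q\<^esub> U) = c \<odot>\<^bsub>Q\<^esub> hder i s U" for c
  proof -
    have "hder i s (c \<odot>\<^bsub>Q\<^esub> U) = cls (hh i s) \<otimes>\<^bsub>Q\<^esub> (c \<odot>\<^bsub>Q\<^esub> cls (degree_der x))"
      using x by (simp add: cls_scale hder_cls degree_der_scale)
    also have "\<dots> = c \<odot>\<^bsub>Q\<^esub> hder i s U"
      using x by (simp add: hder_cls Q.mult_smult_right A.cls_carrier)
    finally show ?thesis .
  qed
  fix Y assume "Y \<in> carrier Q"
  then obtain y where y: "y \<in> carrier P" "Y = cls y" by (rule A.Q_cases)
  show "hder i s (U \<oplus>\<^bsub>Q\<^esub> Y) = hder i s U \<oplus>\<^bsub>Q\<^esub> hder i s Y"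
  proof -
    have "hder i s (U \<oplus>\<^bsub>Q\<^esub> Y) = cls (hh i s) \<otimes>\<^bsub>Q\<^esub> (cls (degree_der x) \<oplus>\<^bsub>Q\<^esub> cls (degree_der y))"
      using x y by (simp add: cls_add hder_cls degree_der_add)
    also have "\<dots> = hder i s U \<oplus>\<^bsub>Q\<^esub> hder i s Y"
      using x y by (simp add: hder_cls Q.r_distr A.cls_carrier)
    finally show ?thesis .
  qed
  have h: "cls (hh i s) \<in> carrier (HH0 Q)" using assms by (simp add: cls_central_iff hh_central)
  then have comm: "cls (hh i s) \<otimes>\<^bsub>Q\<^esub> U = U \<otimes>\<^bsub>Q\<^esub> cls (hh i s)"
    using x by (simp add: Q.HH0_carrier A.cls_carrier)
  have c: "cls (hh i s) \<in> carrier Q" "U \<in> carrier Q" "Y \<in> carrier Q"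
    "cls (degree_der x) \<in> carrier Q" "cls (degree_der y) \<in> carrier Q"
    using x y by (simp_all add: A.cls_carrier)
  have "hder i s (U \<otimes>\<^bsub>Q\<^esub> Y) = cls (hh i s) \<otimes>\<^bsub>Q\<^esub> ((cls (degree_der x) \<otimes>\<^bsub>Q\<^esub> Y) \<oplus>\<^bsub>Q\<^esub> (U \<otimes>\<^bsub>Q\<^esub> cls (degree_der y)))"
    using x y by (simp add: A.cls_mult hder_cls degree_der_mult cls_add)
  also have "\<dots> = ((cls (hh i s) \<otimes>\<^bsub>Q\<^esub> cls (degree_der x)) \<otimes>\<^bsub>Q\<^esub> Y) \<oplus>\<^bsub>Q\<^esub> ((cls (hh i s) \<otimes>\<^bsub>Q\<^esub> U) \<otimes>\<^bsub>Q\<^esub> cls (degree_der y))"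
    using c by (simp add: Q.r_distr Q.m_assoc)
  \<comment> \<open>Centrality moves the factor past \<open>U\<close>; this is what makes the
    product of a derivation with a central element a derivation again.\<close>
  also have "\<dots> = ((cls (hh i s) \<otimes>\<^bsub>Q\<^esub> cls (degree_der x)) \<otimes>\<^bsub>Q\<^esub> Y) \<oplus>\<^bsub>Q\<^esub> (U \<otimes>\<^bsub>Q\<^esub> (cls (hh i s) \<otimes>\<^bsub>Q\<^esub> cls (degree_der y)))"
    using c by (simp only: comm Q.m_assoc)
  also have "\<dots> = (hder i s U \<otimes>\<^bsub>Q\<^esub> Y) \<oplus>\<^bsub>Q\<^esub> (U \<otimes>\<^bsub>Q\<^esub> hder i s Y)"
    using x y by (simp add: hder_cls)
  finally show "hder i s (U \<otimes>\<^bsub>Q\<^esub> Y) = (hder i s U \<otimes>\<^bsub>Q\<^esub> Y) \<oplus>\<^bsub>Q\<^esub> (U \<otimes>\<^bsub>Q\<^esub> hder i s Y)" .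
qed

text \<open>A closed zigzag of length \<open>2 * t\<close> contains \<open>t\<close> arrows of type
  \<open>Arr\<close>, so \<open>f\<^sub>i\<^sup>t\<close> goes to \<open>t\<close> times the power
  with exponent \<open>t + r\<close>. For \<open>t = 1\<close> the factor is 1 in every
  characteristic.\<close>

lemma hder_hsum:
  assumes "r > 0"
  shows "hder i r (cls (hsum i c)) = cls (hsum i (\<lambda>t. if t > r then of_nat (t - r) * c (t - r) else 0))"
proof -
  have "cls (hh i r \<otimes>\<^bsub>P\<^esub> degree_der (hsum i c)) = cls (hsum i (\<lambda>t. if t > r then of_nat (t - r) * c (t - r) else 0))"
  proof (rule cls_eqI)
    fix j b l assume "l \<le> 2 * N"
    show "coef (hh i r \<otimes>\<^bsub>P\<^esub> degree_der (hsum i c)) j b l =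
        coef (hsum i (\<lambda>t. if t > r then of_nat (t - r) * c (t - r) else 0)) j b l"
    proof (cases "even l")
      case True
      then obtain k where k: "l = 2 * k" by (rule evenE)
      have "2 * k - 2 * r = 2 * (k - r)" "k - r \<le> N" using k \<open>l \<le> 2 * N\<close> by simp_all
      then show ?thesis using k \<open>l \<le> 2 * N\<close> assms
        by (simp add: coef_mult_hh coef_hsum coef_degree_der count_arr_zz)
    next
      case False
      then show ?thesis using assms by (auto simp: coef_mult_hh coef_hsum coef_degree_der)
    qed
  qed simp_all
  then show ?thesis by (simp add: hder_cls A.cls_mult)
qed

end

section \<open>Indecomposability\<close>

text \<open>One vector \<open>v\<close> suffices if every splitting \<open>v = u \<oplus> w\<close>
  has a summand whose submodule is everything; the complementary submodule then equals the zero
  intersection.\<close>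

lemma indecomposableI:
  assumes "lie_module R L V act" "carrier V \<noteq> {\<zero>\<^bsub>V\<^esub>}" "v \<in> carrier V"
    and full: "\<And>U W u w. lie_submodule U R L V act \<Longrightarrow> lie_submodule W R L V act \<Longrightarrow>
      u \<in> U \<Longrightarrow> w \<in> W \<Longrightarrow> v = u \<oplus>\<^bsub>V\<^esub> w \<Longrightarrow> carrier V \<subseteq> U \<or> carrier V \<subseteq> W"
  shows "indecomposable_lie_module R L V act"
  unfolding indecomposable_lie_module_def
proof (intro conjI allI impI assms(1,2))
  fix U W
  assume *: "lie_submodule U R L V act \<and> lie_submodule W R L V act \<and>
    U \<inter> W = {\<zero>\<^bsub>V\<^esub>} \<and> U <+>\<^bsub>V\<^esub> W = carrier V"
  interpret V: lie_module R L V act by fact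
  have sub: "U \<subseteq> carrier V" "W \<subseteq> carrier V"
    using * V.V.submoduleE(1) lie_submodule.axioms(1) by blast+
  have "v \<in> U <+>\<^bsub>V\<^esub> W" using * assms(3) by simp
  then obtain u w where "u \<in> U" "w \<in> W" "v = u \<oplus>\<^bsub>V\<^esub> w" by (auto simp: set_add_def')
  then have "carrier V \<subseteq> U \<or> carrier V \<subseteq> W" using full * by blast
  then show "U = {\<zero>\<^bsub>V\<^esub>} \<or> W = {\<zero>\<^bsub>V\<^esub>}"
  proof
    assume "carrier V \<subseteq> U"
    then have "W = U \<inter> W" using sub by blast
    then show ?thesis using * by simp
  next
    assume "carrier V \<subseteq> W"
    then have "U = U \<inter> W" using sub by blast
    then show ?thesis using * by simp
  qed
qed

context zigzag
begin

section \<open>Submodules of a single summand\<close>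

abbreviation restricted :: "int option \<Rightarrow> ('k, 'k kQ set) module" where
  "restricted j \<equiv> HH0 Q\<lparr>carrier := summand m N j\<rparr>"

lemma restricted_lie_module: "lie_module (scalars :: 'k ring) (HH1 Q) (restricted j) HH1_act"
  by (rule lie_module_restrict[OF Q.HH0_lie_module summand_lie_submodule])

lemma restricted_submodule:
  assumes "lie_submodule U (scalars :: 'k ring) (HH1 Q) (restricted j) HH1_act"
  shows "submodule U (scalars :: 'k ring) Q" "U \<subseteq> summand m N j"
proof -
  have "submodule U (scalars :: 'k ring) (restricted j)"
    using assms by (rule lie_submodule.axioms(1))
  moreover have "module (scalars :: 'k ring) (restricted j)"
    using restricted_lie_module[of j] by (rule lie_module.axioms(2))
  ultimately have U: "U \<subseteq> summand m N j" "\<zero>\<^bsub>Q\<^esub> \<in> U" "\<forall>x\<in>U. \<forall>y\<in>U. x \<oplus>\<^bsub>Q\<^esub> y \<in> U" "\<forall>c. \<forall>x\<in>U. c \<odot>\<^bsub>Q\<^esub> x \<in> U"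
    by (simp_all add: submodule_scalars_iff Q.HH0_simps)
  then show "submodule U (scalars :: 'k ring) Q" "U \<subseteq> summand m N j"
    using summand_submodule[of j] by (auto simp: submodule_Q_iff)
qed

lemma restricted_hder:
  assumes "lie_submodule U (scalars :: 'k ring) (HH1 Q) (restricted j) HH1_act" "u \<in> U" "r > 0"
  shows "hder i r u \<in> U"
proof -
  have d: "is_derivation Q (hder i r)" by (rule hder_derivation[OF assms(3)])
  have "HH1_act (Q.Inner.cls (hder i r)) u \<in> U"
    using lie_submodule.act_stable[OF assms(1) Q.HH1_class[OF d] assms(2)] .
  moreover have "u \<in> carrier (HH0 Q)"
    using restricted_submodule(2)[OF assms(1)] assms(2) summand_subset[of j] by blast
  ultimately show ?thesis using d by (simp add: Q.HH1_act_class)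
qed

text \<open>
  Applying \<open>hder i (s - 1)\<close> shifts the coefficient of \<open>f\<^sub>i\<close> to the \<open>s\<close>-th power, so the powers of
  \<open>f\<^sub>i\<close> are obtained one after the other, starting with the highest.
\<close>

lemma hh_generated:
  assumes U: "lie_submodule U (scalars :: 'k ring) (HH1 Q) (restricted j) HH1_act"
    and c: "cls (hsum i c) \<in> U" "c 1 \<noteq> 0"
  shows "hspan i \<subseteq> U"
proof -
  note sub = restricted_submodule(1)[OF U]
  have "cls (hh i s) \<in> U" if "s \<in> {1..N}" for s
    using that
  proof (induction "N - s" arbitrary: s rule: less_induct)
    case less
    \<comment> \<open>An element of \<open>U\<close> whose lowest power of \<open>f\<^sub>i\<close>
      has exponent \<open>s\<close>: the given one for \<open>s = 1\<close>, otherwise its image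
      under \<open>hder i (s - 1)\<close>, with coefficient \<open>c 1\<close> at
      \<open>s\<close>.\<close>
    obtain a where a: "cls (hsum i a) \<in> U" "a s \<noteq> 0" "\<And>t. t < s \<Longrightarrow> t \<ge> 1 \<Longrightarrow> a t = 0"
    proof (cases "s = 1")
      case True
      then show ?thesis using c by (intro that[of c]) auto
    next
      case False
      then have s: "s - 1 > 0" using less.prems by auto
      show ?thesis
      proof (rule that)
        show "cls (hsum i (\<lambda>t. if t > s - 1 then of_nat (t - (s - 1)) * c (t - (s - 1)) else 0)) \<in> U"
          using restricted_hder[OF U c(1) s, of i] by (simp only: hder_hsum[OF s])
        show "(if s > s - 1 then of_nat (s - (s - 1)) * c (s - (s - 1)) else 0) \<noteq> 0"
          using c(2) s by simp
      qed simp
    qed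
    \<comment> \<open>Cancels the terms with exponents above \<open>s\<close>, which are in
      \<open>U\<close> by induction; after that \<open>a s\<close> is divided out.\<close>
    have "cls (hsum i (\<lambda>t. if t = s then 0 else - a t)) \<in> U"
      unfolding hsum_def
    proof (rule submodule_cls_sum[OF sub])
      fix t assume t: "t \<in> {1..N}"
      show "cls (scale (if t = s then 0 else - a t) (hh i t)) \<in> U"
      proof (cases "t > s")
        case True
        then have "cls (hh i t) \<in> U" using t less.prems by (intro less.hyps) auto
        then show ?thesis by (intro submodule_cls_scale[OF sub]) simp_all
      next
        case False
        then have "(if t = s then 0 else - a t) = 0" using a(3)[of t] t by auto
        moreover have "scale 0 (hh i t) = 0" by (rule poly_mapping_eqI) (simp add: lookup_scale)
        ultimately show ?thesis using sub by (simp only: cls_zero submodule_Q_iff)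
      qed
    qed simp
    then have "cls (hsum i a) \<oplus>\<^bsub>Q\<^esub> cls (hsum i (\<lambda>t. if t = s then 0 else - a t)) \<in> U"
      using sub a(1) by (simp add: submodule_Q_iff)
    also have "cls (hsum i a) \<oplus>\<^bsub>Q\<^esub> cls (hsum i (\<lambda>t. if t = s then 0 else - a t)) = cls (scale (a s) (hh i s))"
      using less.prems by (simp add: cls_add, intro cls_eqI) (auto simp: coef_add coef_hsum coef_scale coef_hh elim!: evenE)
    finally have "cls (scale (inverse (a s)) (scale (a s) (hh i s))) \<in> U"
      using submodule_cls_scale[OF sub carrier_scale[OF hh_carrier]] by blast
    moreover have "scale (inverse (a s)) (scale (a s) (hh i s)) = hh i s"
      using a(2) by (intro poly_mapping_eqI) (simp add: lookup_scale)
    ultimately show ?case by (simp only:)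
  qed
  then show ?thesis unfolding hspan_def using submodule_cls_hsum[OF sub] by blast
qed

lemma unit_generated:
  assumes U: "lie_submodule U (scalars :: 'k ring) (HH1 Q) (restricted j) HH1_act"
    and a: "cls (scale a unit) \<in> U" "a \<noteq> 0"
  shows "summand m N None \<subseteq> U"
proof -
  have "cls (scale b unit) \<in> U" for b
  proof -
    have "cls (scale (b / a) (scale a unit)) \<in> U"
      using submodule_cls_scale[OF restricted_submodule(1)[OF U] carrier_scale[OF P.one_closed] a(1)] .
    moreover have "scale (b / a) (scale a unit) = scale b unit"
      using a(2) by (intro poly_mapping_eqI) (simp add: lookup_scale)
    ultimately show ?thesis by (simp only:)
  qed
  then show ?thesis by (auto simp: summand_None)
qed

lemma summand_indecomposable:
  "indecomposable_lie_module (scalars :: 'k ring) (HH1 Q) (restricted j) HH1_act"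
proof (cases j)
  case None
  have v: "cls (scale 1 unit) \<in> summand m N None" by (auto simp: summand_None)
  have nz: "cls (scale 1 unit) \<noteq> \<zero>\<^bsub>Q\<^esub>"
  proof
    assume "cls (scale 1 unit) = \<zero>\<^bsub>Q\<^esub>"
    then have "coef (scale 1 unit) 0 True 0 = coef 0 0 True 0"
      using N_ge by (simp add: cls_eq flip: cls_zero)
    then show False by (simp add: coef_scale coef_one coef_zero)
  qed
  show ?thesis
  proof (rule indecomposableI[OF restricted_lie_module])
    show "carrier (restricted j) \<noteq> {\<zero>\<^bsub>restricted j\<^esub>}" using v nz None by (auto simp: Q.HH0_simps)
    show "cls (scale 1 unit) \<in> carrier (restricted j)" using v None by simp
    fix U W u w
    assume U: "lie_submodule U (scalars :: 'k ring) (HH1 Q) (restricted j) HH1_act"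
      and W: "lie_submodule W (scalars :: 'k ring) (HH1 Q) (restricted j) HH1_act"
      and uw: "u \<in> U" "w \<in> W" "cls (scale 1 unit) = u \<oplus>\<^bsub>restricted j\<^esub> w"
    obtain a where a: "u = cls (scale a unit)"
      using restricted_submodule(2)[OF U] uw(1) by (auto simp: None summand_None)
    obtain b where b: "w = cls (scale b unit)"
      using restricted_submodule(2)[OF W] uw(2) by (auto simp: None summand_None)
    have "cls (scale 1 unit) = cls (scale a unit + scale b unit)"
      using uw(3) by (simp add: a b Q.HH0_simps cls_add)
    then have "coef (scale 1 unit) 0 True 0 = coef (scale a unit + scale b unit) 0 True 0"
      using N_ge by (simp add: cls_eq)
    then have "a \<noteq> 0 \<or> b \<noteq> 0" by (auto simp: coef_scale coef_add coef_one)
    then show "carrier (restricted j) \<subseteq> U \<or> carrier (restricted j) \<subseteq> W"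
      using unit_generated[OF U, of a] unit_generated[OF W, of b] uw(1,2) None by (auto simp: a b)
  qed
next
  case (Some i)
  \<comment> \<open>The coefficient of \<open>f\<^sub>i\<close> is well defined on classes. If
    \<open>N = 1\<close>, then \<open>f\<^sub>i\<close> already lies in length \<open>2 * N\<close>
    and the coefficient is seen only through \<open>topc\<close>; otherwise it is an ordinary
    coefficient in length 2.\<close>
  have eq1: "c 1 = d 1" if "cls (hsum i c) = cls (hsum i d)" for c d
  proof (cases "N = 1")
    case True
    have "topc (hsum i c) i = topc (hsum i d) i" using that by (simp add: cls_eq)
    then have "c N = d N" by (simp add: topc_hsum pred_not_cong pred_not_cong[symmetric])
    then show ?thesis using True by simp
  next
    case False
    then have "coef (hsum i c) i True 2 = coef (hsum i d) i True 2"
      using that N_ge by (simp add: cls_eq)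
    then show ?thesis using N_ge by (simp add: coef_hsum)
  qed
  \<comment> \<open>\<open>hsum i e\<close> represents \<open>f\<^sub>i\<close>, the vector to be
    split.\<close>
  define e where "e s = (if s = 1 then 1 else 0 :: 'k)" for s :: nat
  have v: "cls (hsum i e) \<in> hspan i" by (simp add: hspan_def)
  have nz: "cls (hsum i e) \<noteq> \<zero>\<^bsub>Q\<^esub>"
  proof
    assume *: "cls (hsum i e) = \<zero>\<^bsub>Q\<^esub>"
    have "\<zero>\<^bsub>Q\<^esub> = cls (hsum i (\<lambda>_. 0))"
      unfolding cls_zero[symmetric] by (rule cls_eqI) (simp_all add: coef_hsum coef_zero)
    with * have "e 1 = 0" using eq1[of e "\<lambda>_. 0"] by simp
    then show False by (simp add: e_def)
  qed
  show ?thesis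
  proof (rule indecomposableI[OF restricted_lie_module])
    show "carrier (restricted j) \<noteq> {\<zero>\<^bsub>restricted j\<^esub>}"
      using v nz by (auto simp: Some summand_Some Q.HH0_simps)
    show "cls (hsum i e) \<in> carrier (restricted j)" using v by (simp add: Some summand_Some)
    fix U W u w
    assume U: "lie_submodule U (scalars :: 'k ring) (HH1 Q) (restricted j) HH1_act"
      and W: "lie_submodule W (scalars :: 'k ring) (HH1 Q) (restricted j) HH1_act"
      and uw: "u \<in> U" "w \<in> W" "cls (hsum i e) = u \<oplus>\<^bsub>restricted j\<^esub> w"
    obtain a where a: "u = cls (hsum i a)"
      using restricted_submodule(2)[OF U] uw(1) by (auto simp: Some summand_Some hspan_def)
    obtain b where b: "w = cls (hsum i b)"
      using restricted_submodule(2)[OF W] uw(2) by (auto simp: Some summand_Some hspan_def)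
    have "cls (hsum i e) = cls (hsum i a + hsum i b)"
      using uw(3) by (simp add: a b Q.HH0_simps cls_add)
    also have "\<dots> = cls (hsum i (\<lambda>s. a s + b s))"
      by (rule cls_eqI) (simp_all add: coef_hsum coef_add)
    finally have "e 1 = a 1 + b 1" using eq1[of e "\<lambda>s. a s + b s"] by simp
    then have "a 1 \<noteq> 0 \<or> b 1 \<noteq> 0" by (auto simp: e_def)
    then have "hspan i \<subseteq> U \<or> hspan i \<subseteq> W"
      using hh_generated[OF U, of i a] hh_generated[OF W, of i b] uw(1,2) by (auto simp: a b)
    then show "carrier (restricted j) \<subseteq> U \<or> carrier (restricted j) \<subseteq> W"
      by (simp add: Some summand_Some)
  qed
qed

lemma decomposition:
  assumes "odd m" "(2::'k) \<noteq> 0"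
  shows "indecomposable_decomposition (scalars :: 'k ring) (HH1 Q) (HH0 Q) HH1_act (summand_index m) (summand m N)"
  unfolding indecomposable_decomposition_def
  using Q.HH0_lie_module direct_sum[OF assms] summand_lie_submodule summand_indecomposable by blast

end

theorem theorem9p3p2:
  fixes N m :: nat
  assumes "N \<ge> 1" and "m \<ge> 3" and "odd m"
    and "\<not> CHAR('k::field) dvd 2"
    and "\<not> CHAR('k) dvd N"
    and "\<not> CHAR('k) dvd m"
  shows "indecomposable_decomposition (ring_of_type_algebra :: 'k ring)
           (HH1 (algA m N)) (HH0 (algA m N)) HH1_act (summand_index m) (summand m N)"
proof -
  interpret zigzag m N "TYPE('k)" by unfold_locales (use assms in auto)
  have "(2::'k) \<noteq> 0"
    using assms(4) of_nat_eq_0_iff_char_dvd[of 2, where 'a = 'k] by simp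
  then show ?thesis using decomposition[OF assms(3)] by (simp add: algA_def)
qed

end
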